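(* Let $(b_k)_{k\ge 0}$ be a strictly decreasing sequence of real numbers with $b_0=1$ and $\lim_{k\to\infty}b_k=0$. For each $k\in\mathbb{N}$ let $g_k:[0,1]\to[b_k,b_{k-1}]$ be a decreasing $C^2$ diffeomorphism onto $[b_k,b_{k-1}]$ (so $g_k(0)=b_{k-1}$, $g_k(1)=b_k$) which extends as a $C^2$ diffeomorphism to some neighborhood of $[0,1]$. Let $S_n=\{g_1,\dots,g_n\}$, let $J_n$ be its limit set and $h_n$ the Hausdorff dimension of $J_n$. Assume: (i) $\lim_{n\to\infty}(1-h_n)\ln n=0$; (ii) $\lim_{n\to\infty}\sup_{k\ge n}\left\{\frac{b_k}{b_{k+1}}\right\}=1$; (iii) there is a constant $c\in(0,\infty)$ such that $\left|\frac{g_n''(x)}{g_n'(x)}\right|<c$ for all $n\in\mathbb{N}$ and $x\in[0,1]$; (iv) $\lim_{n\to\infty}\kappa(g_n)=1$; (v) there is a constant $\alpha<1$ such that $|g_n'(x)|<\alpha$ for all $n\in\mathbb{N}$ and $x\in[0,1]$. Then $$\lim_{n\to\infty}H_{h_n}(J_n)=1 .$$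
   Context: $\mathbb{N}=\{1,2,\dots\}$. The limit set is $J_n=\bigcap_{l=1}^{\infty}\bigcup_{(q_1,\dots,q_l)\in\{1,\dots,n\}^l} g_{q_1}\circ\cdots\circ g_{q_l}([0,1])$. The distortion of a diffeomorphism $g:\Delta_1\to\Delta_2$ between intervals is $\kappa(g)=\sup\{|g'(y)|/|g'(x)|:x,y\in\Delta_1\}$; here $\kappa(g_n)$ is taken on $[0,1]$. $H_h$ denotes $h$-dimensional Hausdorff measure, $H_h(A)=\lim_{\delta\to0}\inf\{\sum_i \operatorname{diam}(U_i)^h: A\subset\bigcup_i U_i,\ \operatorname{diam}(U_i)\le\delta\}$ (so $H_1$ is Lebesgue measure on $\mathbb{R}$). *)

theory Defs
  imports "HOL-Analysis.Analysis"
begin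

section \<open>Hausdorff measure and dimension\<close>

text \<open>
  The contribution \<open>diam(U)^h\<close> of one member of a cover. The conventions
  \<open>diam({})^h = 0\<close> and \<open>diam(U)^0 = 1\<close> for nonempty \<open>U\<close> have to be spelled out, since
  \<open>0 powr 0 = 0\<close>.
\<close>

definition diam_pow :: "real \<Rightarrow> 'a::metric_space set \<Rightarrow> ennreal" where
  "diam_pow h U = (if U = {} then 0 else if h = 0 then 1 else ennreal (diameter U powr h))"

text \<open>
  Covers are countable, indexed by \<^typ>\<open>nat\<close>; finite covers are included by padding with the
  empty set. Boundedness is required explicitly because \<^const>\<open>diameter\<close> is meaningful only
  for bounded sets.
\<close>

definition hausdorff_covers :: "real \<Rightarrow> 'a::metric_space set \<Rightarrow> (nat \<Rightarrow> 'a set) set" where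
  "hausdorff_covers \<delta> A =
     {U. A \<subseteq> (\<Union>i. U i) \<and> (\<forall>i. bounded (U i) \<and> diameter (U i) \<le> \<delta>)}"

definition hausdorff_premeasure :: "real \<Rightarrow> real \<Rightarrow> 'a::metric_space set \<Rightarrow> ennreal" where
  "hausdorff_premeasure h \<delta> A = (INF U \<in> hausdorff_covers \<delta> A. \<Sum>i. diam_pow h (U i))"

definition hausdorff_measure :: "real \<Rightarrow> 'a::metric_space set \<Rightarrow> ennreal" where
  "hausdorff_measure h A = Lim (at_right 0) (\<lambda>\<delta>. hausdorff_premeasure h \<delta> A)"

lemma hausdorff_premeasure_antimono:
  assumes "\<delta> \<le> \<delta>'"
  shows "hausdorff_premeasure h \<delta>' A \<le> hausdorff_premeasure h \<delta> A"
  unfolding hausdorff_premeasure_def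
  by (rule INF_superset_mono) (use assms in \<open>auto simp: hausdorff_covers_def intro: order_trans\<close>)

lemma hausdorff_premeasure_tendsto_SUP:
  "((\<lambda>\<delta>. hausdorff_premeasure h \<delta> A) \<longlongrightarrow> (SUP \<delta>\<in>{0<..}. hausdorff_premeasure h \<delta> A)) (at_right 0)"
proof (rule order_tendstoI)
  fix a assume "a < (SUP \<delta>\<in>{0<..}. hausdorff_premeasure h \<delta> A)"
  then obtain d where d: "d > 0" "a < hausdorff_premeasure h d A"
    by (auto simp: less_SUP_iff)
  have "\<forall>\<^sub>F \<delta> in at_right 0. \<delta> \<in> {0<..<d}"
    using d(1) by (rule eventually_at_right_real)
  then show "\<forall>\<^sub>F \<delta> in at_right 0. a < hausdorff_premeasure h \<delta> A"
  proof eventually_elim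
    case (elim \<delta>)
    with d(2) hausdorff_premeasure_antimono[of \<delta> d h A] show ?case by auto
  qed
next
  fix a assume a: "(SUP \<delta>\<in>{0<..}. hausdorff_premeasure h \<delta> A) < a"
  have "\<forall>\<^sub>F \<delta> in at_right (0::real). \<delta> > 0"
    by (rule eventually_at_right_less)
  then show "\<forall>\<^sub>F \<delta> in at_right 0. hausdorff_premeasure h \<delta> A < a"
  proof eventually_elim
    case (elim \<delta>)
    then have "hausdorff_premeasure h \<delta> A \<le> (SUP \<delta>\<in>{0<..}. hausdorff_premeasure h \<delta> A)"
      by (intro SUP_upper) auto
    with a show ?case by (rule le_less_trans[rotated])
  qed
qed

lemma hausdorff_measure_eq_SUP:
  "hausdorff_measure h A = (SUP \<delta>\<in>{0<..}. hausdorff_premeasure h \<delta> A)"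
  unfolding hausdorff_measure_def
  by (rule tendsto_Lim[OF _ hausdorff_premeasure_tendsto_SUP]) simp

text \<open>
  In a Euclidean space the set on the right contains every \<open>h\<close> exceeding the dimension of the
  space, so it is nonempty and bounded below and the real-valued infimum is genuine.
\<close>

definition hausdorff_dim :: "'a::euclidean_space set \<Rightarrow> real" where
  "hausdorff_dim A = Inf {h. 0 \<le> h \<and> hausdorff_measure h A = 0}"


section \<open>Diffeomorphisms of class \<open>C\<^sup>2\<close> between intervals\<close>

text \<open>
  Derivatives are taken within the domain \<open>S\<close>: one-sided at endpoints that belong to an
  interval \<open>S\<close>, and ordinary derivatives if \<open>S\<close> is open. Values outside \<open>S\<close> are irrelevant.
\<close>

definition deriv_within :: "real set \<Rightarrow> (real \<Rightarrow> real) \<Rightarrow> real \<Rightarrow> real" where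
  "deriv_within S f x = vector_derivative f (at x within S)"

definition C2_on :: "real set \<Rightarrow> (real \<Rightarrow> real) \<Rightarrow> bool" where
  "C2_on S f \<longleftrightarrow>
     f differentiable_on S \<and>
     deriv_within S f differentiable_on S \<and>
     continuous_on S (deriv_within S (deriv_within S f))"

definition C2_diffeo :: "real set \<Rightarrow> real set \<Rightarrow> (real \<Rightarrow> real) \<Rightarrow> bool" where
  "C2_diffeo S T f \<longleftrightarrow> bij_betw f S T \<and> C2_on S f \<and> C2_on T (inv_into S f)"

definition extends_C2_diffeo :: "real set \<Rightarrow> (real \<Rightarrow> real) \<Rightarrow> bool" where
  "extends_C2_diffeo S f \<longleftrightarrow>
     (\<exists>U F. open U \<and> S \<subseteq> U \<and> C2_diffeo U (F ` U) F \<and> (\<forall>x\<in>S. F x = f x))"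

text \<open>The supremum is taken in the extended reals, so that an unbounded ratio gives \<open>\<infinity>\<close>.\<close>

definition distortion :: "real set \<Rightarrow> (real \<Rightarrow> real) \<Rightarrow> ereal" where
  "distortion S f =
     (SUP (x, y) \<in> S \<times> S. ereal (\<bar>deriv_within S f y\<bar> / \<bar>deriv_within S f x\<bar>))"


section \<open>Limit sets\<close>

text \<open>The word \<open>[q\<^sub>1, \<dots>, q\<^sub>l]\<close> stands for \<open>g q\<^sub>1 \<circ> \<dots> \<circ> g q\<^sub>l\<close>.\<close>

definition word_map :: "(nat \<Rightarrow> 'a \<Rightarrow> 'a) \<Rightarrow> nat list \<Rightarrow> 'a \<Rightarrow> 'a" where
  "word_map g q = foldr (\<circ>) (map g q) id"

definition limit_set :: "(nat \<Rightarrow> real \<Rightarrow> real) \<Rightarrow> nat \<Rightarrow> real set" where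
  "limit_set g n =
     (\<Inter>l\<in>{1..}. \<Union>q\<in>{q. length q = l \<and> set q \<subseteq> {1..n}}. word_map g q ` {0..1})"

end

theory Submission
  imports Defs "HOL-Library.Sublist"
begin

text \<open>
  Let \<open>J\<close> be the limit set, \<open>h\<close> its dimension and \<open>\<Delta> w\<close> the length of the cylinder of the word \<open>w\<close>.
  No conformal measure is needed: the Hausdorff content \<open>M A\<close> (all covers, no bound on diameters)
  is subadditive and scales under the word maps, and \<open>h\<close> is characterised implicitly.
  If \<open>M J = 0\<close>, or if the sum of \<open>c\<^sub>w powr h\<close> over an antichain exceeds 1, where \<open>c\<^sub>w\<close> is a lower Lipschitz
  constant of the word map of \<open>w\<close>, then the dimension would be smaller, respectively larger, than \<open>h\<close>.

  Upper bound: a word map composed with \<open>g k\<close> has distortion close to 1 when \<open>k\<close> is large, whatever the word.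
  Cover \<open>J\<close> by the cylinders of the words that end with their first \<open>k\<close> after a long prefix; by the antichain
  bound the \<open>h\<close>-th powers of their lengths sum to little more than 1, and the points still missing \<open>k\<close>
  contribute little.

  Lower bound: it suffices that \<open>M (J \<inter> F) \<le> (1 + \<epsilon>) * (length F) powr h * M J\<close> for all intervals \<open>F\<close>. For long
  intervals (and their images under word maps) this follows from the same cylinders, since passing from
  exponent \<open>h\<close> to 1 for \<open>n ^ Q\<close> pieces costs only \<open>(n ^ Q) powr (1 - h)\<close>, which tends to 1 by (i).
  For short intervals at 0, use (ii); an interval at 1 is the image under \<open>g 1\<close> of one at 0. Any other interval is,
  after pulling back along the longest cylinder containing it, a union of at most \<open>n\<close> images of intervals at 0 or at 1.
\<close>

section \<open>Hausdorff content\<close>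

text \<open>The obstacle is distortion. A general word map is only within the fixed factor
  \<open>K\<close> of an affine map, so counting all cylinders of one length would lose a factor
  depending on \<open>K\<close>. After a large letter \<open>k\<close> the loss disappears: the
  prefix acts on the interval \<open>{b k..b (k - 1)}\<close>, whose length tends to 0, and
  \<open>g k\<close> itself is nearly affine by (iv). This is why the covers wait for the letter
  \<open>k\<close>. The order of choices makes (i) applicable in the lower bound: \<theta> comes
  first, then \<open>k\<close>, the prefix length and the maximal waiting time, and \<open>n\<close>
  last. The words involved use all letters up to \<open>n\<close>, but their lengths are bounded
  independently of \<open>n\<close>, so there are at most \<open>n ^ Q\<close> of them with
  \<open>Q\<close> fixed. The content is used because it is finite on bounded sets for every
  positive exponent. An inequality \<open>M J \<le> x * M J\<close> with \<open>x < 1\<close>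
  therefore forces \<open>M J = 0\<close>, and a positive \<open>M J\<close> may be cancelled.
  Nothing like this is available for the measure, which might be infinite a priori.\<close>

definition hausdorff_content :: "real \<Rightarrow> 'a::metric_space set \<Rightarrow> ennreal" where
  "hausdorff_content h A = (INF U \<in> {U. A \<subseteq> (\<Union>i. U i) \<and> (\<forall>i. bounded (U i))}. \<Sum>i. diam_pow h (U i :: 'a set))"

lemma content_le_suminf:
  assumes "A \<subseteq> (\<Union>i. U i)" "\<And>i. bounded (U i)"
  shows "hausdorff_content h A \<le> (\<Sum>i. diam_pow h (U i))"
  unfolding hausdorff_content_def by (rule INF_lower) (use assms in auto)

lemma content_mono: "A \<subseteq> B \<Longrightarrow> hausdorff_content h A \<le> hausdorff_content h B"
  unfolding hausdorff_content_def by (rule INF_superset_mono) auto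

lemma content_le_diam_pow:
  assumes "bounded A"
  shows "hausdorff_content h A \<le> diam_pow h A"
proof -
  have "hausdorff_content h A \<le> (\<Sum>i. diam_pow h ((\<lambda>i::nat. if i = 0 then A else {}) i))"
    by (rule content_le_suminf) (use assms in auto)
  also have "\<dots> = (\<Sum>i\<in>{0::nat}. diam_pow h ((\<lambda>i. if i = 0 then A else {}) i))"
    by (rule suminf_finite) (auto simp: diam_pow_def)
  also have "\<dots> = diam_pow h A" by simp
  finally show ?thesis .
qed

lemma content_le_premeasure: "hausdorff_content h A \<le> hausdorff_premeasure h \<delta> A"
  unfolding hausdorff_content_def hausdorff_premeasure_def
  by (rule INF_superset_mono) (auto simp: hausdorff_covers_def)

lemma content_le_measure: "hausdorff_content h A \<le> hausdorff_measure h A"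
proof -
  have "hausdorff_content h A \<le> hausdorff_premeasure h 1 A" by (rule content_le_premeasure)
  also have "\<dots> \<le> hausdorff_measure h A"
    unfolding hausdorff_measure_eq_SUP by (rule SUP_upper) auto
  finally show ?thesis .
qed

lemma content_countable_subadditive:
  fixes A :: "nat \<Rightarrow> 'a::metric_space set"
  shows "hausdorff_content h (\<Union>i. A i) \<le> (\<Sum>i. hausdorff_content h (A i))"
proof (rule ennreal_le_epsilon)
  fix e :: real
  assume fin: "(\<Sum>i. hausdorff_content h (A i)) < top" and e: "0 < e"
  have "\<exists>U. A i \<subseteq> (\<Union>j. U j) \<and> (\<forall>j. bounded (U j)) \<and>
      (\<Sum>j. diam_pow h (U j)) \<le> hausdorff_content h (A i) + ennreal (e * (1/2) ^ Suc i)" for i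
  proof -
    have "hausdorff_content h (A i) \<noteq> top"
      using ennreal_suminf_lessD[OF fin, of i] by auto
    moreover have "0 < ennreal (e * (1/2) ^ Suc i)" using e by (simp add: ennreal_zero_less_mult_iff)
    ultimately have "hausdorff_content h (A i) < hausdorff_content h (A i) + ennreal (e * (1/2) ^ Suc i)"
      by (cases "hausdorff_content h (A i)") (use e in \<open>auto simp flip: ennreal_plus simp: ennreal_less_iff\<close>)
    then obtain U where "U \<in> {U. A i \<subseteq> (\<Union>j. U j) \<and> (\<forall>j. bounded (U j))}"
      "(\<Sum>j. diam_pow h (U j)) < hausdorff_content h (A i) + ennreal (e * (1/2) ^ Suc i)"
      by (subst (asm) (1) hausdorff_content_def) (unfold INF_less_iff, blast)
    then show ?thesis by (intro exI[of _ U]) simp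
  qed
  then obtain U where U: "\<And>i. A i \<subseteq> (\<Union>j. U i j)" "\<And>i j. bounded (U i j)"
      "\<And>i. (\<Sum>j. diam_pow h (U i j)) \<le> hausdorff_content h (A i) + ennreal (e * (1/2) ^ Suc i)"
    by metis
  define V where "V m = (case prod_decode m of (i, j) \<Rightarrow> U i j)" for m
  have "(\<Union>i. A i) \<subseteq> (\<Union>m. V m)"
  proof
    fix x assume "x \<in> (\<Union>i. A i)"
    then obtain i j where "x \<in> U i j" using U(1) by blast
    then have "x \<in> V (prod_encode (i, j))" by (simp add: V_def)
    then show "x \<in> (\<Union>m. V m)" by blast
  qed
  then have "hausdorff_content h (\<Union>i. A i) \<le> (\<Sum>m. diam_pow h (V m))"
    by (rule content_le_suminf) (auto simp: V_def U split: prod.split)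
  also have "\<dots> = (\<Sum>m. (case prod_decode m of (i, j) \<Rightarrow> diam_pow h (U i j)))"
    by (simp add: V_def case_prod_unfold)
  also have "\<dots> = (\<Sum>i. \<Sum>j. diam_pow h (U i j))"
    using suminf_ennreal_2dimen[of "\<lambda>i. (\<Sum>j. diam_pow h (U i j))" "\<lambda>(i, j). diam_pow h (U i j)"]
    by (simp add: comp_def case_prod_unfold)
  also have "\<dots> \<le> (\<Sum>i. hausdorff_content h (A i) + ennreal (e * (1/2) ^ Suc i))"
    by (intro suminf_le U) auto
  also have "\<dots> = (\<Sum>i. hausdorff_content h (A i)) + (\<Sum>i. ennreal (e * (1/2) ^ Suc i))"
    by (rule suminf_add[symmetric]) auto
  also have "(\<Sum>i. ennreal (e * (1/2) ^ Suc i)) = ennreal e"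
  proof -
    have "(\<lambda>i. e * (1/2) ^ Suc i) sums (e * 1)"
      by (intro sums_mult power_half_series)
    then show ?thesis using e by (intro suminf_ennreal_eq) auto
  qed
  finally show "hausdorff_content h (\<Union>i. A i) \<le> (\<Sum>i. hausdorff_content h (A i)) + ennreal e" .
qed

lemma content_empty: "hausdorff_content h {} = 0"
  using content_le_diam_pow[of "{}" h] by (simp add: diam_pow_def)

text \<open>Mapping a cover forward multiplies each diameter by at most \<open>L\<close>. This
  scaling rule takes the place of conformality of a measure.\<close>

lemma content_image_le:
  fixes f :: "'a::metric_space \<Rightarrow> 'b::metric_space"
  assumes "0 < h" "0 \<le> L"
    and lip: "\<And>x y. x \<in> A \<Longrightarrow> y \<in> A \<Longrightarrow> dist (f x) (f y) \<le> L * dist x y"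
  shows "hausdorff_content h (f ` A) \<le> ennreal (L powr h) * hausdorff_content h A"
proof -
  have *: "hausdorff_content h (f ` A) \<le> ennreal (L powr h) * (\<Sum>i. diam_pow h (U i))"
    if U: "A \<subseteq> (\<Union>i. U i)" "\<And>i. bounded (U i)" for U :: "nat \<Rightarrow> 'a set"
  proof -
    have b: "bounded (f ` (A \<inter> U i))"
      and d: "diam_pow h (f ` (A \<inter> U i)) \<le> ennreal (L powr h) * diam_pow h (U i)" for i
    proof -
      have D: "dist (f x) (f y) \<le> L * diameter (U i)" if "x \<in> A \<inter> U i" "y \<in> A \<inter> U i" for x y
      proof -
        have "dist (f x) (f y) \<le> L * dist x y" using lip that by auto
        also have "\<dots> \<le> L * diameter (U i)"
          using that U(2) diameter_bounded_bound assms(2) by (intro mult_left_mono) auto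
        finally show ?thesis .
      qed
      show "bounded (f ` (A \<inter> U i))"
      proof (cases "A \<inter> U i = {}")
        case False
        then obtain x where "x \<in> A \<inter> U i" by auto
        then show ?thesis unfolding bounded_def using D by (intro exI[of _ "f x"]) blast
      qed auto
      show "diam_pow h (f ` (A \<inter> U i)) \<le> ennreal (L powr h) * diam_pow h (U i)"
      proof (cases "A \<inter> U i = {}")
        case False
        have ge: "0 \<le> diameter (U i)" using U(2) diameter_ge_0 by blast
        have le: "diameter (f ` (A \<inter> U i)) \<le> L * diameter (U i)"
          unfolding diameter_def[of "f ` _"] using False D by (auto intro!: cSUP_least)
        have "0 \<le> diameter (f ` (A \<inter> U i))"
          using \<open>bounded (f ` (A \<inter> U i))\<close> diameter_ge_0 by blast
        with le have "diameter (f ` (A \<inter> U i)) powr h \<le> (L * diameter (U i)) powr h"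
          using assms(1) by (intro powr_mono2) auto
        also have "\<dots> = L powr h * diameter (U i) powr h"
          using ge assms by (simp add: powr_mult)
        finally show ?thesis using assms(1) False
          by (auto simp: diam_pow_def ennreal_mult' intro!: ennreal_leI simp flip: ennreal_mult')
      qed (simp add: diam_pow_def)
    qed
    have "hausdorff_content h (f ` A) \<le> (\<Sum>i. diam_pow h (f ` (A \<inter> U i)))"
      by (rule content_le_suminf) (use U(1) b in blast)+
    also have "\<dots> \<le> (\<Sum>i. ennreal (L powr h) * diam_pow h (U i))"
      by (intro suminf_le d) auto
    finally show ?thesis by (simp add: ennreal_suminf_cmult)
  qed
  show ?thesis
  \<comment> \<open>Dividing by the factor is impossible if it is 0. Then one countable cover of
    \<open>A\<close> by bounded sets is enough, since 0 times any sum is 0 in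
    \<open>ennreal\<close>; balls around a chosen point provide it.\<close>
  proof (cases "L powr h = 0")
    case True
    define U where "U i = {x \<in> A. dist (SOME x. x \<in> A) x \<le> real i}" for i :: nat
    have "hausdorff_content h (f ` A) \<le> ennreal (L powr h) * (\<Sum>i. diam_pow h (U i))"
    proof (rule *)
      show "A \<subseteq> (\<Union>i. U i)" by (auto simp: U_def real_arch_simple)
      show "bounded (U i)" for i unfolding bounded_def U_def by (intro exI) auto
    qed
    then show ?thesis using True by simp
  next
    case False
    then have "L powr h > 0" by simp
    have "hausdorff_content h (f ` A) / ennreal (L powr h) \<le> hausdorff_content h A"
      unfolding hausdorff_content_def[of h A]
    proof (rule INF_greatest, clarify)
      fix U :: "nat \<Rightarrow> 'a set" assume "A \<subseteq> \<Union> (range U)" "\<forall>i. bounded (U i)"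
      with * have "hausdorff_content h (f ` A) \<le> ennreal (L powr h) * (\<Sum>i. diam_pow h (U i))" by blast
      with \<open>L powr h > 0\<close> show "hausdorff_content h (f ` A) / ennreal (L powr h) \<le> (\<Sum>i. diam_pow h (U i))"
        by (intro divide_le_posI_ennreal) (auto simp: ennreal_zero_less_mult_iff)
    qed
    then have "hausdorff_content h (f ` A) / ennreal (L powr h) * ennreal (L powr h) \<le> hausdorff_content h A * ennreal (L powr h)"
      by (rule mult_right_mono) simp
    then show ?thesis using \<open>L powr h > 0\<close>
      by (subst (asm) ennreal_divide_times) (simp add: mult.commute ennreal_times_divide[symmetric])
  qed
qed

text \<open>A cover whose sum is below \<open>\<delta> powr h\<close> has all diameters at most
  \<delta>, because a single larger set would already exceed the sum. So for null sets the
  restriction on diameters is automatic.\<close>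

lemma measure_eq_0_if_content_eq_0:
  assumes "0 < h" "hausdorff_content h A = 0"
  shows "hausdorff_measure h A = 0"
proof -
  have "hausdorff_premeasure h \<delta> A = 0" if "\<delta> > 0" for \<delta>
  proof -
    have "hausdorff_premeasure h \<delta> A \<le> ennreal e" if "0 < e" "e \<le> \<delta> powr h" for e
    proof -
      have "hausdorff_content h A < ennreal e" using assms that by simp
      then obtain U where U: "A \<subseteq> (\<Union>i. U i)" "\<And>i. bounded (U i)" "(\<Sum>i. diam_pow h (U i)) < ennreal e"
        unfolding hausdorff_content_def INF_less_iff by blast
      have "diameter (U i) \<le> \<delta>" for i
      proof (rule ccontr)
        assume "\<not> diameter (U i) \<le> \<delta>"
        then have "\<delta> powr h < diameter (U i) powr h" using \<open>\<delta> > 0\<close> assms by (intro powr_less_mono2) auto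
        moreover have "U i \<noteq> {}" using \<open>\<not> diameter (U i) \<le> \<delta>\<close> \<open>\<delta> > 0\<close> by auto
        moreover have "diam_pow h (U i) \<le> (\<Sum>i. diam_pow h (U i))"
          using sum_le_suminf[of "\<lambda>i. diam_pow h (U i)" "{i}"] by auto
        ultimately show False using U(3) that assms(1)
          by (auto simp: diam_pow_def) (smt (verit) ennreal_less_iff order_le_less_trans powr_ge_zero)
      qed
      then have "U \<in> hausdorff_covers \<delta> A" using U by (auto simp: hausdorff_covers_def)
      then have "hausdorff_premeasure h \<delta> A \<le> (\<Sum>i. diam_pow h (U i))"
        unfolding hausdorff_premeasure_def by (rule INF_lower)
      with U(3) show ?thesis by simp
    qed
    then have *: "hausdorff_premeasure h \<delta> A \<le> ennreal (min e (\<delta> powr h))" if "e > 0" for e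
      using that \<open>\<delta> > 0\<close> by auto
    have "hausdorff_premeasure h \<delta> A \<le> 0 + ennreal e" if "e > 0" for e
      using *[OF that] by (rule order_trans) (auto intro: ennreal_leI)
    then show ?thesis by (metis ennreal_le_epsilon le_zero_eq)
  qed
  then show ?thesis unfolding hausdorff_measure_eq_SUP by (simp add: SUP_eq_const)
qed

lemma bounded_real_subset_interval:
  fixes U :: "real set"
  assumes "bounded U" "U \<noteq> {}"
  obtains a b where "a \<le> b" "U \<subseteq> {a..b}" "b - a \<le> diameter U"
proof
  have bd: "bdd_above U" "bdd_below U" using assms bounded_imp_bdd_above bounded_imp_bdd_below by auto
  show sub: "U \<subseteq> {Inf U..Sup U}" using bd by (auto intro: cInf_lower cSup_upper)
  then show "Inf U \<le> Sup U" using assms by fastforce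
  have "y \<le> x + diameter U" if "x \<in> U" "y \<in> U" for x y
    using diameter_bounded_bound[OF assms(1) that] by (auto simp: dist_real_def)
  then have "Sup U - diameter U \<le> x" if "x \<in> U" for x
    using cSup_least[OF assms(2), of "x + diameter U"] that by force
  then show "Sup U - Inf U \<le> diameter U"
    using cInf_greatest[OF assms(2), of "Sup U - diameter U"] by force
qed

text \<open>Real values make subtraction and cancellation available. Since \<open>enn2real\<close>
  sends infinity to 0, the value is meaningful where the content is finite;
  \<open>ennreal_rcontent\<close> guarantees this for bounded sets and positive exponents.\<close>

definition rcontent :: "real \<Rightarrow> real set \<Rightarrow> real" where
  "rcontent h A = enn2real (hausdorff_content h A)"

lemma rcontent_nonneg: "0 \<le> rcontent h A"
  by (simp add: rcontent_def)

lemma ennreal_rcontent: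
  assumes "0 < h" "bounded A"
  shows "ennreal (rcontent h A) = hausdorff_content h A"
proof -
  have "hausdorff_content h A \<noteq> top"
    using content_le_diam_pow[OF assms(2), of h] assms(1) by (auto simp: diam_pow_def top_unique split: if_splits)
  then show ?thesis by (simp add: rcontent_def less_top)
qed

lemma rcontent_mono:
  assumes "0 < h" "A \<subseteq> B" "bounded B"
  shows "rcontent h A \<le> rcontent h B"
proof -
  have "bounded A" using assms bounded_subset by blast
  then have "ennreal (rcontent h A) \<le> ennreal (rcontent h B)"
    using assms by (simp add: ennreal_rcontent content_mono)
  then show ?thesis by (simp add: rcontent_nonneg)
qed

lemma rcontent_le:
  assumes "0 < h" "A \<subseteq> {a..b}" "a \<le> b"
  shows "rcontent h A \<le> (b - a) powr h"
proof -
  have bA: "bounded A" using assms bounded_subset bounded_closed_interval by blast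
  have "hausdorff_content h A \<le> diam_pow h {a..b}"
    using content_mono[OF assms(2)] content_le_diam_pow[of "{a..b}" h] bounded_closed_interval order_trans by blast
  also have "\<dots> = ennreal ((b - a) powr h)" using assms by (simp add: diam_pow_def diameter_closed_interval)
  finally show ?thesis using assms bA by (simp flip: ennreal_rcontent)
qed

lemma rcontent_degenerate:
  assumes "0 < h" "A \<subseteq> {a}"
  shows "rcontent h A = 0"
  using rcontent_le[of h A a a] assms rcontent_nonneg[of h A] by simp

lemma content_UN_le:
  assumes "finite I"
  shows "hausdorff_content h (\<Union>i\<in>I. A i) \<le> (\<Sum>i\<in>I. hausdorff_content h (A i))"
  using assms
proof induction
  case (insert i I)
  have "hausdorff_content h (X \<union> Y) \<le> hausdorff_content h X + hausdorff_content h Y" for X Y :: "'b set"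
  proof -
    define Z where "Z n = (if n = 0 then X else if n = 1 then Y else {})" for n :: nat
    have "hausdorff_content h (X \<union> Y) \<le> hausdorff_content h (\<Union>n. Z n)"
      by (rule content_mono) (auto simp: Z_def split: if_splits)
    also have "\<dots> \<le> (\<Sum>n. hausdorff_content h (Z n))" by (rule content_countable_subadditive)
    also have "\<dots> = (\<Sum>n\<in>{0, 1}. hausdorff_content h (Z n))"
      by (rule suminf_finite) (auto simp: Z_def content_empty)
    also have "\<dots> = hausdorff_content h X + hausdorff_content h Y" by (simp add: Z_def)
    finally show ?thesis .
  qed
  from this[of "A i" "\<Union>i\<in>I. A i"] insert show ?case
    by (auto intro: order_trans add_left_mono)
qed (simp add: content_empty)

lemma rcontent_UN_le:
  assumes "finite I" "0 < h" "\<And>i. i \<in> I \<Longrightarrow> bounded (A i)"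
  shows "rcontent h (\<Union>i\<in>I. A i) \<le> (\<Sum>i\<in>I. rcontent h (A i))"
proof -
  have "ennreal (rcontent h (\<Union>i\<in>I. A i)) \<le> (\<Sum>i\<in>I. ennreal (rcontent h (A i)))"
    using content_UN_le[OF assms(1), of h A] assms bounded_UN[OF assms(1), of A]
    by (simp add: ennreal_rcontent cong: sum.cong del: sum_ennreal)
  then show ?thesis by (simp add: rcontent_nonneg sum_nonneg)
qed

lemma rcontent_image_le:
  assumes "0 < h" "0 \<le> L" "bounded A"
    and "\<And>x y. x \<in> A \<Longrightarrow> y \<in> A \<Longrightarrow> \<bar>f x - f y\<bar> \<le> L * \<bar>x - y\<bar>"
  shows "rcontent h (f ` A) \<le> L powr h * rcontent h A"
proof -
  have le: "hausdorff_content h (f ` A) \<le> ennreal (L powr h) * hausdorff_content h A"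
    by (rule content_image_le) (use assms in \<open>auto simp: dist_real_def\<close>)
  have "ennreal (L powr h) * hausdorff_content h A = ennreal (L powr h * rcontent h A)"
    using assms by (simp add: ennreal_mult' rcontent_nonneg flip: ennreal_rcontent)
  with le have "enn2real (hausdorff_content h (f ` A)) \<le> L powr h * rcontent h A"
    by (intro enn2real_leI) (auto simp: rcontent_nonneg)
  then show ?thesis by (simp add: rcontent_def)
qed

lemma rcontent_eq_0_iff:
  assumes "0 < h" "bounded A"
  shows "rcontent h A = 0 \<longleftrightarrow> hausdorff_content h A = 0"
  using ennreal_rcontent[OF assms] by (metis ennreal_0 rcontent_def enn2real_0)

section \<open>Dimension and vanishing of the content\<close>

lemma hausdorff_dim_le:
  assumes "0 \<le> s" "hausdorff_measure s A = 0"
  shows "hausdorff_dim A \<le> s"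
  unfolding hausdorff_dim_def by (rule cInf_lower) (use assms in \<open>auto simp: bdd_below_def\<close>)

lemma content_pos_of_less_dim:
  assumes "0 < s" "s < hausdorff_dim A"
  shows "hausdorff_content s A \<noteq> 0"
  using measure_eq_0_if_content_eq_0[of s A] hausdorff_dim_le[of s A] assms by force

text \<open>Self-similarity: two half-size copies cover the interval, so its finite content is at
  most \<open>2 * (1/2) powr s\<close> times itself, and this factor is below 1.\<close>

lemma content_unit_interval_eq_0:
  assumes "1 < s"
  shows "hausdorff_content s {0..1::real} = 0"
proof -
  have s: "0 < s" using assms by simp
  let ?I = "{0..1::real}"
  have *: "rcontent s ((\<lambda>x. x / 2 + t) ` ?I) \<le> (1/2) powr s * rcontent s ?I" for t
    by (rule rcontent_image_le) (use s in \<open>auto simp: abs_if\<close>)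
  have "?I \<subseteq> (\<Union>t\<in>{0,1/2}. (\<lambda>x. x / 2 + t) ` ?I)"
  proof
    fix x :: real assume x: "x \<in> ?I"
    show "x \<in> (\<Union>t\<in>{0,1/2}. (\<lambda>x. x / 2 + t) ` ?I)"
    proof (cases "x \<le> 1/2")
      case True
      then have "x = (2 * x) / 2 + 0" "2 * x \<in> ?I" using x by auto
      then show ?thesis by blast
    next
      case False
      then have "x = (2 * x - 1) / 2 + 1/2" "2 * x - 1 \<in> ?I" using x by (auto simp: field_simps)
      then show ?thesis by blast
    qed
  qed
  moreover have bd: "bounded ((\<lambda>x. x / 2 + t) ` ?I)" for t
    by (intro compact_imp_bounded compact_continuous_image continuous_intros) auto
  ultimately have "rcontent s ?I \<le> rcontent s (\<Union>t\<in>{0,1/2}. (\<lambda>x. x / 2 + t) ` ?I)"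
    by (intro rcontent_mono) (use s in auto)
  also have "\<dots> \<le> (\<Sum>t\<in>{0,1/2}. rcontent s ((\<lambda>x. x / 2 + t) ` ?I))"
    by (rule rcontent_UN_le) (use s bd in auto)
  also have "\<dots> \<le> (\<Sum>t\<in>{0::real,1/2}. (1/2) powr s * rcontent s ?I)"
    by (intro sum_mono *)
  also have "\<dots> = 2 * (1/2) powr s * rcontent s ?I" by simp
  finally have "(1 - 2 * (1/2) powr s) * rcontent s ?I \<le> 0" by (simp add: algebra_simps)
  moreover have "2 * (1/2) powr s < (1::real)"
  proof -
    have "(1/2) powr s < (1/2) powr (1::real)" using assms by (intro powr_less_mono') auto
    then show ?thesis by simp
  qed
  ultimately have "rcontent s ?I \<le> 0" by (simp add: mult_le_0_iff)
  then show ?thesis using rcontent_nonneg[of s ?I] rcontent_eq_0_iff[of s ?I] s by auto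
qed

lemma hausdorff_dim_le_1:
  assumes "A \<subseteq> {0..1::real}"
  shows "hausdorff_dim A \<le> 1"
proof (rule dense_ge)
  fix s :: real assume "1 < s"
  then have "hausdorff_content s A = 0"
    using content_unit_interval_eq_0 content_mono[OF assms, of s] by simp
  then show "hausdorff_dim A \<le> s"
    using \<open>1 < s\<close> by (intro hausdorff_dim_le measure_eq_0_if_content_eq_0) auto
qed

text \<open>For diameters at most 1 a larger exponent gives a smaller power. This is why the
  comparison passes through the premeasure with bound 1 and not through arbitrary covers.\<close>

lemma content_eq_0_of_measure_eq_0:
  assumes "hausdorff_measure t A = 0" "0 \<le> t" "t \<le> s"
  shows "hausdorff_content s A = 0"
proof -
  have "hausdorff_premeasure t 1 A \<le> hausdorff_measure t A"
    unfolding hausdorff_measure_eq_SUP by (rule SUP_upper) auto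
  then have "hausdorff_premeasure t 1 A = 0" using assms by simp
  moreover have "hausdorff_premeasure s 1 A \<le> hausdorff_premeasure t 1 A"
    unfolding hausdorff_premeasure_def
  proof (rule INF_mono)
    fix U :: "nat \<Rightarrow> 'a set" assume U: "U \<in> hausdorff_covers 1 A"
    have "diam_pow s (U i) \<le> diam_pow t (U i)" for i
    proof (cases "U i = {}")
      case False
      have d: "diameter (U i) \<le> 1" "0 \<le> diameter (U i)"
        using U by (auto simp: hausdorff_covers_def diameter_ge_0)
      show ?thesis
      proof (cases "t = 0")
        case True
        then show ?thesis using d assms False by (auto simp: diam_pow_def powr_le1)
      next
        case False
        then have "diameter (U i) powr s \<le> diameter (U i) powr t"
          using d assms by (cases "diameter (U i) = 0") (auto intro: powr_mono')
        then show ?thesis using False assms by (auto simp: diam_pow_def ennreal_leI)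
      qed
    qed (simp add: diam_pow_def)
    then show "\<exists>U'\<in>hausdorff_covers 1 A. (\<Sum>i. diam_pow s (U' i)) \<le> (\<Sum>i. diam_pow t (U i))"
      using U by (intro bexI[of _ U] suminf_le) auto
  qed
  ultimately show ?thesis using content_le_premeasure[of s A 1] by simp
qed

lemma content_eq_0_of_dim_less:
  fixes A :: "real set"
  assumes "A \<subseteq> {0..1}" "hausdorff_dim A < s"
  shows "hausdorff_content s A = 0"
proof -
  \<comment> \<open>The exponent 2 witnesses that the set defining the dimension is nonempty, so its
    infimum is approximated by members.\<close>
  have "hausdorff_measure 2 A = 0"
    using content_unit_interval_eq_0[of 2] content_mono[OF assms(1), of 2]
    by (intro measure_eq_0_if_content_eq_0) auto
  then have "{h. 0 \<le> h \<and> hausdorff_measure h A = 0} \<noteq> {}" by (auto intro: exI[of _ 2])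
  then obtain t where "t < s" "0 \<le> t" "hausdorff_measure t A = 0"
    using cInf_lessD[of "{h. 0 \<le> h \<and> hausdorff_measure h A = 0}" s] assms(2)
    unfolding hausdorff_dim_def by auto
  then show ?thesis by (intro content_eq_0_of_measure_eq_0[of t]) auto
qed

section \<open>Finite covers, gaps, and sums over disjoint intervals\<close>

lemma enlarge_to_open_interval:
  fixes U :: "real set"
  assumes "bounded U" "0 < s" "0 < e"
  shows "\<exists>a b. a < b \<and> U \<subseteq> {a<..<b} \<and> ennreal ((b - a) powr s) \<le> diam_pow s U + ennreal e"
proof (cases "U = {}")
  case True
  then show ?thesis using assms
    by (intro exI[of _ 0] exI[of _ "e powr (1 / s)"]) (auto simp: powr_powr diam_pow_def)
next
  case False
  obtain p q where pq: "p \<le> q" "U \<subseteq> {p..q}" "q - p \<le> diameter U"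
    using bounded_real_subset_interval[OF assms(1) False] .
  let ?d = "diameter U"
  have d0: "0 \<le> ?d" using assms(1) diameter_ge_0 by blast
  have "((\<lambda>r. (?d + 2 * r) powr s) \<longlongrightarrow> (?d + 2 * 0) powr s) (at_right 0)"
  proof (rule tendsto_powr')
    have "((\<lambda>r::real. ?d + 2 * r) \<longlongrightarrow> ?d + 2 * 0) (at 0 within {0<..})" by (intro tendsto_intros)
    then show "((\<lambda>r. ?d + 2 * r) \<longlongrightarrow> ?d + 2 * 0) (at_right 0)" .
  qed (use assms d0 in \<open>auto simp: eventually_at_filter\<close>)
  then have "\<forall>\<^sub>F r in at_right 0. (?d + 2 * r) powr s < ?d powr s + e"
    using assms by (intro order_tendstoD(2)) auto
  moreover have "\<forall>\<^sub>F r in at_right (0::real). 0 < r" by (rule eventually_at_right_less)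
  ultimately have "\<forall>\<^sub>F r in at_right 0. 0 < r \<and> (?d + 2 * r) powr s < ?d powr s + e"
    by eventually_elim auto
  then obtain r where r: "0 < r" "(?d + 2 * r) powr s < ?d powr s + e"
    using eventually_happens'[OF trivial_limit_at_right_real] by blast
  have "((q + r) - (p - r)) powr s \<le> (?d + 2 * r) powr s"
    using pq r assms by (intro powr_mono2) auto
  also have "\<dots> \<le> ?d powr s + e" using r by simp
  finally have "ennreal (((q + r) - (p - r)) powr s) \<le> ennreal (?d powr s + e)" by (rule ennreal_leI)
  also have "\<dots> = diam_pow s U + ennreal e" using False assms by (simp add: diam_pow_def)
  finally show ?thesis using pq r by (intro exI[of _ "p - r"] exI[of _ "q + r"]) auto
qed

text \<open>Finiteness matters twice: a finite sum of powers is continuous in the exponent, and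
  finite covers allow induction on the number of sets. The enlargements to open intervals are
  charged to a geometric series with total \<open>e\<close>.\<close>

lemma compact_finite_interval_cover:
  fixes A :: "real set"
  assumes "compact A" "0 < s" "hausdorff_content s A < ennreal X"
  obtains I :: "nat set" and a b where "finite I" "\<forall>i. a i < b i" "A \<subseteq> (\<Union>i\<in>I. {a i<..<b i})"
    "(\<Sum>i\<in>I. (b i - a i) powr s) < X"
proof -
  obtain U where U: "A \<subseteq> (\<Union>i. U i)" "\<And>i. bounded (U i)" "(\<Sum>i. diam_pow s (U i)) < ennreal X"
    using assms(3) unfolding hausdorff_content_def INF_less_iff by blast
  then obtain t where t: "0 \<le> t" "(\<Sum>i. diam_pow s (U i)) = ennreal t"
    by (cases "\<Sum>i. diam_pow s (U i)") auto
  then have tX: "t < X" using U(3) by (simp add: ennreal_less_iff)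
  define e where "e = (X - t) / 2"
  have e: "0 < e" "t + e < X" using tX by (auto simp: e_def field_simps)
  have "\<exists>a b. a < b \<and> U i \<subseteq> {a<..<b} \<and>
      ennreal ((b - a) powr s) \<le> diam_pow s (U i) + ennreal (e * (1/2) ^ Suc i)" for i
    by (rule enlarge_to_open_interval) (use U assms e in auto)
  then obtain a b where ab: "\<And>i. a i < b i" "\<And>i. U i \<subseteq> {a i<..<b i}"
    "\<And>i. ennreal ((b i - a i) powr s) \<le> diam_pow s (U i) + ennreal (e * (1/2) ^ Suc i)"
    by metis
  have "A \<subseteq> (\<Union>i\<in>UNIV. {a i<..<b i})" using U(1) ab(2) by blast
  then obtain I where I: "finite I" "A \<subseteq> (\<Union>i\<in>I. {a i<..<b i})"
    using compactE_image[OF assms(1), of UNIV "\<lambda>i. {a i<..<b i}"] by auto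
  have "ennreal (\<Sum>i\<in>I. (b i - a i) powr s) = (\<Sum>i\<in>I. ennreal ((b i - a i) powr s))" by simp
  also have "\<dots> \<le> (\<Sum>i. ennreal ((b i - a i) powr s))"
    using I by (intro sum_le_suminf) auto
  also have "\<dots> \<le> (\<Sum>i. diam_pow s (U i) + ennreal (e * (1/2) ^ Suc i))"
    by (intro suminf_le ab) auto
  also have "\<dots> = ennreal t + (\<Sum>i. ennreal (e * (1/2) ^ Suc i))"
    unfolding t(2)[symmetric] by (rule suminf_add[symmetric]) auto
  also have "(\<Sum>i. ennreal (e * (1/2) ^ Suc i)) = ennreal e"
  proof -
    have "(\<lambda>i. e * (1/2) ^ Suc i) sums (e * 1)"
      by (intro sums_mult power_half_series)
    then show ?thesis using e by (intro suminf_ennreal_eq) auto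
  qed
  finally have "(\<Sum>i\<in>I. (b i - a i) powr s) \<le> t + e"
    using t e by (simp flip: ennreal_plus add: ennreal_le_iff)
  then show thesis using I ab(1) e by (intro that[of I a b]) auto
qed

text \<open>Summing the tangent-line bound \<open>t powr h \<le> 1 - h + h * t\<close> at the mean.\<close>
lemma sum_powr_le_card_powr:
  fixes a :: "'i \<Rightarrow> real"
  assumes "finite I" "0 < h" "h \<le> 1" "\<And>i. i \<in> I \<Longrightarrow> 0 \<le> a i"
  shows "(\<Sum>i\<in>I. a i powr h) \<le> real (card I) powr (1 - h) * (\<Sum>i\<in>I. a i) powr h"
proof (cases "(\<Sum>i\<in>I. a i) = 0")
  case True
  then have "a i = 0" if "i \<in> I" for i using sum_nonneg_eq_0_iff[of I a] assms that by auto
  then show ?thesis using True by simp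
next
  case False
  define N where "N = real (card I)"
  define A where "A = (\<Sum>i\<in>I. a i) / N"
  have "I \<noteq> {}" using False by auto
  then have N: "N > 0" using assms by (simp add: N_def card_gt_0_iff)
  have S: "(\<Sum>i\<in>I. a i) > 0" using False assms by (simp add: sum_nonneg order_less_le)
  then have A: "A > 0" using N by (simp add: A_def)
  have tan: "t powr h \<le> 1 - h + h * t" if "0 \<le> t" for t :: real
  proof (cases "t = 0")
    case False
    then have "1 powr (1 - h) * t powr h \<le> (1 - h) * 1 + h * t"
      using that assms by (intro Youngs_inequality_0) auto
    then show ?thesis by simp
  qed (use assms in auto)
  have "(\<Sum>i\<in>I. a i powr h) = (\<Sum>i\<in>I. A powr h * (a i / A) powr h)"
    using A assms by (intro sum.cong) (auto simp: powr_divide)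
  also have "\<dots> \<le> (\<Sum>i\<in>I. A powr h * (1 - h + h * (a i / A)))"
    using A assms by (intro sum_mono mult_left_mono tan) auto
  also have "\<dots> = A powr h * (\<Sum>i\<in>I. 1 - h + h * (a i / A))"
    by (rule sum_distrib_left[symmetric])
  also have "(\<Sum>i\<in>I. 1 - h + h * (a i / A)) = N * (1 - h) + h * ((\<Sum>i\<in>I. a i) / A)"
    by (simp only: sum.distrib sum_distrib_left[symmetric] sum_divide_distrib[symmetric]) (simp add: N_def)
  also have "(\<Sum>i\<in>I. a i) / A = N" using A N False by (simp add: A_def)
  also have "A powr h * (N * (1 - h) + h * N) = N * A powr h" by (simp add: algebra_simps)
  also have "\<dots> = N powr (1 - h) * (\<Sum>i\<in>I. a i) powr h"
    using N S by (simp add: A_def powr_divide powr_diff)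
  finally show ?thesis by (simp add: N_def)
qed

lemma sum_disjoint_intervals_le:
  fixes a b :: "'i \<Rightarrow> real"
  assumes "finite I" "disjoint_family_on (\<lambda>i. {a i<..<b i}) I" "p \<le> q"
    and "\<And>i. i \<in> I \<Longrightarrow> a i \<le> b i" "\<And>i. i \<in> I \<Longrightarrow> {a i<..<b i} \<subseteq> {p..q}"
  shows "(\<Sum>i\<in>I. b i - a i) \<le> q - p"
proof -
  have "(\<Sum>i\<in>I. b i - a i) = (\<Sum>i\<in>I. measure lborel {a i<..<b i})"
    using assms(4) by (intro sum.cong) auto
  also have "\<dots> = measure lborel (\<Union>i\<in>I. {a i<..<b i})"
    by (rule measure_finite_Union[symmetric]) (use assms in auto)
  also have "\<dots> \<le> measure lborel {p..q}"
    by (rule measure_mono_fmeasurable) (use assms in \<open>auto simp: fmeasurable_def\<close>)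
  finally show ?thesis using assms by simp
qed

lemma finite_disjoint_compact_gap:
  fixes A :: "'i \<Rightarrow> 'a::heine_borel set"
  assumes "finite I" "\<And>i. i \<in> I \<Longrightarrow> compact (A i)" "disjoint_family_on A I"
  obtains \<gamma> where "0 < \<gamma>" "\<And>i j x y. i \<in> I \<Longrightarrow> j \<in> I \<Longrightarrow> i \<noteq> j \<Longrightarrow> x \<in> A i \<Longrightarrow> y \<in> A j \<Longrightarrow> \<gamma> \<le> dist x y"
proof -
  have "\<exists>d>0. \<forall>x\<in>A i. \<forall>y\<in>A j. d \<le> dist x y" if "i \<in> I" "j \<in> I" "i \<noteq> j" for i j
  proof -
    have "A i \<inter> A j = {}" using assms(3) that by (auto simp: disjoint_family_on_def)
    then show ?thesis
      using separate_compact_closed[of "A i" "A j"] assms(2) that compact_imp_closed by blast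
  qed
  then obtain d where d: "\<And>i j. i \<in> I \<Longrightarrow> j \<in> I \<Longrightarrow> i \<noteq> j \<Longrightarrow> 0 < d i j \<and> (\<forall>x\<in>A i. \<forall>y\<in>A j. d i j \<le> dist x y)"
    by metis
  define D where "D = insert 1 ((\<lambda>(i, j). d i j) ` {(i, j). i \<in> I \<and> j \<in> I \<and> i \<noteq> j})"
  have "finite {(i, j). i \<in> I \<and> j \<in> I \<and> i \<noteq> j}"
    by (rule finite_subset[of _ "I \<times> I"]) (use assms in auto)
  then have fin: "finite D" by (simp add: D_def)
  show thesis
  proof (rule that[of "Min D"])
    show "0 < Min D" using fin d by (subst Min_gr_iff) (auto simp: D_def)
  next
    fix i j x y assume *: "i \<in> I" "j \<in> I" "i \<noteq> j" "x \<in> A i" "y \<in> A j"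
    then have "d i j \<in> D" unfolding D_def by force
    then have "Min D \<le> d i j" using fin by (intro Min_le) auto
    then show "Min D \<le> dist x y" using d[OF *(1-3)] * by force
  qed
qed

section \<open>Distortion of word maps\<close>

lemma word_map_Nil [simp]: "word_map g [] x = x"
  by (simp add: word_map_def)

lemma word_map_Cons [simp]: "word_map g (k # w) x = g k (word_map g w x)"
  by (simp add: word_map_def)

lemma word_map_append [simp]: "word_map g (u @ v) x = word_map g u (word_map g v x)"
  by (induction u) auto

text \<open>Distortion multiplies under composition. The numbers \<open>l\<close> and
  \<open>m\<close> are lengths after the inner map: the premises compare \<open>A / l\<close> with
  \<open>B / m\<close> and \<open>l / e\<close> with \<open>m / d\<close>, written without division,
  and the intermediate lengths cancel.\<close>

lemma compose_ratio_le:
  fixes A B d e :: real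
  assumes "A * m \<le> s * (B * l)" "l * d \<le> t * (m * e)" "0 < m" "0 < l" "0 \<le> s" "0 \<le> B" "0 \<le> d"
  shows "A * d \<le> (s * t) * (B * e)"
proof -
  have "(A * d) * (m * l) = (A * m) * (l * d)" by (simp add: algebra_simps)
  also have "\<dots> \<le> (s * (B * l)) * (l * d)" using assms by (intro mult_right_mono) auto
  also have "\<dots> \<le> (s * (B * l)) * (t * (m * e))" using assms by (intro mult_left_mono) auto
  also have "\<dots> = ((s * t) * (B * e)) * (m * l)" by (simp add: algebra_simps)
  finally show ?thesis using assms by (auto dest!: mult_right_le_imp_le)
qed

text \<open>Smoothness is replaced by inequalities between difference quotients.
  \<open>contraction\<close> reflects (v), \<open>ratio\<close> is (iii) integrated over
  \<open>{p..q}\<close>, \<open>ratio_lim\<close> is (iv) and \<open>b_ratio\<close> is (ii).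
  Keeping \<open>q - p\<close> in the exponent of \<open>ratio\<close> is what later makes
  distortion small on short intervals.\<close>

locale interval_system =
  fixes b :: "nat \<Rightarrow> real" and g :: "nat \<Rightarrow> real \<Rightarrow> real" and \<alpha> c :: real
  assumes b_less: "\<And>i j. i < j \<Longrightarrow> b j < b i"
    and b_0: "b 0 = 1"
    and b_lim: "b \<longlonglongrightarrow> 0"
    and \<alpha>: "0 < \<alpha>" "\<alpha> < 1"
    and c: "0 < c"
    and contraction: "\<And>k x y. 1 \<le> k \<Longrightarrow> x \<in> {0..1} \<Longrightarrow> y \<in> {0..1} \<Longrightarrow> \<bar>g k x - g k y\<bar> \<le> \<alpha> * \<bar>x - y\<bar>"
    and antimono: "\<And>k x y. 1 \<le> k \<Longrightarrow> x \<in> {0..1} \<Longrightarrow> y \<in> {0..1} \<Longrightarrow> x < y \<Longrightarrow> g k y < g k x"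
    and image: "\<And>k. 1 \<le> k \<Longrightarrow> g k ` {0..1} = {b k..b (k - 1)}"
    and ratio: "\<And>k p q x y u v. 1 \<le> k \<Longrightarrow> 0 \<le> p \<Longrightarrow> q \<le> 1 \<Longrightarrow> {x, y, u, v} \<subseteq> {p..q} \<Longrightarrow>
      \<bar>g k x - g k y\<bar> * \<bar>u - v\<bar> \<le> exp (c * (q - p)) * (\<bar>g k u - g k v\<bar> * \<bar>x - y\<bar>)"
    and ratio_lim: "\<And>\<theta>. 1 < \<theta> \<Longrightarrow> \<forall>\<^sub>F k in sequentially. \<forall>x y u v. {x, y, u, v} \<subseteq> {0..1} \<longrightarrow>
      \<bar>g k x - g k y\<bar> * \<bar>u - v\<bar> \<le> \<theta> * (\<bar>g k u - g k v\<bar> * \<bar>x - y\<bar>)"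
    and b_ratio: "\<And>\<theta>. 1 < \<theta> \<Longrightarrow> \<forall>\<^sub>F k in sequentially. b k \<le> \<theta> * b (Suc k)"
begin

abbreviation "\<phi> \<equiv> word_map g"

lemma b_le: "i \<le> j \<Longrightarrow> b j \<le> b i"
  using b_less[of i j] by (cases "i = j") auto

lemma b_pos: "0 < b i"
proof -
  have "0 \<le> b (Suc i)"
    by (rule LIMSEQ_le_const2[OF b_lim]) (auto intro!: exI[of _ "Suc i"] b_le)
  with b_less[of i "Suc i"] show ?thesis by simp
qed

lemma b_le_1: "b i \<le> 1"
  using b_le[of 0 i] b_0 by simp

lemma g_mem: "1 \<le> k \<Longrightarrow> x \<in> {0..1} \<Longrightarrow> g k x \<in> {b k..b (k - 1)}"
  using image by blast

lemma g_mem_unit: "1 \<le> k \<Longrightarrow> x \<in> {0..1} \<Longrightarrow> g k x \<in> {0..1}"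
  using g_mem[of k x] b_pos[of k] b_le_1[of "k - 1"] by simp

lemma g_le: "1 \<le> k \<Longrightarrow> x \<in> {0..1} \<Longrightarrow> y \<in> {0..1} \<Longrightarrow> x \<le> y \<Longrightarrow> g k y \<le> g k x"
  using antimono[of k x y] by (cases "x = y") auto

lemma g_less_iff: "1 \<le> k \<Longrightarrow> x \<in> {0..1} \<Longrightarrow> y \<in> {0..1} \<Longrightarrow> g k y < g k x \<longleftrightarrow> x < y"
  using antimono[of k x y] g_le[of k y x] by force

lemma g_0: "1 \<le> k \<Longrightarrow> g k 0 = b (k - 1)"
proof -
  assume k: "1 \<le> k"
  have "b (k - 1) \<in> g k ` {0..1}" using image[OF k] b_le[of "k - 1" k] by auto
  then obtain x where x: "x \<in> {0..1}" "g k x = b (k - 1)" by auto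
  then have "b (k - 1) \<le> g k 0" using g_le[OF k, of 0 x] by auto
  then show ?thesis using g_mem[OF k, of 0] by auto
qed

lemma g_1: "1 \<le> k \<Longrightarrow> g k 1 = b k"
proof -
  assume k: "1 \<le> k"
  have "b k \<in> g k ` {0..1}" using image[OF k] b_le[of "k - 1" k] by auto
  then obtain x where x: "x \<in> {0..1}" "g k x = b k" by auto
  then have "g k 1 \<le> b k" using g_le[OF k, of x 1] by auto
  then show ?thesis using g_mem[OF k, of 1] by auto
qed

lemma g_image:
  assumes "1 \<le> k" "0 \<le> p" "p \<le> q" "q \<le> 1"
  shows "g k ` {p..q} = {g k q..g k p}"
proof
  show "g k ` {p..q} \<subseteq> {g k q..g k p}" using assms by (auto intro!: g_le)
  show "{g k q..g k p} \<subseteq> g k ` {p..q}"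
  proof
    fix y assume y: "y \<in> {g k q..g k p}"
    then have "y \<in> g k ` {0..1}"
      using g_mem[OF assms(1), of p] g_mem[OF assms(1), of q] assms unfolding image[OF assms(1)] by auto
    then obtain x where x: "x \<in> {0..1}" "y = g k x" by auto
    have "\<not> x < p" using antimono[of k x p] assms x y by auto
    moreover have "\<not> q < x" using antimono[of k q x] assms x y by auto
    ultimately show "y \<in> g k ` {p..q}" using x by auto
  qed
qed

lemma \<phi>_mem: "0 \<notin> set w \<Longrightarrow> x \<in> {0..1} \<Longrightarrow> \<phi> w x \<in> {0..1}"
proof (induction w)
  case (Cons k w)
  then have "\<phi> w x \<in> {0..1}" "1 \<le> k" by auto
  then show ?case using g_mem_unit[of k "\<phi> w x"] by simp
qed simp

lemma \<phi>_inj: "0 \<notin> set w \<Longrightarrow> inj_on (\<phi> w) {0..1}"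
proof (induction w)
  case (Cons k w)
  then have k: "1 \<le> k" by auto
  have "inj_on (g k) {0..1}"
  proof (rule inj_onI)
    fix x y assume "x \<in> {0..1}" "y \<in> {0..1}" "g k x = g k y"
    then show "x = y" using antimono[OF k, of x y] antimono[OF k, of y x] by force
  qed
  moreover have "\<phi> w ` {0..1} \<subseteq> {0..1}" using \<phi>_mem[of w] Cons by auto
  ultimately have "inj_on (g k \<circ> \<phi> w) {0..1}"
    using Cons by (intro comp_inj_on) (auto intro: inj_on_subset)
  then show ?case by (simp add: comp_def)
qed (auto simp: inj_on_def)

lemma \<phi>_eq_iff: "0 \<notin> set w \<Longrightarrow> x \<in> {0..1} \<Longrightarrow> y \<in> {0..1} \<Longrightarrow> \<phi> w x = \<phi> w y \<longleftrightarrow> x = y"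
  using \<phi>_inj inj_on_eq_iff by metis

lemma \<phi>_image:
  assumes "0 \<notin> set w" "0 \<le> p" "p \<le> q" "q \<le> 1"
  shows "\<phi> w ` {p..q} = {min (\<phi> w p) (\<phi> w q)..max (\<phi> w p) (\<phi> w q)}"
  using assms(1)
proof (induction w)
  case Nil
  then show ?case using assms by (simp add: min_def max_def)
next
  case (Cons k w)
  let ?l = "min (\<phi> w p) (\<phi> w q)" and ?u = "max (\<phi> w p) (\<phi> w q)"
  have k: "1 \<le> k" using Cons by auto
  have mem: "\<phi> w p \<in> {0..1}" "\<phi> w q \<in> {0..1}" using \<phi>_mem[of w] Cons assms by auto
  have "\<phi> (k # w) ` {p..q} = g k ` \<phi> w ` {p..q}" by (simp add: image_image)
  also have "\<dots> = g k ` {?l..?u}" using Cons by simp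
  also have "\<dots> = {g k ?u..g k ?l}" using mem by (intro g_image[OF k]) auto
  also have "\<dots> = {min (\<phi> (k # w) p) (\<phi> (k # w) q)..max (\<phi> (k # w) p) (\<phi> (k # w) q)}"
    using g_le[OF k mem] g_le[OF k mem(2,1)] by (cases "\<phi> w p \<le> \<phi> w q") (simp_all add: min_def max_def)
  finally show ?case .
qed

lemma \<phi>_image_open:
  assumes "0 \<notin> set w" "0 \<le> p" "p \<le> q" "q \<le> 1"
  shows "\<phi> w ` {p<..<q} = {min (\<phi> w p) (\<phi> w q)<..<max (\<phi> w p) (\<phi> w q)}"
proof -
  have eq: "{p<..<q} = {p..q} - {p, q}" by auto
  have "\<phi> w ` {p<..<q} = \<phi> w ` {p..q} - \<phi> w ` {p, q}"
    unfolding eq by (rule inj_on_image_set_diff[OF \<phi>_inj[OF assms(1)]]) (use assms in auto)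
  also have "\<dots> = {min (\<phi> w p) (\<phi> w q)<..<max (\<phi> w p) (\<phi> w q)}"
    unfolding \<phi>_image[OF assms] by (cases "\<phi> w p \<le> \<phi> w q") (auto simp: min_def max_def)
  finally show ?thesis .
qed

lemma \<phi>_contraction:
  assumes "0 \<notin> set w" "x \<in> {0..1}" "y \<in> {0..1}"
  shows "\<bar>\<phi> w x - \<phi> w y\<bar> \<le> \<alpha> ^ length w * \<bar>x - y\<bar>"
  using assms(1)
proof (induction w)
  case (Cons k w)
  have k: "1 \<le> k" using Cons by auto
  have "\<bar>\<phi> (k # w) x - \<phi> (k # w) y\<bar> \<le> \<alpha> * \<bar>\<phi> w x - \<phi> w y\<bar>"
    using contraction[OF k] \<phi>_mem[of w] Cons assms by auto
  also have "\<dots> \<le> \<alpha> * (\<alpha> ^ length w * \<bar>x - y\<bar>)" using Cons \<alpha> by (intro mult_left_mono) auto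
  finally show ?case by (simp add: algebra_simps)
qed simp

text \<open>The sum of the geometric series of the terms \<open>c * \<alpha> ^ j\<close>;
  \<open>K\<close> is the resulting distortion bound on the whole unit interval.\<close>

definition "C = c / (1 - \<alpha>)"
definition "K = exp C"

lemma C_pos: "0 < C" using c \<alpha> by (simp add: C_def)

lemma K_gt_1: "1 < K" using C_pos by (simp add: K_def)

text \<open>Bounded distortion. A letter applied after \<open>j\<close> others sees an interval of
  length at most \<open>\<alpha> ^ j * (q - p)\<close>, so it contributes the factor
  \<open>exp (c * \<alpha> ^ j * (q - p))\<close>. The exponents sum to at most
  \<open>C * (q - p)\<close>, uniformly in the length of the word.\<close>

lemma \<phi>_ratio:
  assumes w: "0 \<notin> set w" and pq: "0 \<le> p" "q \<le> 1" and sub: "{x, y, u, v} \<subseteq> {p..q}"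
  shows "\<bar>\<phi> w x - \<phi> w y\<bar> * \<bar>u - v\<bar> \<le> exp (C * (q - p)) * (\<bar>\<phi> w u - \<phi> w v\<bar> * \<bar>x - y\<bar>)"
proof (cases "x = y \<or> u = v")
  case False
  have "p \<le> q" using sub by auto
  define S where "S m = c * (q - p) * (\<Sum>j<m. \<alpha> ^ j)" for m :: nat
  have "\<bar>\<phi> w x - \<phi> w y\<bar> * \<bar>u - v\<bar> \<le> exp (S (length w)) * (\<bar>\<phi> w u - \<phi> w v\<bar> * \<bar>x - y\<bar>)"
    using w
  proof (induction w)
    case (Cons k w)
    have k: "1 \<le> k" and w: "0 \<notin> set w" using Cons by auto
    let ?P = "min (\<phi> w p) (\<phi> w q)" and ?Q = "max (\<phi> w p) (\<phi> w q)"
    have mem: "\<phi> w p \<in> {0..1}" "\<phi> w q \<in> {0..1}" using \<phi>_mem[OF w] pq \<open>p \<le> q\<close> by auto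
    have im: "{\<phi> w x, \<phi> w y, \<phi> w u, \<phi> w v} \<subseteq> {?P..?Q}"
      using sub unfolding \<phi>_image[OF w pq(1) \<open>p \<le> q\<close> pq(2), symmetric] by auto
    have "?Q - ?P = \<bar>\<phi> w p - \<phi> w q\<bar>" by (auto simp: min_def max_def)
    also have "\<dots> \<le> \<alpha> ^ length w * (q - p)" using \<phi>_contraction[OF w, of p q] pq \<open>p \<le> q\<close> by auto
    finally have "c * (?Q - ?P) \<le> c * (\<alpha> ^ length w * (q - p))"
      using c \<open>p \<le> q\<close> by (intro mult_left_mono) auto
    then have le: "exp (c * (?Q - ?P)) * (\<bar>\<phi> (k # w) u - \<phi> (k # w) v\<bar> * \<bar>\<phi> w x - \<phi> w y\<bar>)
       \<le> exp (c * (\<alpha> ^ length w * (q - p))) * (\<bar>\<phi> (k # w) u - \<phi> (k # w) v\<bar> * \<bar>\<phi> w x - \<phi> w y\<bar>)"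
      by (intro mult_right_mono) auto
    have "\<bar>\<phi> (k # w) x - \<phi> (k # w) y\<bar> * \<bar>\<phi> w u - \<phi> w v\<bar>
       \<le> exp (c * (?Q - ?P)) * (\<bar>\<phi> (k # w) u - \<phi> (k # w) v\<bar> * \<bar>\<phi> w x - \<phi> w y\<bar>)"
      using ratio[OF k, of ?P ?Q] mem im by simp
    then have "\<bar>\<phi> (k # w) x - \<phi> (k # w) y\<bar> * \<bar>u - v\<bar> \<le>
       (exp (c * (\<alpha> ^ length w * (q - p))) * exp (S (length w))) * (\<bar>\<phi> (k # w) u - \<phi> (k # w) v\<bar> * \<bar>x - y\<bar>)"
    proof (rule compose_ratio_le[OF order_trans[OF _ le]])
      show "\<bar>\<phi> w x - \<phi> w y\<bar> * \<bar>u - v\<bar> \<le> exp (S (length w)) * (\<bar>\<phi> w u - \<phi> w v\<bar> * \<bar>x - y\<bar>)"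
        using Cons w by simp
      show "0 < \<bar>\<phi> w u - \<phi> w v\<bar>" "0 < \<bar>\<phi> w x - \<phi> w y\<bar>"
        using \<phi>_eq_iff[OF w] False sub pq by auto
    qed auto
    also have "exp (c * (\<alpha> ^ length w * (q - p))) * exp (S (length w)) = exp (S (length (k # w)))"
      by (simp add: exp_add[symmetric] S_def algebra_simps)
    finally show ?case .
  qed (simp add: S_def)
  also have "exp (S (length w)) \<le> exp (C * (q - p))"
  proof -
    have "(\<Sum>j<length w. \<alpha> ^ j) \<le> 1 / (1 - \<alpha>)"
      using \<alpha> by (simp add: sum_gp_strict divide_right_mono)
    then have "c * (q - p) * (\<Sum>j<length w. \<alpha> ^ j) \<le> c * (q - p) * (1 / (1 - \<alpha>))"
      using c \<open>p \<le> q\<close> by (intro mult_left_mono) auto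
    then show ?thesis by (simp add: S_def C_def mult.commute)
  qed
  finally show ?thesis by (simp add: mult_right_mono)
qed auto

definition "\<Delta> w = \<bar>\<phi> w 0 - \<phi> w 1\<bar>"

lemma \<Delta>_pos: "0 \<notin> set w \<Longrightarrow> 0 < \<Delta> w"
  using \<phi>_eq_iff[of w 0 1] by (auto simp: \<Delta>_def)

lemma \<Delta>_nonneg [simp]: "0 \<le> \<Delta> w" by (simp add: \<Delta>_def)

lemma \<Delta>_le: "0 \<notin> set w \<Longrightarrow> \<Delta> w \<le> \<alpha> ^ length w"
  using \<phi>_contraction[of w 0 1] by (simp add: \<Delta>_def)

lemma \<phi>_upper:
  assumes "0 \<notin> set w" "x \<in> {0..1}" "y \<in> {0..1}"
  shows "\<bar>\<phi> w x - \<phi> w y\<bar> \<le> K * \<Delta> w * \<bar>x - y\<bar>"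
  using \<phi>_ratio[of w 0 1 x y 0 1] assms by (simp add: K_def \<Delta>_def algebra_simps)

lemma \<phi>_lower:
  assumes "0 \<notin> set w" "x \<in> {0..1}" "y \<in> {0..1}"
  shows "\<Delta> w * \<bar>x - y\<bar> \<le> K * \<bar>\<phi> w x - \<phi> w y\<bar>"
  using \<phi>_ratio[of w 0 1 0 1 x y] assms by (simp add: K_def \<Delta>_def algebra_simps)

lemma \<Delta>_append_le:
  assumes "0 \<notin> set u" "0 \<notin> set v"
  shows "\<Delta> (u @ v) \<le> K * \<Delta> u * \<Delta> v"
  using \<phi>_upper[OF assms(1) \<phi>_mem[OF assms(2), of 0] \<phi>_mem[OF assms(2), of 1]] by (simp add: \<Delta>_def)

lemma \<Delta>_append_ge:
  assumes "0 \<notin> set u" "0 \<notin> set v"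
  shows "\<Delta> u * \<Delta> v \<le> K * \<Delta> (u @ v)"
  using \<phi>_lower[OF assms(1) \<phi>_mem[OF assms(2), of 0] \<phi>_mem[OF assms(2), of 1]] by (simp add: \<Delta>_def)

section \<open>Disjointness of cylinders and their total length\<close>

lemma g_open:
  assumes "1 \<le> k" "x \<in> {0<..<1}"
  shows "g k x \<in> {b k<..<b (k - 1)}"
  using antimono[OF assms(1), of 0 x] antimono[OF assms(1), of x 1] g_0[OF assms(1)] g_1[OF assms(1)] assms by auto

lemma g_closed_open_disjoint:
  assumes "1 \<le> i" "1 \<le> j" "i \<noteq> j" "x \<in> {0<..<1}" "y \<in> {0..1}"
  shows "g i x \<noteq> g j y"
proof
  assume eq: "g i x = g j y"
  have "g i x \<in> {b i<..<b (i - 1)}" "g i x \<in> {b j..b (j - 1)}"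
    using g_open[of i x] g_mem[of j y] assms eq by auto
  moreover consider "i \<le> j - 1" | "j \<le> i - 1" using assms by linarith
  ultimately show False using b_le[of i "j - 1"] b_le[of j "i - 1"] by cases auto
qed

lemma \<phi>_open:
  assumes "0 \<notin> set w" "x \<in> {0<..<1}"
  shows "\<phi> w x \<in> {0<..<1}"
  using assms
proof (induction w)
  case (Cons k w)
  then have "\<phi> w x \<in> {0<..<1}" "1 \<le> k" by auto
  then show ?case using g_open[of k "\<phi> w x"] b_pos[of k] b_le_1[of "k - 1"] by auto
qed simp

text \<open>Neighbouring cylinders share an endpoint, so one of the two arguments has to be
  interior. Injectivity strips the common prefix, after which the first differing letters separate
  the points.\<close>

lemma parallel_disjoint:
  assumes "0 \<notin> set u" "0 \<notin> set v" "u \<parallel> v" "x \<in> {0<..<1}" "y \<in> {0..1}"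
  shows "\<phi> u x \<noteq> \<phi> v y"
proof
  assume eq: "\<phi> u x = \<phi> v y"
  obtain as i bs j cs where d: "i \<noteq> j" "u = as @ i # bs" "v = as @ j # cs"
    using parallel_decomp[OF assms(3)] by blast
  then have z: "0 \<notin> set as" "0 \<notin> set bs" "0 \<notin> set cs" and ij: "1 \<le> i" "1 \<le> j" using assms by auto
  have x: "\<phi> bs x \<in> {0<..<1}" and y: "\<phi> cs y \<in> {0..1}"
    using \<phi>_open[OF z(2)] \<phi>_mem[OF z(3)] assms by blast+
  have "g i (\<phi> bs x) \<in> {0..1}" "g j (\<phi> cs y) \<in> {0..1}" using g_mem_unit[OF ij(1)] g_mem_unit[OF ij(2)] x y by auto
  then have "g i (\<phi> bs x) = g j (\<phi> cs y)"
    using eq \<phi>_inj[OF z(1)] by (auto simp: d dest: inj_onD)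
  then show False using g_closed_open_disjoint[OF ij d(1) x y] by simp
qed

definition "antichain W \<longleftrightarrow> (\<forall>u\<in>W. \<forall>v\<in>W. u \<noteq> v \<longrightarrow> u \<parallel> (v :: nat list))"

text \<open>Open cylinders of an antichain are disjoint, so this is additivity of Lebesgue measure
  inside the image of \<open>{p..q}\<close>. The prefix \<open>v\<close> is carried along because
  the lower bound needs the estimate under every word map.\<close>

lemma sum_\<Delta>_le:
  assumes "finite W" "antichain W" "\<And>w. w \<in> W \<Longrightarrow> 0 \<notin> set w" "0 \<notin> set v" "0 \<le> p" "p \<le> q" "q \<le> 1"
    and sub: "\<And>w. w \<in> W \<Longrightarrow> \<phi> w ` {0<..<1} \<subseteq> {p..q}"
  shows "(\<Sum>w\<in>W. \<Delta> (v @ w)) \<le> \<bar>\<phi> v p - \<phi> v q\<bar>"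
proof -
  let ?a = "\<lambda>w. min (\<phi> (v @ w) 0) (\<phi> (v @ w) 1)" and ?b = "\<lambda>w. max (\<phi> (v @ w) 0) (\<phi> (v @ w) 1)"
  have im: "{?a w<..<?b w} = \<phi> v ` \<phi> w ` {0<..<1}" if "w \<in> W" for w
    using \<phi>_image_open[of "v @ w" 0 1] assms that by (simp add: image_image)
  have "(\<Sum>w\<in>W. \<Delta> (v @ w)) = (\<Sum>w\<in>W. ?b w - ?a w)"
    by (intro sum.cong) (auto simp: \<Delta>_def)
  also have "\<dots> \<le> max (\<phi> v p) (\<phi> v q) - min (\<phi> v p) (\<phi> v q)"
  proof (rule sum_disjoint_intervals_le[OF assms(1)])
    show "disjoint_family_on (\<lambda>w. {?a w<..<?b w}) W"
      unfolding disjoint_family_on_def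
    proof (intro ballI impI)
      fix w w' assume w: "w \<in> W" "w' \<in> W" "w \<noteq> w'"
      then have "w \<parallel> w'" using assms(2) by (auto simp: antichain_def)
      then have "(v @ w) \<parallel> (v @ w')" by (auto simp: parallel_def)
      then have "\<phi> (v @ w) x \<noteq> \<phi> (v @ w') y" if "x \<in> {0<..<1}" "y \<in> {0<..<1}" for x y
        using parallel_disjoint[of "v @ w" "v @ w'" x y] w assms that by auto
      then show "{?a w<..<?b w} \<inter> {?a w'<..<?b w'} = {}"
        unfolding im[OF w(1)] im[OF w(2)] by (auto simp: image_image)
    qed
  next
    fix w assume "w \<in> W"
    then have "{?a w<..<?b w} \<subseteq> \<phi> v ` {p..q}" unfolding im[OF \<open>w \<in> W\<close>] using sub by blast
    then show "{?a w<..<?b w} \<subseteq> {min (\<phi> v p) (\<phi> v q)..max (\<phi> v p) (\<phi> v q)}"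
      using \<phi>_image[of v p q] assms by simp
  qed auto
  finally show ?thesis by (simp add: max_def min_def split: if_splits)
qed

lemma sum_\<Delta>_le_1:
  assumes "finite W" "antichain W" "\<And>w. w \<in> W \<Longrightarrow> 0 \<notin> set w"
  shows "(\<Sum>w\<in>W. \<Delta> w) \<le> 1"
  using sum_\<Delta>_le[of W "[]" 0 1] assms \<phi>_open by force

text \<open>The maps of words ending in \<open>k\<close> are, up to the factor \<theta> on both
  sides, affine with slope \<open>\<Delta> (v @ [k])\<close>. The point is the uniformity in the
  prefix \<open>v\<close>.\<close>

definition "good \<theta> k \<longleftrightarrow> 1 \<le> k \<and> (\<forall>v x y. 0 \<notin> set v \<longrightarrow> x \<in> {0..1} \<longrightarrow> y \<in> {0..1} \<longrightarrow>
   \<bar>\<phi> (v @ [k]) x - \<phi> (v @ [k]) y\<bar> \<le> \<theta> * \<Delta> (v @ [k]) * \<bar>x - y\<bar> \<and>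
   \<Delta> (v @ [k]) * \<bar>x - y\<bar> \<le> \<theta> * \<bar>\<phi> (v @ [k]) x - \<phi> (v @ [k]) y\<bar>)"

lemma eventually_exp_b_le:
  assumes "1 < \<theta>"
  shows "\<forall>\<^sub>F k in sequentially. exp (C * b k) \<le> \<theta>"
proof -
  have "(\<lambda>k. exp (C * b k)) \<longlonglongrightarrow> exp (C * 0)" by (intro tendsto_intros b_lim)
  then have "\<forall>\<^sub>F k in sequentially. exp (C * b k) < \<theta>"
    using assms by (intro order_tendstoD(2)) auto
  then show ?thesis by eventually_elim simp
qed

text \<open>With \<theta> split as \<open>s * s\<close>, one factor pays for \<open>g k\<close> by
  \<open>ratio_lim\<close>, the other for the prefix, which acts on an interval of length at most
  \<open>b (k - 1)\<close> and so has distortion at most \<open>exp (C * b (k - 1))\<close>.\<close>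

lemma eventually_good:
  assumes "1 < \<theta>"
  shows "\<forall>\<^sub>F k in sequentially. good \<theta> k"
proof -
  define s where "s = sqrt \<theta>"
  have s: "1 < s" "s * s = \<theta>" using assms by (auto simp: s_def)
  have "\<forall>\<^sub>F k in sequentially. exp (C * b (k - 1)) \<le> s"
    using eventually_exp_b_le[OF s(1)] eventually_sequentially_seg[of "\<lambda>k. exp (C * b (k - 1)) \<le> s" 1]
    by simp
  then show ?thesis using ratio_lim[OF s(1)] eventually_ge_at_top[of 1]
  proof eventually_elim
    case (elim k)
    have k: "1 \<le> k" using elim by simp
    have main: "\<bar>\<phi> (v @ [k]) x - \<phi> (v @ [k]) y\<bar> * \<bar>t - z\<bar> \<le> \<theta> * (\<bar>\<phi> (v @ [k]) t - \<phi> (v @ [k]) z\<bar> * \<bar>x - y\<bar>)"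
      if v: "0 \<notin> set v" and m: "{x, y, t, z} \<subseteq> {0..1}" for v :: "nat list" and x y t z
    proof (cases "x = y \<or> t = z")
      case False
      have "\<bar>\<phi> v (g k x) - \<phi> v (g k y)\<bar> * \<bar>g k t - g k z\<bar>
        \<le> exp (C * (b (k - 1) - b k)) * (\<bar>\<phi> v (g k t) - \<phi> v (g k z)\<bar> * \<bar>g k x - g k y\<bar>)"
        by (rule \<phi>_ratio[OF v]) (use g_mem[OF k] m b_pos[of k] b_le_1 in \<open>auto simp: less_imp_le\<close>)
      also have "\<dots> \<le> s * (\<bar>\<phi> v (g k t) - \<phi> v (g k z)\<bar> * \<bar>g k x - g k y\<bar>)"
      proof (rule mult_right_mono)
        have "C * (b (k - 1) - b k) \<le> C * b (k - 1)" using C_pos b_pos[of k] by simp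
        then have "exp (C * (b (k - 1) - b k)) \<le> exp (C * b (k - 1))" by (simp only: exp_le_cancel_iff)
        then show "exp (C * (b (k - 1) - b k)) \<le> s" using elim(1) by (rule order_trans)
      qed auto
      finally have 1: "\<bar>\<phi> v (g k x) - \<phi> v (g k y)\<bar> * \<bar>g k t - g k z\<bar>
         \<le> s * (\<bar>\<phi> v (g k t) - \<phi> v (g k z)\<bar> * \<bar>g k x - g k y\<bar>)" .
      have 2: "\<bar>g k x - g k y\<bar> * \<bar>t - z\<bar> \<le> s * (\<bar>g k t - g k z\<bar> * \<bar>x - y\<bar>)"
        using elim(2) m by blast
      have ne: "g k x \<noteq> g k y" "g k t \<noteq> g k z" using \<phi>_eq_iff[of "[k]"] False m k by auto
      show ?thesis unfolding s(2)[symmetric] word_map_append word_map_Cons word_map_Nil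
        by (rule compose_ratio_le[OF 1 2]) (use s ne in auto)
    qed auto
    show ?case unfolding good_def
    proof (intro conjI allI impI k)
      fix v :: "nat list" and x y assume *: "0 \<notin> set v" "x \<in> {0..1::real}" "y \<in> {0..1::real}"
      show "\<bar>\<phi> (v @ [k]) x - \<phi> (v @ [k]) y\<bar> \<le> \<theta> * \<Delta> (v @ [k]) * \<bar>x - y\<bar>"
        using main[of v x y 0 1] * by (simp add: \<Delta>_def algebra_simps)
      show "\<Delta> (v @ [k]) * \<bar>x - y\<bar> \<le> \<theta> * \<bar>\<phi> (v @ [k]) x - \<phi> (v @ [k]) y\<bar>"
        using main[of v 0 1 x y] * by (simp add: \<Delta>_def algebra_simps)
    qed
  qed
qed

end

section \<open>The limit set and its dimension\<close>

text \<open>A finite sum of powers of positive numbers is continuous in the exponent, so a strict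
  inequality survives a small change. This and its counterpart for larger exponents are how a strict
  inequality at \<open>h\<close> contradicts that \<open>h\<close> is the dimension.\<close>

lemma exists_less_sum_powr_less_1:
  fixes L :: "'i \<Rightarrow> real"
  assumes "0 < h" "\<And>i. i \<in> I \<Longrightarrow> 0 < L i" "(\<Sum>i\<in>I. L i powr h) < 1"
  obtains s where "0 < s" "s < h" "(\<Sum>i\<in>I. L i powr s) < 1"
proof -
  have "((\<lambda>s. \<Sum>i\<in>I. L i powr s) \<longlongrightarrow> (\<Sum>i\<in>I. L i powr h)) (at_left h)"
    by (intro tendsto_sum tendsto_powr tendsto_const tendsto_ident_at) (use assms in force)
  then have "\<forall>\<^sub>F s in at_left h. (\<Sum>i\<in>I. L i powr s) < 1"
    using assms by (intro order_tendstoD(2)) auto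
  moreover have "\<forall>\<^sub>F s in at_left h. s \<in> {0<..<h}" using assms by (intro eventually_at_left_real)
  ultimately have "\<forall>\<^sub>F s in at_left h. 0 < s \<and> s < h \<and> (\<Sum>i\<in>I. L i powr s) < 1"
    by eventually_elim auto
  then show ?thesis using that eventually_happens'[OF trivial_limit_at_left_real] by blast
qed

lemma exists_greater_sum_powr_greater_1:
  fixes L :: "'i \<Rightarrow> real"
  assumes "\<And>i. i \<in> I \<Longrightarrow> 0 < L i" "1 < (\<Sum>i\<in>I. L i powr h)"
  obtains s where "h < s" "1 < (\<Sum>i\<in>I. L i powr s)"
proof -
  have "((\<lambda>s. \<Sum>i\<in>I. L i powr s) \<longlongrightarrow> (\<Sum>i\<in>I. L i powr h)) (at_right h)"
    by (intro tendsto_sum tendsto_powr tendsto_const tendsto_ident_at) (use assms in force)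
  then have "\<forall>\<^sub>F s in at_right h. 1 < (\<Sum>i\<in>I. L i powr s)"
    using assms by (intro order_tendstoD(1)) auto
  moreover have "\<forall>\<^sub>F s in at_right h. h < s" by (rule eventually_at_right_less)
  ultimately have "\<forall>\<^sub>F s in at_right h. h < s \<and> 1 < (\<Sum>i\<in>I. L i powr s)"
    by eventually_elim auto
  then show ?thesis using that eventually_happens'[OF trivial_limit_at_right_real] by blast
qed

context interval_system
begin

section \<open>Levels of cylinders and invariance of the limit set\<close>

abbreviation "J n \<equiv> limit_set g n"

definition words :: "nat \<Rightarrow> nat \<Rightarrow> nat list set" where
  "words n l = {q. length q = l \<and> set q \<subseteq> {1..n}}"

definition cylinders :: "nat \<Rightarrow> nat \<Rightarrow> real set" where
  "cylinders n l = (\<Union>q\<in>words n l. \<phi> q ` {0..1})"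

lemma finite_words: "finite (words n l)"
proof -
  have "words n l = {q. set q \<subseteq> {1..n} \<and> length q = l}" by (auto simp: words_def)
  then show ?thesis by (simp add: finite_lists_length_eq)
qed

lemma words_nonzero: "q \<in> words n l \<Longrightarrow> 0 \<notin> set q"
  by (auto simp: words_def)

lemma nonzero_of_subset: "set q \<subseteq> {1..n} \<Longrightarrow> (0::nat) \<notin> set q"
  by force

lemma words_Suc: "words n (Suc l) = (\<Union>i\<in>{1..n}. (#) i ` words n l)"
  by (auto simp: words_def length_Suc_conv image_iff)

lemma cylinders_0: "cylinders n 0 = {0..1}"
  by (auto simp: cylinders_def words_def)

lemma cylinders_Suc: "cylinders n (Suc l) = (\<Union>i\<in>{1..n}. g i ` cylinders n l)"
  by (auto simp: cylinders_def words_Suc)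

lemma cylinders_unit: "cylinders n l \<subseteq> {0..1}"
proof
  fix x assume "x \<in> cylinders n l"
  then obtain q y where "q \<in> words n l" "y \<in> {0..1}" "x = \<phi> q y" by (auto simp: cylinders_def)
  then show "x \<in> {0..1}" using \<phi>_mem[of q y] words_nonzero by auto
qed

lemma cylinders_decreasing: "cylinders n (Suc l) \<subseteq> cylinders n l"
proof (induction l)
  case 0
  then show ?case using cylinders_unit by (auto simp: cylinders_0)
next
  case (Suc l)
  then show ?case by (subst (1 2) cylinders_Suc) blast
qed

lemma cylinders_antimono: "l \<le> m \<Longrightarrow> cylinders n m \<subseteq> cylinders n l"
  by (rule lift_Suc_antimono_le[of "cylinders n", OF cylinders_decreasing])

text \<open>\<open>limit_set\<close> starts at level 1. Level 0 is the unit interval and the levels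
  decrease, so including it changes nothing.\<close>

lemma J_eq: "J n = (\<Inter>l. cylinders n l)"
proof
  show "(\<Inter>l. cylinders n l) \<subseteq> J n" by (auto simp: limit_set_def cylinders_def words_def)
  show "J n \<subseteq> (\<Inter>l. cylinders n l)"
  proof (intro subsetI INT_I)
    fix x l assume "x \<in> J n"
    then have "x \<in> cylinders n (Suc l)" by (auto simp: limit_set_def cylinders_def words_def)
    then show "x \<in> cylinders n l" using cylinders_decreasing by blast
  qed
qed

lemma J_unit: "J n \<subseteq> {0..1}"
  unfolding J_eq using cylinders_0 by blast

lemma J_compact: "compact (J n)"
proof -
  have "closed (cylinders n l)" for l
    unfolding cylinders_def using finite_words words_nonzero by (intro closed_UN) (auto simp: \<phi>_image)
  then have "closed (J n)" unfolding J_eq by blast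
  moreover have "bounded (J n)" by (rule bounded_subset[OF bounded_closed_interval J_unit])
  ultimately show ?thesis by (simp add: compact_eq_bounded_closed)
qed

lemma J_bounded: "bounded (J n)"
  using J_compact compact_imp_bounded by blast

lemma g_J: "i \<in> {1..n} \<Longrightarrow> g i ` J n \<subseteq> J n"
proof -
  assume i: "i \<in> {1..n}"
  have "g i x \<in> cylinders n l" if "x \<in> J n" for x l
  proof -
    have "g i x \<in> cylinders n (Suc l)" using i that unfolding cylinders_Suc J_eq by blast
    then show ?thesis using cylinders_decreasing by blast
  qed
  then show ?thesis unfolding J_eq[of n] by blast
qed

text \<open>At different levels \<open>x\<close> may be reached through different first letters.
  Some letter \<open>j\<close> occurs for infinitely many levels, and by injectivity of
  \<open>g j\<close> the preimage of \<open>x\<close> is the same each time; hence it lies in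
  arbitrarily deep levels.\<close>

lemma J_subset_UN: "J n \<subseteq> (\<Union>i\<in>{1..n}. g i ` J n)"
proof
  fix x assume x: "x \<in> J n"
  have "\<exists>i y. i \<in> {1..n} \<and> y \<in> cylinders n l \<and> x = g i y" for l
    using x unfolding J_eq using cylinders_Suc[of n l] by blast
  then obtain i y where iy: "\<And>l. i l \<in> {1..n}" "\<And>l. y l \<in> cylinders n l" "\<And>l. x = g (i l) (y l)"
    by metis
  have "\<exists>j\<in>i ` UNIV. infinite {l\<in>UNIV. i l = j}"
    using pigeonhole_infinite[of UNIV i] finite_subset[of "range i" "{1..n}"] iy(1) by fastforce
  then obtain j where j: "infinite {l. i l = j}" "j \<in> {1..n}" using iy(1) by auto
  then obtain l0 where l0: "i l0 = j" using infinite_imp_nonempty by fastforce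
  have "y l0 \<in> cylinders n m" for m
  proof -
    obtain l where l: "l \<ge> m" "i l = j" using j(1) infinite_nat_iff_unbounded_le by auto
    have "y l \<in> {0..1}" "y l0 \<in> {0..1}" using iy(2) cylinders_unit by blast+
    then have "y l = y l0" using \<phi>_eq_iff[of "[j]" "y l" "y l0"] iy(3)[of l] iy(3)[of l0] l l0 j(2) by auto
    then show ?thesis using iy(2)[of l] cylinders_antimono[OF l(1)] by auto
  qed
  then have "y l0 \<in> J n" by (simp add: J_eq)
  then show "x \<in> (\<Union>i\<in>{1..n}. g i ` J n)" using iy(3)[of l0] l0 j(2) by blast
qed

lemma J_ge: "x \<in> J n \<Longrightarrow> b n \<le> x"
proof -
  assume "x \<in> J n"
  then obtain i y where "i \<in> {1..n}" "y \<in> J n" "x = g i y" using J_subset_UN by blast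
  then show ?thesis using g_mem[of i y] J_unit[of n] b_le[of i n] by fastforce
qed

text \<open>The limit set stays above \<open>b n\<close>, which excludes 0; the value 1 is excluded
  because it could only arise as \<open>g 1 0\<close>. Therefore pieces of the limit set are truly
  disjoint although the closed cylinders touch.\<close>

lemma J_open: "J n \<subseteq> {0<..<1}"
proof
  fix x assume x: "x \<in> J n"
  then obtain i y where iy: "i \<in> {1..n}" "y \<in> J n" "x = g i y" using J_subset_UN by blast
  have "0 < y" using J_ge[OF iy(2)] b_pos[of n] by simp
  then have "g i y < g i 0" using iy J_unit[of n] by (intro antimono) auto
  then have "x < 1" using iy g_0[of i] b_le_1[of "i - 1"] by auto
  then show "x \<in> {0<..<1}" using J_ge[OF x] b_pos[of n] by simp
qed

lemma J_Int_g_image: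
  assumes "i \<in> {1..n}" "B \<subseteq> {0..1}"
  shows "J n \<inter> g i ` B = g i ` (J n \<inter> B)"
proof
  show "g i ` (J n \<inter> B) \<subseteq> J n \<inter> g i ` B" using g_J[OF assms(1)] by blast
  show "J n \<inter> g i ` B \<subseteq> g i ` (J n \<inter> B)"
  proof
    fix x assume x: "x \<in> J n \<inter> g i ` B"
    then obtain z where z: "z \<in> B" "x = g i z" by auto
    obtain j y where jy: "j \<in> {1..n}" "y \<in> J n" "x = g j y" using J_subset_UN x by blast
    have "y \<in> {0<..<1}" "z \<in> {0..1}" using J_open jy z assms by blast+
    then have "j = i" using g_closed_open_disjoint[of j i y z] jy z assms by auto
    then have "y = z" using \<phi>_eq_iff[of "[i]" y z] jy z \<open>y \<in> {0<..<1}\<close> \<open>z \<in> {0..1}\<close> by auto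
    then show "x \<in> g i ` (J n \<inter> B)" using jy z by blast
  qed
qed

lemma J_Int_\<phi>_image:
  assumes "set w \<subseteq> {1..n}" "B \<subseteq> {0..1}"
  shows "J n \<inter> \<phi> w ` B = \<phi> w ` (J n \<inter> B)"
  using assms(1)
proof (induction w)
  case (Cons i w)
  have "0 \<notin> set w" using Cons.prems nonzero_of_subset[of "i # w" n] by auto
  then have "\<phi> w ` B \<subseteq> {0..1}" using \<phi>_mem[of w] assms(2) by blast
  then show ?case using Cons J_Int_g_image[of i n "\<phi> w ` B"] by (simp add: image_image[symmetric])
qed simp

lemma \<phi>_J: "set w \<subseteq> {1..n} \<Longrightarrow> \<phi> w ` J n \<subseteq> J n"
  using J_Int_\<phi>_image[of w n "J n"] J_unit by blast

lemma \<phi>_J_eq_UN: 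
  assumes "set w \<subseteq> {1..n}"
  shows "\<phi> w ` J n = (\<Union>i\<in>{1..n}. \<phi> (w @ [i]) ` J n)"
proof -
  have "J n = (\<Union>i\<in>{1..n}. g i ` J n)" using J_subset_UN g_J by blast
  then have "\<phi> w ` J n = \<phi> w ` (\<Union>i\<in>{1..n}. g i ` J n)" by simp
  then show ?thesis by (simp add: image_UN image_image)
qed

lemma J_eq_UN_words: "J n = (\<Union>w\<in>words n l. \<phi> w ` J n)"
proof (induction l)
  case 0
  then show ?case by (simp add: words_def)
next
  case (Suc l)
  have "J n = (\<Union>i\<in>{1..n}. g i ` J n)" using J_subset_UN g_J by blast
  also have "\<dots> = (\<Union>i\<in>{1..n}. g i ` (\<Union>w\<in>words n l. \<phi> w ` J n))" using Suc by simp
  also have "\<dots> = (\<Union>w\<in>words n (Suc l). \<phi> w ` J n)" by (auto simp: words_Suc)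
  finally show ?case .
qed

lemma J_nonempty:
  assumes "1 \<le> n"
  shows "J n \<noteq> {}"
proof -
  have "\<exists>!x\<in>{0..1}. g 1 x = x"
    using \<alpha> contraction[of 1] g_mem_unit[of 1]
    by (intro Banach_fix[of _ \<alpha>]) (auto simp: dist_real_def complete_eq_closed less_imp_le)
  then obtain x where x: "x \<in> {0..1}" "g 1 x = x" by blast
  have "x \<in> cylinders n l" for l
    by (induction l) (use x assms in \<open>auto simp: cylinders_0 cylinders_Suc image_iff intro!: bexI[of _ 1] bexI[of _ x]\<close>)
  then show ?thesis by (auto simp: J_eq)
qed

lemma \<phi>_continuous: "0 \<notin> set w \<Longrightarrow> continuous_on {0..1} (\<phi> w)"
proof (rule lipschitz_on_continuous_on[of 1])
  assume w: "0 \<notin> set w"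
  show "1-lipschitz_on {0..1} (\<phi> w)"
  proof (rule lipschitz_onI)
    fix x y :: real assume "x \<in> {0..1}" "y \<in> {0..1}"
    then have "\<bar>\<phi> w x - \<phi> w y\<bar> \<le> \<alpha> ^ length w * \<bar>x - y\<bar>" by (rule \<phi>_contraction[OF w])
    also have "\<dots> \<le> 1 * \<bar>x - y\<bar>" using \<alpha> by (intro mult_right_mono power_le_one) auto
    finally show "dist (\<phi> w x) (\<phi> w y) \<le> 1 * dist x y" by (simp add: dist_real_def)
  qed simp
qed

lemma \<phi>_J_compact: "0 \<notin> set w \<Longrightarrow> compact (\<phi> w ` J n)"
  by (rule compact_continuous_image[OF continuous_on_subset[OF \<phi>_continuous J_unit] J_compact])

lemma \<phi>_J_disjoint:
  assumes "antichain W" "\<And>w. w \<in> W \<Longrightarrow> 0 \<notin> set w"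
  shows "disjoint_family_on (\<lambda>w. \<phi> w ` J n) W"
  unfolding disjoint_family_on_def
proof (intro ballI impI equals0I)
  fix u v y assume uv: "u \<in> W" "v \<in> W" "u \<noteq> v" and "y \<in> \<phi> u ` J n \<inter> \<phi> v ` J n"
  then obtain x z where xz: "x \<in> J n" "z \<in> J n" "\<phi> u x = \<phi> v z" by auto
  have "x \<in> {0<..<1}" "z \<in> {0..1}" using xz J_open J_unit by blast+
  then show False using parallel_disjoint[of u v x z] uv assms xz by (auto simp: antichain_def)
qed

text \<open>Since the first-level pieces of the limit set are separated by gaps, a small subset of the limit
  set lies in a single cylinder of comparable length: take the longest word whose cylinder contains it.\<close>
lemma subset_of_comparable_cylinder:
  assumes "1 \<le> n"
  obtains M where "0 < M" "\<And>F \<rho>. F \<subseteq> J n \<Longrightarrow> 0 < \<rho> \<Longrightarrow> (\<And>x y. x \<in> F \<Longrightarrow> y \<in> F \<Longrightarrow> \<bar>x - y\<bar> \<le> \<rho>) \<Longrightarrow>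
    \<exists>w. set w \<subseteq> {1..n} \<and> F \<subseteq> \<phi> w ` J n \<and> \<Delta> w \<le> M * \<rho>"
proof -
  have ac: "antichain ((\<lambda>i. [i]) ` {1..n})" by (auto simp: antichain_def)
  have nz: "0 \<notin> set w" if "w \<in> (\<lambda>i. [i]) ` {1..n}" for w using that by auto
  have "disjoint_family_on (\<lambda>i. g i ` J n) {1..n}"
    unfolding disjoint_family_on_def
  proof (intro ballI impI)
    fix i j assume "i \<in> {1..n}" "j \<in> {1..n}" "i \<noteq> j"
    then show "g i ` J n \<inter> g j ` J n = {}"
      using disjoint_family_onD[OF \<phi>_J_disjoint[OF ac nz, of n], of "[i]" "[j]"] by simp
  qed
  moreover have "compact (g i ` J n)" if "i \<in> {1..n}" for i
    using \<phi>_J_compact[of "[i]" n] that by simp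
  ultimately obtain \<gamma> where \<gamma>: "0 < \<gamma>" 
    "\<And>i j x y. i \<in> {1..n} \<Longrightarrow> j \<in> {1..n} \<Longrightarrow> i \<noteq> j \<Longrightarrow> x \<in> g i ` J n \<Longrightarrow> y \<in> g j ` J n \<Longrightarrow> \<gamma> \<le> dist x y"
    using finite_disjoint_compact_gap[of "{1..n}" "\<lambda>i. g i ` J n"] by blast
  show thesis
  proof (rule that[of "K / \<gamma>"])
    show "0 < K / \<gamma>" using \<gamma> K_gt_1 by simp
    fix F :: "real set" and \<rho> :: real
    assume F: "F \<subseteq> J n" "0 < \<rho>" "\<And>x y. x \<in> F \<Longrightarrow> y \<in> F \<Longrightarrow> \<bar>x - y\<bar> \<le> \<rho>"
    let ?P = "\<exists>w. set w \<subseteq> {1..n} \<and> F \<subseteq> \<phi> w ` J n \<and> \<Delta> w \<le> K / \<gamma> * \<rho>"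
    have "?P \<or> (\<exists>w\<in>words n l. F \<subseteq> \<phi> w ` J n)" for l
    proof (induction l)
      case 0
      then show ?case using F by (auto simp: words_def)
    next
      case (Suc l)
      show ?case
      proof (cases ?P)
        case False
        with Suc obtain w where w: "set w \<subseteq> {1..n}" "length w = l" "F \<subseteq> \<phi> w ` J n" by (auto simp: words_def)
        have w0: "0 \<notin> set w" using w nonzero_of_subset by blast
        show ?thesis
        proof (cases "\<exists>i\<in>{1..n}. F \<subseteq> \<phi> (w @ [i]) ` J n")
          case True
          then obtain i where "i \<in> {1..n}" "F \<subseteq> \<phi> (w @ [i]) ` J n" by blast
          then show ?thesis using w by (intro disjI2 bexI[of _ "w @ [i]"]) (auto simp: words_def)
        next
          \<comment> \<open>Here \<open>F\<close> meets two different pieces below \<open>w\<close>.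
            The preimages of two such points are at least \<gamma> apart, so bounded distortion
            makes \<open>\<Delta> w\<close> at most \<open>K / \<gamma>\<close> times their
            distance.\<close>
          case no: False
          then have "F \<noteq> {}" using assms by auto
          then obtain x where x: "x \<in> F" by blast
          then obtain i where i: "i \<in> {1..n}" "x \<in> \<phi> (w @ [i]) ` J n" using w \<phi>_J_eq_UN by blast
          then obtain y where y: "y \<in> F" "y \<notin> \<phi> (w @ [i]) ` J n" using no by blast
          then obtain j where j: "j \<in> {1..n}" "y \<in> \<phi> (w @ [j]) ` J n" using w \<phi>_J_eq_UN by blast
          then have "i \<noteq> j" using y by blast
          obtain x' y' where xy: "x' \<in> g i ` J n" "x = \<phi> w x'" "y' \<in> g j ` J n" "y = \<phi> w y'"
            using i j by auto
          have "\<gamma> \<le> \<bar>x' - y'\<bar>" using \<gamma>(2)[OF i(1) j(1) \<open>i \<noteq> j\<close> xy(1,3)] by (simp add: dist_real_def)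
          then have "\<Delta> w * \<gamma> \<le> \<Delta> w * \<bar>x' - y'\<bar>" by (intro mult_left_mono) auto
          also have "\<dots> \<le> K * \<bar>x - y\<bar>" unfolding xy
          proof (rule \<phi>_lower[OF w0])
            show "x' \<in> {0..1}" "y' \<in> {0..1}" using xy g_J[OF i(1)] g_J[OF j(1)] J_unit by blast+
          qed
          also have "\<dots> \<le> K * \<rho>" using F(3)[OF x y(1)] K_gt_1 by simp
          finally have "\<Delta> w \<le> K / \<gamma> * \<rho>" using \<gamma>(1) by (simp add: field_simps)
          then show ?thesis using w by blast
        qed
      qed simp
    qed
    note dich = this
    \<comment> \<open>A set that never splits, such as a single point, lies in a cylinder of every
      level; a deep enough one is short by contraction.\<close>
    obtain l where l: "\<alpha> ^ l < K / \<gamma> * \<rho>"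
      using real_arch_pow_inv[of "K / \<gamma> * \<rho>" \<alpha>] \<alpha> \<gamma> K_gt_1 F by auto
    from dich[of l] show ?P
    proof
      assume "\<exists>w\<in>words n l. F \<subseteq> \<phi> w ` J n"
      then obtain w where w: "w \<in> words n l" "F \<subseteq> \<phi> w ` J n" by blast
      then have "\<Delta> w \<le> \<alpha> ^ l" using \<Delta>_le[of w] words_nonzero by (auto simp: words_def)
      then have "\<Delta> w \<le> K / \<gamma> * \<rho>" using l by linarith
      then show ?P using w by (auto simp: words_def)
    qed
  qed
qed

section \<open>Positive content and antichain sums at the dimension\<close>

abbreviation "hdim n \<equiv> hausdorff_dim (J n)"

text \<open>If the content vanished, some cover by cylinders would have upper Lipschitz constants
  \<open>L i\<close> with sum of \<open>h\<close>-th powers below 1, hence also below 1 at some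
  \<open>s < h\<close>. Subadditivity and scaling then give content 0 at exponent \<open>s\<close>,
  which is impossible below the dimension.\<close>

lemma content_J_pos:
  assumes n: "1 \<le> n" and h: "0 < hdim n"
  shows "0 < rcontent (hdim n) (J n)"
proof (rule ccontr)
  let ?h = "hdim n"
  assume "\<not> 0 < rcontent ?h (J n)"
  then have z: "hausdorff_content ?h (J n) = 0"
    using rcontent_eq_0_iff[OF h J_bounded] rcontent_nonneg[of ?h "J n"] by force
  obtain M where M: "0 < M" "\<And>F \<rho>. F \<subseteq> J n \<Longrightarrow> 0 < \<rho> \<Longrightarrow> (\<And>x y. x \<in> F \<Longrightarrow> y \<in> F \<Longrightarrow> \<bar>x - y\<bar> \<le> \<rho>) \<Longrightarrow>
    \<exists>w. set w \<subseteq> {1..n} \<and> F \<subseteq> \<phi> w ` J n \<and> \<Delta> w \<le> M * \<rho>"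
    using subset_of_comparable_cylinder[OF n] by blast
  have KM: "0 < K * M" using M K_gt_1 by simp
  \<comment> \<open>The threshold is chosen so that the Lipschitz constants, which satisfy
    \<open>L i \<le> K * M * (c i - a i)\<close>, have sum of \<open>h\<close>-th powers below
    1.\<close>
  have "hausdorff_content ?h (J n) < ennreal ((1 / (K * M)) powr ?h)" unfolding z using M(1) K_gt_1 by simp
  then obtain I :: "nat set" and a c where I: "finite I" "\<forall>i. a i < c i" "J n \<subseteq> (\<Union>i\<in>I. {a i<..<c i})"
    and sum: "(\<Sum>i\<in>I. (c i - a i) powr ?h) < (1 / (K * M)) powr ?h"
    by (rule compact_finite_interval_cover[OF J_compact h]) (rule that)
  have "\<exists>w. set w \<subseteq> {1..n} \<and> J n \<inter> {a i<..<c i} \<subseteq> \<phi> w ` J n \<and> \<Delta> w \<le> M * (c i - a i)" for i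
    by (rule M(2)) (use I(2)[THEN spec, of i] in auto)
  then obtain w where w: "\<And>i. set (w i) \<subseteq> {1..n}" "\<And>i. J n \<inter> {a i<..<c i} \<subseteq> \<phi> (w i) ` J n"
     "\<And>i. \<Delta> (w i) \<le> M * (c i - a i)" by metis
  have w0: "0 \<notin> set (w i)" for i using w(1) nonzero_of_subset by blast
  define L where "L i = K * \<Delta> (w i)" for i
  have L: "0 < L i" for i using \<Delta>_pos[OF w0] K_gt_1 by (simp add: L_def)
  have "(\<Sum>i\<in>I. L i powr ?h) \<le> (\<Sum>i\<in>I. (K * M) powr ?h * (c i - a i) powr ?h)"
  proof (rule sum_mono)
    fix i
    have "L i \<le> K * M * (c i - a i)" using w(3)[of i] K_gt_1 by (simp add: L_def)
    then have "L i powr ?h \<le> (K * M * (c i - a i)) powr ?h" using L[of i] h by (intro powr_mono2) auto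
    then show "L i powr ?h \<le> (K * M) powr ?h * (c i - a i) powr ?h"
      using KM I(2)[THEN spec, of i] by (simp add: powr_mult)
  qed
  also have "\<dots> = (K * M) powr ?h * (\<Sum>i\<in>I. (c i - a i) powr ?h)" by (simp add: sum_distrib_left)
  also have "\<dots> < (K * M) powr ?h * (1 / (K * M)) powr ?h" using KM by (intro mult_strict_left_mono[OF sum]) (metis powr_gt_zero less_irrefl)
  also have "\<dots> = 1"
  proof -
    have "x powr ?h * (1 / x) powr ?h = 1" if "0 < x" for x :: real
      using that by (simp add: powr_divide)
    then show ?thesis using KM by blast
  qed
  finally obtain s where s: "0 < s" "s < ?h" "(\<Sum>i\<in>I. L i powr s) < 1"
    using exists_less_sum_powr_less_1[OF h, of I L] L by blast
  have "J n \<subseteq> (\<Union>i\<in>I. \<phi> (w i) ` J n)" using I(3) w(2) by blast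
  moreover have bd: "bounded (\<phi> (w i) ` J n)" for i
    using \<phi>_J_compact[OF w0] compact_imp_bounded by blast
  ultimately have "rcontent s (J n) \<le> rcontent s (\<Union>i\<in>I. \<phi> (w i) ` J n)"
    using I s by (intro rcontent_mono bounded_UN) auto
  also have "\<dots> \<le> (\<Sum>i\<in>I. rcontent s (\<phi> (w i) ` J n))"
    using I s bd by (intro rcontent_UN_le) auto
  also have "\<dots> \<le> (\<Sum>i\<in>I. L i powr s * rcontent s (J n))"
  proof (rule sum_mono, rule rcontent_image_le)
    fix i x y assume "x \<in> J n" "y \<in> J n"
    then show "\<bar>\<phi> (w i) x - \<phi> (w i) y\<bar> \<le> L i * \<bar>x - y\<bar>"
      unfolding L_def using J_unit by (intro \<phi>_upper[OF w0]) blast+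
  qed (use s L[THEN less_imp_le] J_bounded in auto)
  also have "\<dots> = (\<Sum>i\<in>I. L i powr s) * rcontent s (J n)" by (simp add: sum_distrib_right)
  finally have "(1 - (\<Sum>i\<in>I. L i powr s)) * rcontent s (J n) \<le> 0" by (simp add: algebra_simps)
  then have "rcontent s (J n) \<le> 0" using s(3) by (simp add: mult_le_0_iff)
  then show False
    using content_pos_of_less_dim[OF s(1,2)] rcontent_eq_0_iff[OF s(1) J_bounded] rcontent_nonneg[of s "J n"] by force
qed

text \<open>Induction on the number of covering sets: if all of them are smaller than the gap between the
  pieces \<open>\<phi> w ` J n\<close>, then each piece is covered by strictly fewer of them.\<close>
lemma sum_cover_ge:
  fixes cl :: "nat list \<Rightarrow> real" and r :: "'i \<Rightarrow> real"
  assumes n: "1 \<le> n" and s: "0 < s" and W: "finite W"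
    and cl: "\<And>w. w \<in> W \<Longrightarrow> 0 < cl w" "\<And>w. w \<in> W \<Longrightarrow> cl w \<le> 1"
    and low: "\<And>w x y. w \<in> W \<Longrightarrow> x \<in> J n \<Longrightarrow> y \<in> J n \<Longrightarrow> cl w * \<bar>x - y\<bar> \<le> \<bar>\<phi> w x - \<phi> w y\<bar>"
    and WJ: "\<And>w. w \<in> W \<Longrightarrow> \<phi> w ` J n \<subseteq> J n"
    and \<gamma>: "0 < \<gamma>" "\<And>u v x y. u \<in> W \<Longrightarrow> v \<in> W \<Longrightarrow> u \<noteq> v \<Longrightarrow> x \<in> \<phi> u ` J n \<Longrightarrow> y \<in> \<phi> v ` J n \<Longrightarrow> \<gamma> \<le> \<bar>x - y\<bar>"
    and gt1: "1 < (\<Sum>w\<in>W. cl w powr s)"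
    and I: "finite I" "J n \<subseteq> (\<Union>i\<in>I. U i)"
    and r: "\<And>i. i \<in> I \<Longrightarrow> 0 \<le> r i" "\<And>i x y. i \<in> I \<Longrightarrow> x \<in> U i \<Longrightarrow> y \<in> U i \<Longrightarrow> \<bar>x - y\<bar> \<le> r i"
  shows "\<gamma> powr s \<le> (\<Sum>i\<in>I. r i powr s)"
  using I r
proof (induction I arbitrary: U r rule: finite_psubset_induct)
  case (psubset I)
  show ?case
  proof (cases "\<exists>i\<in>I. \<gamma> \<le> r i")
    case True
    then obtain i where i: "i \<in> I" "\<gamma> \<le> r i" by blast
    then have "\<gamma> powr s \<le> r i powr s" using \<gamma>(1) s by (intro powr_mono2) auto
    also have "\<dots> \<le> (\<Sum>i\<in>I. r i powr s)" using psubset(1) i by (intro member_le_sum) auto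
    finally show ?thesis .
  next
    case small: False
    define IW where "IW w = {i \<in> I. U i \<inter> \<phi> w ` J n \<noteq> {}}" for w
    have sub: "IW w \<subseteq> I" for w by (auto simp: IW_def)
    then have fin: "finite (IW w)" for w using psubset(1) finite_subset by blast
    have disj: "IW u \<inter> IW v = {}" if uv: "u \<in> W" "v \<in> W" "u \<noteq> v" for u v
    proof (rule equals0I)
      fix i assume "i \<in> IW u \<inter> IW v"
      then obtain x y where "i \<in> I" "x \<in> U i" "x \<in> \<phi> u ` J n" "y \<in> U i" "y \<in> \<phi> v ` J n"
        by (auto simp: IW_def)
      then show False using \<gamma>(2)[OF uv, of x y] psubset(5)[of i x y] small by fastforce
    qed
    have ne: "IW w \<noteq> {}" if "w \<in> W" for w
    proof -
      obtain x where "x \<in> J n" using J_nonempty[OF n] by blast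
      then have "\<phi> w x \<in> \<phi> w ` J n" "\<phi> w x \<in> J n" using WJ[OF that] by auto
      moreover obtain i where "i \<in> I" "\<phi> w x \<in> U i" using psubset(3) \<open>\<phi> w x \<in> J n\<close> by blast
      ultimately have "i \<in> IW w" by (auto simp: IW_def)
      then show ?thesis by blast
    qed
    \<comment> \<open>A single word contributes at most 1 to a sum exceeding 1, so a second piece
      exists, and the sets meeting it are lost to the first.\<close>
    have strict: "IW w \<subset> I" if w: "w \<in> W" for w
    proof -
      have "\<exists>v\<in>W. v \<noteq> w"
      proof (rule ccontr)
        assume "\<not> (\<exists>v\<in>W. v \<noteq> w)"
        then have "W = {w}" using w by blast
        then have "1 < cl w powr s" using gt1 by simp
        moreover have "cl w powr s \<le> 1" using cl[OF w] s by (simp add: powr_le1)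
        ultimately show False by simp
      qed
      then obtain v where v: "v \<in> W" "v \<noteq> w" by blast
      then show ?thesis using disj[OF v(1) w v(2)] ne[OF v(1)] sub by blast
    qed
    \<comment> \<open>The sets meeting the piece of \<open>w\<close> are pulled back by its word map
      to a cover of the whole limit set; this enlarges them by at most
      \<open>1 / cl w\<close>.\<close>
    have piece: "\<gamma> powr s * cl w powr s \<le> (\<Sum>i\<in>IW w. r i powr s)" if w: "w \<in> W" for w
    proof -
      have "\<gamma> powr s \<le> (\<Sum>i\<in>IW w. (r i / cl w) powr s)"
      proof (rule psubset(2)[OF strict[OF w], of "\<lambda>i. {x \<in> J n. \<phi> w x \<in> U i}"])
        show "J n \<subseteq> (\<Union>i\<in>IW w. {x \<in> J n. \<phi> w x \<in> U i})"
        proof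
          fix x assume x: "x \<in> J n"
          then have "\<phi> w x \<in> J n" using WJ[OF w] by auto
          then obtain i where "i \<in> I" "\<phi> w x \<in> U i" using psubset(3) by blast
          then show "x \<in> (\<Union>i\<in>IW w. {x \<in> J n. \<phi> w x \<in> U i})" using x by (auto simp: IW_def)
        qed
      next
        fix i assume "i \<in> IW w"
        then have i: "i \<in> I" using sub by blast
        show "0 \<le> r i / cl w" using psubset(4)[OF i] cl[OF w] by simp
        fix x y assume "x \<in> {x \<in> J n. \<phi> w x \<in> U i}" "y \<in> {x \<in> J n. \<phi> w x \<in> U i}"
        then have "cl w * \<bar>x - y\<bar> \<le> r i" using low[OF w, of x y] psubset(5)[OF i] by fastforce
        then show "\<bar>x - y\<bar> \<le> r i / cl w" using cl[OF w] by (simp add: field_simps)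
      qed
      also have "\<dots> = (\<Sum>i\<in>IW w. r i powr s) / cl w powr s"
        unfolding sum_divide_distrib
        using psubset(4) sub cl[OF w] by (intro sum.cong powr_divide) auto
      finally show ?thesis using cl[OF w] by (simp add: field_simps)
    qed
    have "\<gamma> powr s \<le> \<gamma> powr s * (\<Sum>w\<in>W. cl w powr s)" using gt1 \<gamma>(1) by simp
    also have "\<dots> \<le> (\<Sum>w\<in>W. \<Sum>i\<in>IW w. r i powr s)"
      unfolding sum_distrib_left by (intro sum_mono piece)
    also have "\<dots> = (\<Sum>i\<in>(\<Union>w\<in>W. IW w). r i powr s)"
      by (rule sum.UNION_disjoint[symmetric]) (use W fin disj in auto)
    also have "\<dots> \<le> (\<Sum>i\<in>I. r i powr s)"
      using psubset(1) sub by (intro sum_mono2) auto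
    finally show ?thesis .
  qed
qed

text \<open>If the sum exceeded 1, it would still do so at some \<open>s\<close> above the
  dimension. By \<open>sum_cover_ge\<close> every finite interval cover would then have sum at least
  \<open>\<gamma> powr s\<close>, while the content at exponent \<open>s\<close> is 0.\<close>

lemma sum_lower_powr_le_1:
  fixes cl :: "nat list \<Rightarrow> real"
  assumes n: "1 \<le> n" and h: "0 < hdim n" and W: "finite W" "antichain W" "\<And>w. w \<in> W \<Longrightarrow> set w \<subseteq> {1..n}"
    and cl: "\<And>w. w \<in> W \<Longrightarrow> 0 < cl w" "\<And>w. w \<in> W \<Longrightarrow> cl w \<le> 1"
    and low: "\<And>w x y. w \<in> W \<Longrightarrow> x \<in> J n \<Longrightarrow> y \<in> J n \<Longrightarrow> cl w * \<bar>x - y\<bar> \<le> \<bar>\<phi> w x - \<phi> w y\<bar>"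
  shows "(\<Sum>w\<in>W. cl w powr hdim n) \<le> 1"
proof (rule ccontr)
  assume "\<not> ?thesis"
  then have "1 < (\<Sum>w\<in>W. cl w powr hdim n)" by simp
  then obtain s where s: "hdim n < s" "1 < (\<Sum>w\<in>W. cl w powr s)"
    using exists_greater_sum_powr_greater_1[of W cl] cl by blast
  have s0: "0 < s" using h s by simp
  have W0: "0 \<notin> set w" if "w \<in> W" for w using W(3)[OF that] nonzero_of_subset by blast
  obtain \<gamma> where \<gamma>: "0 < \<gamma>"
    "\<And>u v x y. u \<in> W \<Longrightarrow> v \<in> W \<Longrightarrow> u \<noteq> v \<Longrightarrow> x \<in> \<phi> u ` J n \<Longrightarrow> y \<in> \<phi> v ` J n \<Longrightarrow> \<gamma> \<le> dist x y"
    using finite_disjoint_compact_gap[OF W(1) \<phi>_J_compact[OF W0] \<phi>_J_disjoint[OF W(2) W0]] by blast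
  have "hausdorff_content s (J n) < ennreal (\<gamma> powr s)"
    using content_eq_0_of_dim_less[OF J_unit s(1)] \<gamma>(1) by simp
  then obtain I :: "nat set" and a c where I: "finite I" "\<forall>i. a i < c i" "J n \<subseteq> (\<Union>i\<in>I. {a i<..<c i})"
    and sum: "(\<Sum>i\<in>I. (c i - a i) powr s) < \<gamma> powr s"
    by (rule compact_finite_interval_cover[OF J_compact s0]) (rule that)
  have "\<gamma> powr s \<le> (\<Sum>i\<in>I. (c i - a i) powr s)"
  proof (rule sum_cover_ge[OF n s0 W(1) cl low _ \<gamma>(1) _ s(2) I(1,3)])
    show "\<phi> w ` J n \<subseteq> J n" if "w \<in> W" for w using \<phi>_J W(3)[OF that] by blast
    show "\<gamma> \<le> \<bar>x - y\<bar>" if "u \<in> W" "v \<in> W" "u \<noteq> v" "x \<in> \<phi> u ` J n" "y \<in> \<phi> v ` J n" for u v x y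
      using \<gamma>(2)[OF that] by (simp add: dist_real_def)
    show "0 \<le> c i - a i" for i using I(2)[THEN spec, of i] by simp
    show "\<bar>x - y\<bar> \<le> c i - a i" if "x \<in> {a i<..<c i}" "y \<in> {a i<..<c i}" for i x y using that by auto
  qed
  with sum show False by simp
qed

end

section \<open>The upper bound\<close>

lemma hausdorff_premeasure_le_sum:
  assumes "finite I" "A \<subseteq> (\<Union>i\<in>I. S i)" "\<And>i. i \<in> I \<Longrightarrow> bounded (S i)"
    "\<And>i. i \<in> I \<Longrightarrow> diameter (S i) \<le> \<delta>" "0 \<le> \<delta>"
  shows "hausdorff_premeasure h \<delta> A \<le> (\<Sum>i\<in>I. diam_pow h (S i))"
proof -
  obtain e where e: "bij_betw e {0..<card I} I" using ex_bij_betw_nat_finite[OF assms(1)] by blast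
  define U where "U m = (if m < card I then S (e m) else {})" for m
  have eI: "e m \<in> I" if "m < card I" for m using bij_betwE[OF e] that by auto
  have "A \<subseteq> (\<Union>m. U m)"
  proof
    fix x assume "x \<in> A"
    then obtain i where i: "i \<in> I" "x \<in> S i" using assms(2) by blast
    then obtain m where "m < card I" "i = e m" using bij_betw_imp_surj_on[OF e] by (metis atLeastLessThan_iff imageE)
    then have "x \<in> U m" using i by (simp add: U_def)
    then show "x \<in> (\<Union>m. U m)" by blast
  qed
  then have "U \<in> hausdorff_covers \<delta> A"
    using assms eI by (auto simp: hausdorff_covers_def U_def)
  then have "hausdorff_premeasure h \<delta> A \<le> (\<Sum>m. diam_pow h (U m))"
    unfolding hausdorff_premeasure_def by (rule INF_lower)
  also have "\<dots> = (\<Sum>m\<in>{0..<card I}. diam_pow h (U m))"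
    by (rule suminf_finite) (auto simp: U_def diam_pow_def)
  also have "\<dots> = (\<Sum>m\<in>{0..<card I}. diam_pow h (S (e m)))" by (simp add: U_def)
  also have "\<dots> = (\<Sum>i\<in>I. diam_pow h (S i))" using sum.reindex_bij_betw[OF e] .
  finally show ?thesis .
qed

context interval_system
begin

section \<open>Words sorted by the first occurrence of a letter after a free prefix\<close>

definition avoid :: "nat \<Rightarrow> nat \<Rightarrow> nat \<Rightarrow> nat list set" where
  "avoid n k j = {v. length v = j \<and> set v \<subseteq> {1..n} - {k}}"

text \<open>The prefix \<open>u\<close> of length \<open>N\<close> is unrestricted and only serves
  to make cylinders short. The letter \<open>k\<close> then appears for the first time after fewer
  than \<open>l\<close> further letters; \<open>miss\<close> collects the words still waiting after
  exactly \<open>j\<close> letters.\<close>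

definition hit :: "nat \<Rightarrow> nat \<Rightarrow> nat \<Rightarrow> nat \<Rightarrow> nat list set" where
  "hit n k N l = (\<Union>j\<in>{..<l}. \<Union>v\<in>avoid n k j. (\<lambda>u. u @ v @ [k]) ` words n N)"

definition miss :: "nat \<Rightarrow> nat \<Rightarrow> nat \<Rightarrow> nat \<Rightarrow> nat list set" where
  "miss n k N j = (\<lambda>(u, v). u @ v) ` (words n N \<times> avoid n k j)"

lemma finite_avoid: "finite (avoid n k j)"
  by (rule finite_subset[OF _ finite_words[of n j]]) (auto simp: avoid_def words_def)

lemma finite_hit: "finite (hit n k N l)"
  by (simp add: hit_def finite_avoid finite_words)

lemma finite_miss: "finite (miss n k N j)"
  by (simp add: miss_def finite_avoid finite_words)

lemma hit_iff:
  "w \<in> hit n k N l \<longleftrightarrow> (\<exists>u v j. w = u @ v @ [k] \<and> u \<in> words n N \<and> v \<in> avoid n k j \<and> j < l)"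
  by (auto simp: hit_def)

lemma miss_iff: "w \<in> miss n k N j \<longleftrightarrow> (\<exists>u v. w = u @ v \<and> u \<in> words n N \<and> v \<in> avoid n k j)"
  by (auto simp: miss_def)

lemma avoidD: "v \<in> avoid n k j \<Longrightarrow> length v = j \<and> set v \<subseteq> {1..n} \<and> k \<notin> set v \<and> 0 \<notin> set v"
  unfolding avoid_def using nonzero_of_subset[of v n] by blast

lemma wordsD: "u \<in> words n N \<Longrightarrow> length u = N \<and> set u \<subseteq> {1..n} \<and> 0 \<notin> set u"
  unfolding words_def using nonzero_of_subset[of u n] by blast

lemma hit_letters: "w \<in> hit n k N l \<Longrightarrow> k \<in> {1..n} \<Longrightarrow> set w \<subseteq> {1..n}"
  unfolding hit_iff using avoidD[of _ n k] wordsD[of _ n N] by force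

lemma miss_letters: "w \<in> miss n k N l \<Longrightarrow> set w \<subseteq> {1..n}"
  unfolding miss_iff using avoidD[of _ n k] wordsD[of _ n N] by force

lemma hit_length: "w \<in> hit n k N l \<Longrightarrow> N \<le> length w \<and> length w \<le> N + l"
  unfolding hit_iff using avoidD[of _ n k] wordsD[of _ n N] by force

lemma miss_length: "w \<in> miss n k N l \<Longrightarrow> length w = N + l"
  unfolding miss_iff using avoidD[of _ n k] wordsD[of _ n N] by force

lemma hit_last: "w \<in> hit n k N l \<Longrightarrow> \<exists>v. w = v @ [k]"
  unfolding hit_iff by auto

text \<open>Prefixes of equal length must agree, so a hit word that is a proper prefix of another
  would place \<open>k\<close> inside the part \<open>v'\<close> that avoids it.\<close>

lemma antichain_hit: "antichain (hit n k N l)"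
proof -
  have "\<not> prefix w w'" if ww: "w \<in> hit n k N l" "w' \<in> hit n k N l" "w \<noteq> w'" for w w'
  proof
    assume pre: "prefix w w'"
    obtain u v where w: "w = u @ v @ [k]" "u \<in> words n N" using ww(1) unfolding hit_iff by blast
    obtain u' v' i' where w': "w' = u' @ v' @ [k]" "u' \<in> words n N" "v' \<in> avoid n k i'"
      using ww(2) unfolding hit_iff by blast
    have "length u = length u'" using wordsD[OF w(2)] wordsD[OF w'(2)] by simp
    then have "u = u'" using pre w w' by (auto simp: prefix_def)
    then have "prefix (v @ [k]) (v' @ [k])" "v @ [k] \<noteq> v' @ [k]" using pre w w' ww(3) by auto
    then have "prefix (v @ [k]) v'" by (simp only: prefix_snoc) auto
    then have "k \<in> set v'" by (auto simp: prefix_def)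
    then show False using avoidD[OF w'(3)] by simp
  qed
  then show ?thesis by (auto simp: antichain_def parallel_def)
qed

lemma antichain_words: "antichain (words n l)"
proof -
  have "u = v" if "prefix u v" "length u = length v" for u v :: "nat list"
    using that by (auto simp: prefix_def)
  then show ?thesis by (auto simp: antichain_def parallel_def words_def)
qed

lemma J_subset_hit_miss:
  assumes "k \<in> {1..n}"
  shows "J n \<subseteq> (\<Union>w\<in>hit n k N j \<union> miss n k N j. \<phi> w ` J n)"
proof (induction j)
  case 0
  have "miss n k N 0 = words n N" by (auto simp: miss_iff avoid_def)
  then show ?case using J_eq_UN_words[of n N] by (auto simp: hit_def)
next
  case (Suc j)
  show ?case
  proof
    fix x assume "x \<in> J n"
    then obtain w where w: "w \<in> hit n k N j \<union> miss n k N j" "x \<in> \<phi> w ` J n" using Suc by blast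
    show "x \<in> (\<Union>w\<in>hit n k N (Suc j) \<union> miss n k N (Suc j). \<phi> w ` J n)"
    proof (cases "w \<in> hit n k N j")
      case True
      then have "w \<in> hit n k N (Suc j)" unfolding hit_iff using less_SucI by blast
      then show ?thesis using w by blast
    next
      case False
      then have m: "w \<in> miss n k N j" using w by blast
      then obtain i where i: "i \<in> {1..n}" "x \<in> \<phi> (w @ [i]) ` J n"
        using \<phi>_J_eq_UN[OF miss_letters[OF m]] w by blast
      obtain u v where uv: "w = u @ v" "u \<in> words n N" "v \<in> avoid n k j" using m by (auto simp: miss_def)
      have "w @ [i] \<in> hit n k N (Suc j) \<union> miss n k N (Suc j)"
      proof (cases "i = k")
        case True
        then have "w @ [i] \<in> hit n k N (Suc j)"
          unfolding hit_iff uv(1) using uv(2,3) by (intro exI[of _ u] exI[of _ v] exI[of _ j]) auto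
        then show ?thesis by blast
      next
        case False
        then have "v @ [i] \<in> avoid n k (Suc j)" using uv(3) i(1) by (auto simp: avoid_def)
        then have "w @ [i] \<in> miss n k N (Suc j)"
          unfolding miss_def uv(1) using uv(2) by (intro image_eqI[of _ _ "(u, v @ [i])"]) auto
        then show ?thesis by blast
      qed
      then show ?thesis using i by blast
    qed
  qed
qed

text \<open>There are \<open>Q\<close> possible lengths, each with at most
  \<open>n ^ (Q - 1)\<close> words; \<open>Q \<le> n\<close> absorbs the number of lengths into one
  more factor \<open>n\<close>.\<close>

lemma card_short_words_le:
  assumes "\<And>w. w \<in> W \<Longrightarrow> set w \<subseteq> {1..n} \<and> length w < Q" "Q \<le> n"
  shows "card W \<le> n ^ Q"
proof (cases Q)
  case 0
  then have "W = {}" using assms by auto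
  then show ?thesis by simp
next
  case (Suc q)
  have "W \<subseteq> {w. set w \<subseteq> {1..n} \<and> length w \<le> q}" using assms(1) Suc by (auto simp: less_Suc_eq_le)
  then have "card W \<le> card {w. set w \<subseteq> {1..n} \<and> length w \<le> q}"
    by (intro card_mono finite_lists_length_le) auto
  also have "\<dots> = (\<Sum>i\<le>q. n ^ i)" by (simp add: card_lists_length_le)
  also have "\<dots> \<le> (\<Sum>i\<le>q. n ^ q)" using assms Suc by (intro sum_mono power_increasing) auto
  also have "\<dots> = Suc q * n ^ q" by simp
  also have "\<dots> \<le> n * n ^ q" using assms(2) Suc by (intro mult_right_mono) auto
  finally show ?thesis using Suc by simp
qed

lemma sum_hit_0:
  "(\<Sum>w\<in>hit n k 0 l. f w) = (\<Sum>j<l. \<Sum>v\<in>avoid n k j. f (v @ [k]))" for f :: "nat list \<Rightarrow> real"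
proof -
  have "words n 0 = {[]}" by (auto simp: words_def)
  then have "hit n k 0 l = (\<Union>j\<in>{..<l}. (\<lambda>v. v @ [k]) ` avoid n k j)" by (auto simp: hit_def)
  then have "(\<Sum>w\<in>hit n k 0 l. f w) = (\<Sum>j<l. \<Sum>w\<in>(\<lambda>v. v @ [k]) ` avoid n k j. f w)"
    by (simp only:) (rule sum.UNION_disjoint, use finite_avoid in \<open>auto simp: avoid_def\<close>)
  also have "\<dots> = (\<Sum>j<l. \<Sum>v\<in>avoid n k j. f (v @ [k]))"
    by (simp add: sum.reindex inj_on_def)
  finally show ?thesis .
qed

text \<open>The pieces hit at time \<open>j\<close> carry a fixed proportion of those not yet hit; as all hit pieces together
  carry at most \<open>B\<close>, the pieces not yet hit must be small at some time below \<open>l\<close>.\<close>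
lemma exists_small_avoid:
  assumes k: "1 \<le> k" and h: "0 < h" and l: "0 < l" and B: "(\<Sum>w\<in>hit n k 0 l. \<Delta> w powr h) \<le> B"
  obtains j where "j < l" "(\<Sum>v\<in>avoid n k j. \<Delta> v powr h) \<le> (K / \<Delta> [k]) powr h * B / l"
proof (rule ccontr)
  let ?e = "(\<Delta> [k] / K) powr h" and ?e' = "(K / \<Delta> [k]) powr h"
  have pos: "0 < \<Delta> [k]" "0 < K" using k K_gt_1 by (auto simp: \<Delta>_pos)
  have ee: "?e * ?e' = 1" using pos by (simp add: powr_divide)
  assume "\<not> thesis"
  then have gt: "?e' * B / l < (\<Sum>v\<in>avoid n k j. \<Delta> v powr h)" if "j < l" for j
    using that \<open>\<And>j. j < l \<Longrightarrow> _ \<Longrightarrow> thesis\<close> by (meson not_le)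
  \<comment> \<open>Averaging over the \<open>l\<close> waiting times: appending \<open>k\<close>
    keeps at least the proportion \<open>?e\<close> of each waiting sum, so if all \<open>l\<close>
    sums exceeded the threshold, the hits would carry more than \<open>B\<close>.\<close>
  have "B = (\<Sum>j<l. ?e * (?e' * B / l))" using l ee by (simp add: mult.assoc[symmetric])
  also have "\<dots> < (\<Sum>j<l. ?e * (\<Sum>v\<in>avoid n k j. \<Delta> v powr h))"
    using gt l pos by (intro sum_strict_mono mult_strict_left_mono) auto
  also have "\<dots> \<le> (\<Sum>j<l. \<Sum>v\<in>avoid n k j. \<Delta> (v @ [k]) powr h)"
    unfolding sum_distrib_left
  proof (intro sum_mono)
    fix j v assume "v \<in> avoid n k j"
    then have v: "0 \<notin> set v" using avoidD by blast
    have "\<Delta> [k] / K * \<Delta> v \<le> \<Delta> (v @ [k])"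
      using \<Delta>_append_ge[OF v, of "[k]"] k pos by (simp add: field_simps)
    then have "(\<Delta> [k] / K * \<Delta> v) powr h \<le> \<Delta> (v @ [k]) powr h"
      using pos h by (intro powr_mono2) auto
    then show "?e * \<Delta> v powr h \<le> \<Delta> (v @ [k]) powr h"
      using pos powr_mult[of "\<Delta> [k] / K" "\<Delta> v" h] by simp
  qed
  also have "\<dots> \<le> B" using B by (simp add: sum_hit_0)
  finally show False by simp
qed

lemma sum_miss_le:
  assumes h: "0 < h"
  shows "(\<Sum>w\<in>miss n k N j. \<Delta> w powr h) \<le>
    K powr h * (\<Sum>u\<in>words n N. \<Delta> u powr h) * (\<Sum>v\<in>avoid n k j. \<Delta> v powr h)"
proof -
  have "(\<Sum>w\<in>miss n k N j. \<Delta> w powr h) \<le> (\<Sum>p\<in>words n N \<times> avoid n k j. \<Delta> ((\<lambda>(u, v). u @ v) p) powr h)"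
    unfolding miss_def
    using sum_image_le[of "words n N \<times> avoid n k j" "\<lambda>w. \<Delta> w powr h" "\<lambda>(u, v). u @ v"]
    by (simp add: finite_words finite_avoid comp_def)
  also have "\<dots> = (\<Sum>u\<in>words n N. \<Sum>v\<in>avoid n k j. \<Delta> (u @ v) powr h)"
    by (simp add: sum.cartesian_product case_prod_unfold)
  also have "\<dots> \<le> (\<Sum>u\<in>words n N. \<Sum>v\<in>avoid n k j. K powr h * \<Delta> u powr h * \<Delta> v powr h)"
  proof (intro sum_mono)
    fix u v assume "u \<in> words n N" "v \<in> avoid n k j"
    then have "0 \<notin> set u" "0 \<notin> set v" using avoidD wordsD by blast+
    then have "\<Delta> (u @ v) powr h \<le> (K * \<Delta> u * \<Delta> v) powr h"
      using h by (intro powr_mono2 \<Delta>_append_le) auto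
    then show "\<Delta> (u @ v) powr h \<le> K powr h * \<Delta> u powr h * \<Delta> v powr h"
      using K_gt_1 by (simp add: powr_mult)
  qed
  also have "\<dots> = K powr h * (\<Sum>u\<in>words n N. \<Delta> u powr h) * (\<Sum>v\<in>avoid n k j. \<Delta> v powr h)"
    by (simp only: sum_distrib_left[symmetric] sum_distrib_right[symmetric])
  finally show ?thesis .
qed

text \<open>The lower Lipschitz constants are \<open>\<Delta> w / \<theta>\<close>, and
  \<open>\<theta> powr h \<le> \<theta>\<close> since the dimension is at most 1. It serves with
  \<theta> near 1 for hit words and with \<theta> equal to \<open>K\<close> for all words of one
  length.\<close>

lemma sum_\<Delta>_powr_dim_le:
  assumes n: "1 \<le> n" and h: "0 < hdim n" and W: "finite W" "antichain W" "\<And>w. w \<in> W \<Longrightarrow> set w \<subseteq> {1..n}"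
    and \<theta>: "1 \<le> \<theta>"
    and low: "\<And>w x y. w \<in> W \<Longrightarrow> x \<in> {0..1} \<Longrightarrow> y \<in> {0..1} \<Longrightarrow> \<Delta> w * \<bar>x - y\<bar> \<le> \<theta> * \<bar>\<phi> w x - \<phi> w y\<bar>"
  shows "(\<Sum>w\<in>W. \<Delta> w powr hdim n) \<le> \<theta>"
proof -
  let ?h = "hdim n"
  have W0: "0 \<notin> set w" if "w \<in> W" for w using W(3)[OF that] nonzero_of_subset by blast
  have "(\<Sum>w\<in>W. (\<Delta> w / \<theta>) powr ?h) \<le> 1"
  proof (rule sum_lower_powr_le_1[OF n h W])
    fix w assume w: "w \<in> W"
    show "0 < \<Delta> w / \<theta>" using \<Delta>_pos[OF W0[OF w]] \<theta> by simp
    have "\<Delta> w \<le> 1" using \<Delta>_le[OF W0[OF w]] \<alpha> power_le_one[of \<alpha> "length w"] by simp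
    then show "\<Delta> w / \<theta> \<le> 1" using \<theta> by simp
    fix x y assume "x \<in> J n" "y \<in> J n"
    then have "x \<in> {0..1}" "y \<in> {0..1}" using J_unit by blast+
    then show "\<Delta> w / \<theta> * \<bar>x - y\<bar> \<le> \<bar>\<phi> w x - \<phi> w y\<bar>"
      using low[OF w, of x y] \<theta> by (simp add: field_simps)
  qed
  then have "(\<Sum>w\<in>W. \<Delta> w powr ?h) / \<theta> powr ?h \<le> 1"
    using \<theta> by (simp add: powr_divide sum_divide_distrib)
  then have "(\<Sum>w\<in>W. \<Delta> w powr ?h) \<le> \<theta> powr ?h" using \<theta> by (simp add: field_simps)
  also have "\<dots> \<le> \<theta> powr 1" using \<theta> hausdorff_dim_le_1[OF J_unit[of n]] by (intro powr_mono) auto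
  finally show ?thesis using \<theta> by simp
qed

lemma diam_pow_\<phi>_unit:
  assumes "0 \<notin> set w" "0 < h"
  shows "bounded (\<phi> w ` {0..1})" "diameter (\<phi> w ` {0..1}) = \<Delta> w"
    "diam_pow h (\<phi> w ` {0..1}) = ennreal (\<Delta> w powr h)"
proof -
  have im: "\<phi> w ` {0..1} = {min (\<phi> w 0) (\<phi> w 1)..max (\<phi> w 0) (\<phi> w 1)}"
    using \<phi>_image[of w 0 1] assms by simp
  show "bounded (\<phi> w ` {0..1})" unfolding im by (rule bounded_closed_interval)
  show d: "diameter (\<phi> w ` {0..1}) = \<Delta> w" unfolding im by (simp add: diameter_closed_interval \<Delta>_def)
  show "diam_pow h (\<phi> w ` {0..1}) = ennreal (\<Delta> w powr h)"
    using assms unfolding diam_pow_def d by simp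
qed

lemma measure_J_le:
  assumes h: "0 < hdim n" and k: "good \<theta> k" "k \<le> n" and \<theta>: "1 < \<theta>"
  shows "hausdorff_measure (hdim n) (J n) \<le> ennreal \<theta>"
proof -
  let ?h = "hdim n"
  have k1: "1 \<le> k" using k by (simp add: good_def)
  then have n: "1 \<le> n" and kn: "k \<in> {1..n}" using k by auto
  have nz: "0 \<notin> set w" if "set w \<subseteq> {1..n}" for w using that nonzero_of_subset by blast
  have hits: "(\<Sum>w\<in>hit n k N l. \<Delta> w powr ?h) \<le> \<theta>" for N l
  proof (rule sum_\<Delta>_powr_dim_le[OF n h finite_hit antichain_hit hit_letters[OF _ kn]])
    fix w x y assume w: "w \<in> hit n k N l" and xy: "x \<in> {0..1::real}" "y \<in> {0..1::real}"
    obtain v where v: "w = v @ [k]" using hit_last[OF w] by blast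
    then have "0 \<notin> set v" using nz[OF hit_letters[OF w kn]] by auto
    then show "\<Delta> w * \<bar>x - y\<bar> \<le> \<theta> * \<bar>\<phi> w x - \<phi> w y\<bar>" using k(1) xy unfolding v good_def by blast
  qed (use \<theta> in auto)
  have all: "(\<Sum>w\<in>words n N. \<Delta> w powr ?h) \<le> K" for N
    using K_gt_1 nz
    by (intro sum_\<Delta>_powr_dim_le[OF n h finite_words antichain_words] \<phi>_lower) (auto simp: words_def)
  \<comment> \<open>\<open>K powr ?h\<close> pays for cutting a missed word into prefix and tail,
    the second \<open>K\<close> bounds the sum over all prefixes, and the rest comes from
    \<open>exists_small_avoid\<close>. As \<open>Z\<close> involves neither \<open>N\<close> nor
    \<open>l\<close>, the missed words become negligible for large \<open>l\<close> at every
    \<delta>.\<close>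
  define Z where "Z = K powr ?h * K * ((K / \<Delta> [k]) powr ?h * \<theta>)"
  have Z0: "0 \<le> Z" using K_gt_1 \<theta> by (simp add: Z_def)
  have bound: "hausdorff_premeasure ?h \<delta> (J n) \<le> ennreal (\<theta> + Z / l)" if \<delta>: "0 < \<delta>" and l: "0 < l" for \<delta> and l :: nat
  proof -
    obtain N where "\<alpha> ^ N < \<delta>" using real_arch_pow_inv[OF \<delta>, of \<alpha>] \<alpha> by auto
    obtain j where j: "j < l" "(\<Sum>v\<in>avoid n k j. \<Delta> v powr ?h) \<le> (K / \<Delta> [k]) powr ?h * \<theta> / l"
      using exists_small_avoid[OF k1 h l hits] by blast
    let ?W = "hit n k N j \<union> miss n k N j"
    have W: "set w \<subseteq> {1..n} \<and> N \<le> length w" if "w \<in> ?W" for w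
      using that hit_letters[OF _ kn] hit_length miss_letters miss_length by (metis Un_iff le_add1)
    have "(\<Sum>w\<in>miss n k N j. \<Delta> w powr ?h) \<le> K powr ?h * K * ((K / \<Delta> [k]) powr ?h * \<theta> / l)"
      by (rule order_trans[OF sum_miss_le[OF h]], intro mult_mono mult_nonneg_nonneg sum_nonneg)
        (use all j K_gt_1 in auto)
    then have "(\<Sum>w\<in>miss n k N j. \<Delta> w powr ?h) \<le> Z / l" by (simp add: Z_def)
    have "hausdorff_premeasure ?h \<delta> (J n) \<le> (\<Sum>w\<in>?W. diam_pow ?h (\<phi> w ` {0..1}))"
    proof (rule hausdorff_premeasure_le_sum)
      show "J n \<subseteq> (\<Union>w\<in>?W. \<phi> w ` {0..1})" using J_subset_hit_miss[OF kn, of N j] J_unit[of n] by blast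
      fix w assume w: "w \<in> ?W"
      then have w0: "0 \<notin> set w" using W nz by blast
      show "bounded (\<phi> w ` {0..1})" using diam_pow_\<phi>_unit[OF w0 h] by simp
      have "\<Delta> w \<le> \<alpha> ^ length w" by (rule \<Delta>_le[OF w0])
      also have "\<dots> \<le> \<alpha> ^ N" using W[OF w] \<alpha> by (intro power_decreasing) auto
      finally show "diameter (\<phi> w ` {0..1}) \<le> \<delta>" using \<open>\<alpha> ^ N < \<delta>\<close> diam_pow_\<phi>_unit[OF w0 h] by simp
    qed (use \<delta> finite_hit finite_miss in auto)
    also have "\<dots> = (\<Sum>w\<in>?W. ennreal (\<Delta> w powr ?h))"
      using W nz diam_pow_\<phi>_unit(3)[OF _ h] by (intro sum.cong) auto
    also have "\<dots> = ennreal (\<Sum>w\<in>?W. \<Delta> w powr ?h)" by simp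
    also have "(\<Sum>w\<in>?W. \<Delta> w powr ?h) \<le> (\<Sum>w\<in>hit n k N j. \<Delta> w powr ?h) + (\<Sum>w\<in>miss n k N j. \<Delta> w powr ?h)"
      by (subst sum.union_inter[symmetric]) (auto simp: finite_hit finite_miss intro: sum_nonneg)
    also have "\<dots> \<le> \<theta> + Z / l" using hits[of N j] \<open>_ \<le> Z / l\<close> by simp
    finally show ?thesis by (simp add: ennreal_leI)
  qed
  have "hausdorff_premeasure ?h \<delta> (J n) \<le> ennreal \<theta>" if \<delta>: "0 < \<delta>" for \<delta>
  proof (rule ennreal_le_epsilon)
    fix e :: real assume e: "0 < e"
    obtain l :: nat where l: "Z / e < l" using reals_Archimedean2 by blast
    then have l0: "0 < l" using Z0 e by (cases l) (auto simp: field_simps)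
    have "Z / l \<le> e" using l l0 e by (simp add: field_simps)
    then have "ennreal (\<theta> + Z / l) \<le> ennreal (\<theta> + e)" by (intro ennreal_leI) simp
    also have "\<dots> = ennreal \<theta> + ennreal e" using \<theta> e by simp
    finally show "hausdorff_premeasure ?h \<delta> (J n) \<le> ennreal \<theta> + ennreal e"
      using bound[OF \<delta> l0] by (rule order_trans[rotated])
  qed
  then show ?thesis unfolding hausdorff_measure_eq_SUP by (intro SUP_least) auto
qed

end

section \<open>The lower bound\<close>

context interval_system
begin

lemma rcontent_\<phi>_J_le:
  assumes h: "0 < h" and w: "0 \<notin> set w" and L: "0 \<le> L"
    and lip: "\<And>x y. x \<in> {0..1} \<Longrightarrow> y \<in> {0..1} \<Longrightarrow> \<bar>\<phi> w x - \<phi> w y\<bar> \<le> L * \<bar>x - y\<bar>"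
  shows "rcontent h (\<phi> w ` J n) \<le> L powr h * rcontent h (J n)"
proof (rule rcontent_image_le[OF h L J_bounded])
  fix x y assume "x \<in> J n" "y \<in> J n"
  then show "\<bar>\<phi> w x - \<phi> w y\<bar> \<le> L * \<bar>x - y\<bar>" using J_unit by (intro lip) blast+
qed

lemma \<phi>_J_bounded: "0 \<notin> set w \<Longrightarrow> bounded (\<phi> w ` J n)"
  by (rule compact_imp_bounded[OF \<phi>_J_compact])

text \<open>Passing from exponent \<open>h\<close> to exponent \<open>1\<close> costs only the factor \<open>card W powr (1 - h)\<close>.\<close>
lemma sum_rcontent_le:
  assumes h: "0 < h" "h \<le> 1" and W: "finite W" "\<And>w. w \<in> W \<Longrightarrow> 0 \<notin> set w" and v: "0 \<notin> set v"
    and L: "0 \<le> L" and lip: "\<And>w x y. w \<in> W \<Longrightarrow> x \<in> {0..1} \<Longrightarrow> y \<in> {0..1} \<Longrightarrow>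
       \<bar>\<phi> (v @ w) x - \<phi> (v @ w) y\<bar> \<le> L * \<Delta> (v @ w) * \<bar>x - y\<bar>"
    and card: "real (card W) powr (1 - h) \<le> T" and sum: "(\<Sum>w\<in>W. \<Delta> (v @ w)) \<le> S"
  shows "(\<Sum>w\<in>W. rcontent h (\<phi> (v @ w) ` J n)) \<le> T * (L * S) powr h * rcontent h (J n)"
proof -
  have T: "0 \<le> T" using card by (rule order_trans[rotated]) simp
  have "(\<Sum>w\<in>W. rcontent h (\<phi> (v @ w) ` J n)) \<le> (\<Sum>w\<in>W. (L * \<Delta> (v @ w)) powr h * rcontent h (J n))"
    using W(2) v L by (intro sum_mono rcontent_\<phi>_J_le[OF h(1)] lip) auto
  also have "\<dots> = (\<Sum>w\<in>W. (L * \<Delta> (v @ w)) powr h) * rcontent h (J n)"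
    by (simp add: sum_distrib_right)
  also have "\<dots> \<le> (T * (L * S) powr h) * rcontent h (J n)"
  proof (rule mult_right_mono[OF _ rcontent_nonneg])
    have "(\<Sum>w\<in>W. (L * \<Delta> (v @ w)) powr h) \<le> real (card W) powr (1 - h) * (\<Sum>w\<in>W. L * \<Delta> (v @ w)) powr h"
      using L by (intro sum_powr_le_card_powr[OF W(1) h]) auto
    also have "\<dots> \<le> T * (L * S) powr h"
      using L h T sum by (intro mult_mono card powr_mono2) (auto simp: sum_distrib_left[symmetric] intro!: mult_left_mono mult_nonneg_nonneg sum_nonneg)
    finally show "(\<Sum>w\<in>W. (L * \<Delta> (v @ w)) powr h) \<le> T * (L * S) powr h" .
  qed
  finally show ?thesis .
qed

text \<open>Errors inside the unit interval are measured against the image of an interval of length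
  at least \<open>r\<close>, so that they stay relative to that image for every word
  \<open>v\<close>.\<close>

lemma \<phi>_ratio_subinterval:
  assumes v: "0 \<notin> set v" and xy: "0 \<le> x" "y \<le> 1" "0 < r" "r \<le> y - x"
    and st: "s \<in> {0..1}" "t \<in> {0..1}"
  shows "\<bar>\<phi> v s - \<phi> v t\<bar> \<le> K / r * \<bar>s - t\<bar> * \<bar>\<phi> v x - \<phi> v y\<bar>"
proof -
  have "\<bar>\<phi> v s - \<phi> v t\<bar> * r \<le> \<bar>\<phi> v s - \<phi> v t\<bar> * \<bar>x - y\<bar>" using xy by (intro mult_left_mono) auto
  also have "\<dots> \<le> K * (\<bar>\<phi> v x - \<phi> v y\<bar> * \<bar>s - t\<bar>)"
    using \<phi>_ratio[of v 0 1 s t x y] v xy st by (simp add: K_def)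
  finally show ?thesis using xy by (simp add: field_simps)
qed

end

locale interval_system_dim = interval_system +
  assumes dim_lim: "(\<lambda>n. (1 - hausdorff_dim (limit_set g n)) * ln (real n)) \<longlonglongrightarrow> 0"
begin

lemma hdim_le_1: "hdim n \<le> 1"
  by (rule hausdorff_dim_le_1[OF J_unit])

text \<open>Condition (i) enters here: \<open>(n ^ Q) powr (1 - h)\<close> equals
  \<open>exp (Q * ((1 - h) * ln n))\<close>, which tends to 1 because \<open>Q\<close> is
  fixed.\<close>

lemma eventually_card_powr_le:
  assumes "1 < \<theta>"
  shows "\<forall>\<^sub>F n in sequentially. \<forall>m. real m \<le> real n ^ Q \<longrightarrow> real m powr (1 - hdim n) \<le> \<theta>"
proof -
  have "(\<lambda>n. exp (real Q * ((1 - hdim n) * ln (real n)))) \<longlonglongrightarrow> exp (real Q * 0)"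
    by (intro tendsto_intros dim_lim)
  then have "\<forall>\<^sub>F n in sequentially. exp (real Q * ((1 - hdim n) * ln (real n))) < \<theta>"
    using assms by (intro order_tendstoD(2)) auto
  then show ?thesis using eventually_gt_at_top[of 0]
  proof eventually_elim
    case (elim n)
    show ?case
    proof (intro allI impI)
      fix m assume "real m \<le> real n ^ Q"
      then have "real m powr (1 - hdim n) \<le> (real n ^ Q) powr (1 - hdim n)"
        using hdim_le_1[of n] by (intro powr_mono2) auto
      also have "real n ^ Q = exp (real Q * ln (real n))"
        using elim by (simp add: exp_of_nat_mult)
      also have "exp (real Q * ln (real n)) powr (1 - hdim n) = exp (real Q * ((1 - hdim n) * ln (real n)))"
        by (simp add: powr_def mult_ac)
      finally show "real m powr (1 - hdim n) \<le> \<theta>" using elim by simp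
    qed
  qed
qed

text \<open>Small quantities have small \<open>h\<close>-th powers uniformly in \<open>n\<close>
  only if \<open>h\<close> stays away from 0.\<close>

lemma eventually_hdim_ge: "\<forall>\<^sub>F n in sequentially. 1 / 2 \<le> hdim n"
proof -
  have "\<forall>\<^sub>F n in sequentially. (1 - hdim n) * ln (real n) < 1 / 2 * ln 2"
    using dim_lim by (rule order_tendstoD(2)) simp
  then show ?thesis using eventually_ge_at_top[of 2]
  proof eventually_elim
    case (elim n)
    have "(1 - hdim n) * ln 2 \<le> (1 - hdim n) * ln (real n)"
      using elim hdim_le_1[of n] by (intro mult_left_mono) auto
    then have "(1 - hdim n) * ln 2 < 1 / 2 * ln 2" using elim(1) by (rule le_less_trans)
    then have "1 - hdim n < 1 / 2" by (rule mult_right_less_imp_less) simp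
    then show ?case by simp
  qed
qed

text \<open>All images under word maps are included. Deducing them from the empty word by bounded
  distortion would bring back the constant \<open>K\<close>; demanded for all \<open>v\<close> at
  once, the estimate passes to smaller cylinders without loss.\<close>

definition bound_on :: "real \<Rightarrow> nat \<Rightarrow> real \<Rightarrow> real \<Rightarrow> bool" where
  "bound_on B n p q \<longleftrightarrow> (\<forall>v. set v \<subseteq> {1..n} \<longrightarrow>
     rcontent (hdim n) (\<phi> v ` (J n \<inter> {p..q})) \<le> B * \<bar>\<phi> v p - \<phi> v q\<bar> powr hdim n * rcontent (hdim n) (J n))"

text \<open>Hit cylinders meeting the interval cost three factors \<theta>: one for their number,
  one for distortion, one for sticking out at the ends. Missed cylinders cost at most
  \<open>\<theta> - 1\<close>, and
  \<open>\<theta> ^ 3 + \<theta> - 1 \<le> \<theta> ^ 4\<close>.\<close>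

lemma eventually_bound_long:
  assumes \<theta>: "1 < \<theta>" and r: "0 < r"
  shows "\<forall>\<^sub>F n in sequentially. \<forall>x y. 0 \<le> x \<longrightarrow> y \<le> 1 \<longrightarrow> r \<le> y - x \<longrightarrow> bound_on (\<theta> ^ 4) n x y"
proof -
  obtain k where k: "good \<theta> k"
    using eventually_happens'[OF _ eventually_good[OF \<theta>]] by auto
  have k1: "1 \<le> k" using k by (simp add: good_def)
  have K0: "0 < K" using K_gt_1 by simp
  have D: "0 < \<Delta> [k]" using k1 by (simp add: \<Delta>_pos)
  \<comment> \<open>Enlarging the interval by \<tau> at one end adds at most the fraction
    \<open>(\<theta> - 1) / 2\<close> of its image, so both ends together cost the factor
    \<theta>.\<close>
  define \<tau> where "\<tau> = r * (\<theta> - 1) / (2 * K)"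
  have \<tau>: "0 < \<tau>" "K / r * \<tau> = (\<theta> - 1) / 2" using \<theta> r K0 by (auto simp: \<tau>_def)
  obtain N where N: "\<alpha> ^ N < \<tau>" using real_arch_pow_inv[OF \<tau>(1), of \<alpha>] \<alpha> by auto
  \<comment> \<open>The square compensates the exponent: for \<open>h\<close> at least 1/2 it gives
    \<open>x0 powr h \<le> (\<theta> - 1) / \<theta>\<close>.\<close>
  define x0 where "x0 = ((\<theta> - 1) / \<theta>)\<^sup>2"
  have x0: "0 < x0" using \<theta> by (simp add: x0_def)
  \<comment> \<open>\<open>Y / L\<close> bounds the share of the missed words: the outer
    \<open>K\<close> is their distortion, \<open>K * (K / r)\<close> compares their images under
    \<open>v\<close> with the image of the interval, and \<open>K * (K / \<Delta> [k])\<close> comes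
    from the total length of the missed cylinders.\<close>
  define Y where "Y = K * (K * (K / r)) * (K * (K / \<Delta> [k]))"
  have Y: "0 < Y" using K0 r D by (simp add: Y_def)
  obtain L :: nat where L: "Y / x0 < L" using reals_Archimedean2 by blast
  then have L0: "0 < L" using Y x0 by (cases L) (auto simp: field_simps)
  have YL: "Y / L \<le> x0" using L L0 x0 by (simp add: field_simps)
  define Q where "Q = N + L + 2"
  show ?thesis
    using eventually_card_powr_le[OF \<theta>, of Q] eventually_hdim_ge eventually_ge_at_top[of "max Q k"]
  proof eventually_elim
    case (elim n)
    let ?h = "hdim n"
    define R where "R = rcontent ?h (J n)"
    have R: "0 \<le> R" by (simp add: R_def rcontent_nonneg)
    have h: "0 < ?h" "?h \<le> 1" "1 / 2 \<le> ?h" using elim(2) hdim_le_1 by auto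
    have kn: "k \<in> {1..n}" using elim k1 by auto
    \<comment> \<open>At exponent 1 the hit cylinders have total length at most 1 by disjointness.
      The choice of \<open>j\<close> may depend on \<open>n\<close>, but the bound on
      \<open>j\<close> and on the waiting sum does not.\<close>
    obtain j where j: "j < L" "(\<Sum>v\<in>avoid n k j. \<Delta> v) \<le> K / \<Delta> [k] / L"
    proof -
      have "(\<Sum>w\<in>hit n k 0 L. \<Delta> w) \<le> 1"
        using hit_letters[OF _ kn] nonzero_of_subset by (intro sum_\<Delta>_le_1 finite_hit antichain_hit) blast
      then have "(\<Sum>w\<in>hit n k 0 L. \<Delta> w powr 1) \<le> 1" by simp
      from exists_small_avoid[OF k1 _ L0 this] obtain j where
        "j < L" "(\<Sum>v\<in>avoid n k j. \<Delta> v powr 1) \<le> (K / \<Delta> [k]) powr 1 * 1 / L" by auto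
      then show thesis using that[of j] K0 D by simp
    qed
    have nz: "0 \<notin> set w" if "set w \<subseteq> {1..n}" for w using that nonzero_of_subset by blast
    have miss_sum: "(\<Sum>w\<in>miss n k N j. \<Delta> w) \<le> K * (K / \<Delta> [k] / L)"
    proof -
      have 1: "(\<Sum>u\<in>words n N. \<Delta> u) \<le> 1"
        using wordsD by (intro sum_\<Delta>_le_1 finite_words antichain_words) blast
      have "(\<Sum>w\<in>miss n k N j. \<Delta> w) \<le> K * (\<Sum>u\<in>words n N. \<Delta> u) * (\<Sum>v\<in>avoid n k j. \<Delta> v)"
        using sum_miss_le[of 1 n k N j] K0 by simp
      also have "\<dots> \<le> K * 1 * (K / \<Delta> [k] / L)"
        using 1 j(2) K0 D by (intro mult_mono) (auto intro!: sum_nonneg mult_nonneg_nonneg)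
      finally show ?thesis by simp
    qed
    have card: "real (card W) powr (1 - ?h) \<le> \<theta>" if "W \<subseteq> hit n k N j \<union> miss n k N j" for W
    proof -
      have "card W \<le> n ^ Q"
      proof (rule card_short_words_le)
        fix w assume "w \<in> W"
        then show "set w \<subseteq> {1..n} \<and> length w < Q"
          using that hit_letters[OF _ kn, of w N j] hit_length[of w n k N j] miss_letters[of w n k N j] miss_length[of w n k N j] j(1)
          unfolding Q_def by fastforce
      qed (use elim in auto)
      then have "real (card W) \<le> real n ^ Q" by (simp flip: of_nat_power)
      then show ?thesis using elim(1) by blast
    qed
    show ?case unfolding bound_on_def
    proof (intro allI impI)
      fix x y v assume xy: "0 \<le> x" "y \<le> 1" "r \<le> y - x" and v: "set v \<subseteq> {1..n}"
      have v0: "0 \<notin> set v" using nz v by blast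
      define len where "len = \<bar>\<phi> v x - \<phi> v y\<bar>"
      have len: "0 \<le> len" by (simp add: len_def)
      note sub = \<phi>_ratio_subinterval[OF v0 xy(1,2) r xy(3), folded len_def]
      define H where "H = {w \<in> hit n k N j. \<phi> w ` J n \<inter> {x..y} \<noteq> {}}"
      define M where "M = miss n k N j"
      have fin: "finite H" "finite M" by (auto simp: H_def M_def finite_hit finite_miss)
      have H0: "0 \<notin> set w" if "w \<in> H" for w using that hit_letters[OF _ kn] nz by (auto simp: H_def)
      have M0: "0 \<notin> set w" if "w \<in> M" for w using that miss_letters nz by (auto simp: M_def)
      \<comment> \<open>Cylinders of words in \<open>H\<close> have length below \<tau> because of
        the prefix of length \<open>N\<close>, so those meeting \<open>{x..y}\<close> stay within
        \<open>{x'..y'}\<close>.\<close>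
      define x' where "x' = max 0 (x - \<tau>)"
      define y' where "y' = min 1 (y + \<tau>)"
      have xy': "0 \<le> x'" "x' \<le> x" "x - x' \<le> \<tau>" "y \<le> y'" "y' \<le> 1" "y' - y \<le> \<tau>" "x \<le> y"
        using xy \<tau> r by (auto simp: x'_def y'_def)
      have H_sum: "(\<Sum>w\<in>H. \<Delta> (v @ w)) \<le> \<theta> * len"
      proof -
        have "(\<Sum>w\<in>H. \<Delta> (v @ w)) \<le> \<bar>\<phi> v x' - \<phi> v y'\<bar>"
        proof (rule sum_\<Delta>_le[OF fin(1) _ H0 v0])
          show "antichain H" using antichain_hit[of n k N j] by (auto simp: antichain_def H_def)
          fix w assume w: "w \<in> H"
          then obtain z where z: "z \<in> J n" "\<phi> w z \<in> {x..y}" using w unfolding H_def by blast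
          then have z01: "z \<in> {0..1}" using J_unit by blast
          have "N \<le> length w" using w hit_length by (auto simp: H_def)
          then have "\<alpha> ^ length w \<le> \<alpha> ^ N" using \<alpha> by (intro power_decreasing) auto
          then have "\<alpha> ^ length w \<le> \<tau>" using N by simp
          have "\<phi> w t \<in> {x'..y'}" if t: "t \<in> {0<..<1}" for t
          proof -
            have "\<bar>\<phi> w t - \<phi> w z\<bar> \<le> \<alpha> ^ length w * \<bar>t - z\<bar>"
              using t z01 by (intro \<phi>_contraction H0[OF w]) auto
            also have "\<dots> \<le> \<tau> * 1" using \<open>\<alpha> ^ length w \<le> \<tau>\<close> t z01 \<tau> \<alpha> by (intro mult_mono) auto
            finally have "\<bar>\<phi> w t - \<phi> w z\<bar> \<le> \<tau>" by simp
            moreover have "\<phi> w t \<in> {0<..<1}" by (rule \<phi>_open[OF H0[OF w] t])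
            ultimately show ?thesis using z by (auto simp: x'_def y'_def)
          qed
          then show "\<phi> w ` {0<..<1} \<subseteq> {x'..y'}" by blast
        qed (use xy' in auto)
        also have "\<dots> \<le> \<bar>\<phi> v x' - \<phi> v x\<bar> + len + \<bar>\<phi> v y - \<phi> v y'\<bar>" by (simp add: len_def)
        also have "\<bar>\<phi> v x' - \<phi> v x\<bar> \<le> K / r * \<tau> * len"
          using xy' xy r K0 len by (intro order_trans[OF sub] mult_right_mono mult_left_mono) auto
        also have "\<bar>\<phi> v y - \<phi> v y'\<bar> \<le> K / r * \<tau> * len"
          using xy' xy r K0 len by (intro order_trans[OF sub] mult_right_mono mult_left_mono) auto
        finally show ?thesis unfolding \<tau>(2) by (simp add: field_simps)
      qed
      have M_sum: "(\<Sum>w\<in>M. \<Delta> (v @ w)) \<le> K * (K / r) * (K * (K / \<Delta> [k])) / L * len"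
      proof -
        have Dv: "\<Delta> v \<le> K / r * len" using sub[of 0 1] by (simp add: \<Delta>_def)
        have "(\<Sum>w\<in>M. \<Delta> (v @ w)) \<le> (\<Sum>w\<in>M. K * \<Delta> v * \<Delta> w)"
          by (intro sum_mono \<Delta>_append_le v0 M0)
        also have "\<dots> = K * \<Delta> v * (\<Sum>w\<in>M. \<Delta> w)" by (simp add: sum_distrib_left)
        also have "\<dots> \<le> K * (K / r * len) * (K * (K / \<Delta> [k] / L))"
          using Dv miss_sum K0 r len unfolding M_def by (intro mult_mono mult_left_mono) (auto intro!: sum_nonneg)
        finally show ?thesis by (simp add: mult_ac)
      qed
      have HR: "(\<Sum>w\<in>H. rcontent ?h (\<phi> (v @ w) ` J n)) \<le> \<theta> * (\<theta> * (\<theta> * len)) powr ?h * R"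
        unfolding R_def
      proof (rule sum_rcontent_le[OF h(1,2) fin(1) H0 v0])
        show "real (card H) powr (1 - ?h) \<le> \<theta>" by (rule card) (auto simp: H_def)
        fix w s t assume w: "w \<in> H" and st: "s \<in> {0..1::real}" "t \<in> {0..1::real}"
        have "w \<in> hit n k N j" using w by (simp add: H_def)
        then obtain w' where w': "w = w' @ [k]" using hit_last by blast
        then have "0 \<notin> set (v @ w')" using H0[OF w] v0 by auto
        then show "\<bar>\<phi> (v @ w) s - \<phi> (v @ w) t\<bar> \<le> \<theta> * \<Delta> (v @ w) * \<bar>s - t\<bar>"
          using k st unfolding good_def w' append_assoc[symmetric] by blast
      qed (use \<theta> H_sum in auto)
      have MR: "(\<Sum>w\<in>M. rcontent ?h (\<phi> (v @ w) ` J n)) \<le>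
          \<theta> * (K * (K * (K / r) * (K * (K / \<Delta> [k])) / L * len)) powr ?h * R"
        unfolding R_def
      proof (rule sum_rcontent_le[OF h(1,2) fin(2) M0 v0 _ _ _ M_sum])
        show "real (card M) powr (1 - ?h) \<le> \<theta>" by (rule card) (auto simp: M_def)
        fix w s t assume w: "w \<in> M" and st: "s \<in> {0..1::real}" "t \<in> {0..1::real}"
        show "\<bar>\<phi> (v @ w) s - \<phi> (v @ w) t\<bar> \<le> K * \<Delta> (v @ w) * \<bar>s - t\<bar>"
          using M0[OF w] v0 by (intro \<phi>_upper st) auto
      qed (use K0 in auto)
      have e1: "\<theta> * (\<theta> * (\<theta> * len)) powr ?h \<le> \<theta> ^ 3 * len powr ?h"
      proof -
        have "(\<theta> * (\<theta> * len)) powr ?h = (\<theta> * \<theta>) powr ?h * len powr ?h"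
          using \<theta> len by (simp add: powr_mult mult.assoc)
        also have "(\<theta> * \<theta>) powr ?h \<le> (\<theta> * \<theta>) powr 1"
          using \<theta> h by (intro powr_mono) (auto intro: less_imp_le less_1_mult)
        finally have "(\<theta> * (\<theta> * len)) powr ?h \<le> (\<theta> * \<theta>) * len powr ?h" using \<theta> by (simp add: mult_right_mono)
        then have "\<theta> * (\<theta> * (\<theta> * len)) powr ?h \<le> \<theta> * ((\<theta> * \<theta>) * len powr ?h)" using \<theta> by (intro mult_left_mono) auto
        then show ?thesis by (simp add: power3_eq_cube mult_ac)
      qed
      have e2: "\<theta> * (K * (K * (K / r) * (K * (K / \<Delta> [k])) / L * len)) powr ?h \<le> (\<theta> - 1) * len powr ?h"
      proof -
        have "K * (K * (K / r) * (K * (K / \<Delta> [k])) / L * len) = Y / L * len"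
          by (simp add: Y_def mult_ac)
        moreover have "(Y / L * len) powr ?h = (Y / L) powr ?h * len powr ?h"
          using Y len by (intro powr_mult)
        moreover have "(Y / L) powr ?h \<le> x0 powr ?h" using Y YL h by (intro powr_mono2) auto
        moreover have "x0 powr ?h \<le> x0 powr (1 / 2)"
        proof (rule powr_mono')
          show "x0 \<le> 1" unfolding x0_def using \<theta> by (intro power_le_one) auto
        qed (use h x0 in auto)
        moreover have "x0 powr (1 / 2) = (\<theta> - 1) / \<theta>"
          using \<theta> unfolding x0_def by (simp add: powr_half_sqrt)
        ultimately have "(K * (K * (K / r) * (K * (K / \<Delta> [k])) / L * len)) powr ?h \<le> (\<theta> - 1) / \<theta> * len powr ?h"
          by (simp only:) (intro mult_right_mono, auto)
        then have "\<theta> * (K * (K * (K / r) * (K * (K / \<Delta> [k])) / L * len)) powr ?h \<le> \<theta> * ((\<theta> - 1) / \<theta> * len powr ?h)"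
          using \<theta> by (intro mult_left_mono) auto
        also have "\<dots> = (\<theta> - 1) * len powr ?h" using \<theta> by simp
        finally show ?thesis .
      qed
      have "\<phi> v ` (J n \<inter> {x..y}) \<subseteq> (\<Union>w\<in>H \<union> M. \<phi> (v @ w) ` J n)"
      proof
        fix p assume "p \<in> \<phi> v ` (J n \<inter> {x..y})"
        then obtain z where z: "z \<in> J n" "z \<in> {x..y}" "p = \<phi> v z" by blast
        then obtain w where w: "w \<in> hit n k N j \<union> miss n k N j" "z \<in> \<phi> w ` J n"
          using J_subset_hit_miss[OF kn] by blast
        then have "w \<in> H \<union> M" using z by (auto simp: H_def M_def)
        moreover have "p \<in> \<phi> (v @ w) ` J n" using w z by auto
        ultimately show "p \<in> (\<Union>w\<in>H \<union> M. \<phi> (v @ w) ` J n)" by blast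
      qed
      moreover have bd: "bounded (\<phi> (v @ w) ` J n)" if "w \<in> H \<union> M" for w
        using that v0 H0 M0 by (intro \<phi>_J_bounded) auto
      ultimately have "rcontent ?h (\<phi> v ` (J n \<inter> {x..y})) \<le> rcontent ?h (\<Union>w\<in>H \<union> M. \<phi> (v @ w) ` J n)"
        using fin h by (intro rcontent_mono bounded_UN) auto
      also have "\<dots> \<le> (\<Sum>w\<in>H \<union> M. rcontent ?h (\<phi> (v @ w) ` J n))"
        using fin h bd by (intro rcontent_UN_le) auto
      also have "\<dots> \<le> (\<Sum>w\<in>H. rcontent ?h (\<phi> (v @ w) ` J n)) + (\<Sum>w\<in>M. rcontent ?h (\<phi> (v @ w) ` J n))"
        by (subst sum.union_inter[symmetric]) (auto simp: fin rcontent_nonneg intro: sum_nonneg)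
      also have "\<dots> \<le> \<theta> ^ 3 * len powr ?h * R + (\<theta> - 1) * len powr ?h * R"
        using e1 e2 R by (intro add_mono order_trans[OF HR] order_trans[OF MR] mult_right_mono) auto
      also have "\<dots> = (\<theta> ^ 3 + \<theta> - 1) * (len powr ?h * R)" by (simp add: algebra_simps)
      also have "\<dots> \<le> \<theta> ^ 4 * (len powr ?h * R)"
      proof (rule mult_right_mono)
        have "1 * (\<theta> - 1) \<le> \<theta> ^ 3 * (\<theta> - 1)" using \<theta> by (intro mult_right_mono one_le_power) auto
        then show "\<theta> ^ 3 + \<theta> - 1 \<le> \<theta> ^ 4" by (simp add: algebra_simps power_Suc[symmetric] numeral_eq_Suc)
      qed (use R in auto)
      finally show "rcontent ?h (\<phi> v ` (J n \<inter> {x..y})) \<le> \<theta> ^ 4 * \<bar>\<phi> v x - \<phi> v y\<bar> powr ?h * rcontent ?h (J n)"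
        by (simp add: R_def len_def mult.assoc)
    qed
  qed
qed

end

context interval_system
begin

lemma sum_\<phi>_intervals_le:
  assumes I: "finite I" "disjoint_family_on (\<lambda>i. {x i<..<y i}) I"
    and xy: "\<And>i. i \<in> I \<Longrightarrow> x i \<le> y i" "\<And>i. i \<in> I \<Longrightarrow> p \<le> x i" "\<And>i. i \<in> I \<Longrightarrow> y i \<le> q"
    and pq: "0 \<le> p" "p \<le> q" "q \<le> 1" and v: "0 \<notin> set v"
  shows "(\<Sum>i\<in>I. \<bar>\<phi> v (x i) - \<phi> v (y i)\<bar>) \<le> \<bar>\<phi> v p - \<phi> v q\<bar>"
proof -
  let ?a = "\<lambda>i. min (\<phi> v (x i)) (\<phi> v (y i))" and ?b = "\<lambda>i. max (\<phi> v (x i)) (\<phi> v (y i))"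
  have unit: "0 \<le> x i \<and> x i \<le> y i \<and> y i \<le> 1" if "i \<in> I" for i
    using xy(1)[OF that] xy(2)[OF that] xy(3)[OF that] pq by linarith
  have im: "{?a i<..<?b i} = \<phi> v ` {x i<..<y i}" if "i \<in> I" for i
    using \<phi>_image_open[OF v, of "x i" "y i"] unit[OF that] by simp
  have "(\<Sum>i\<in>I. \<bar>\<phi> v (x i) - \<phi> v (y i)\<bar>) = (\<Sum>i\<in>I. ?b i - ?a i)"
    by (intro sum.cong) auto
  also have "\<dots> \<le> max (\<phi> v p) (\<phi> v q) - min (\<phi> v p) (\<phi> v q)"
  proof (rule sum_disjoint_intervals_le[OF I(1)])
    show "disjoint_family_on (\<lambda>i. {?a i<..<?b i}) I"
      unfolding disjoint_family_on_def
    proof (intro ballI impI)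
      fix i j assume ij: "i \<in> I" "j \<in> I" "i \<noteq> j"
      have "\<phi> v ` {x i<..<y i} \<inter> \<phi> v ` {x j<..<y j} = \<phi> v ` ({x i<..<y i} \<inter> {x j<..<y j})"
        by (rule inj_on_image_Int[OF \<phi>_inj[OF v], symmetric]) (use unit[OF ij(1)] unit[OF ij(2)] in auto)
      also have "{x i<..<y i} \<inter> {x j<..<y j} = {}" using I(2) ij by (auto simp: disjoint_family_on_def)
      finally show "{?a i<..<?b i} \<inter> {?a j<..<?b j} = {}" unfolding im[OF ij(1)] im[OF ij(2)] by simp
    qed
  next
    fix i assume i: "i \<in> I"
    have "{x i<..<y i} \<subseteq> {p..q}" using xy(2)[OF i] xy(3)[OF i] by auto
    then have "{?a i<..<?b i} \<subseteq> \<phi> v ` {p..q}" unfolding im[OF i] by blast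
    then show "{?a i<..<?b i} \<subseteq> {min (\<phi> v p) (\<phi> v q)..max (\<phi> v p) (\<phi> v q)}"
      using \<phi>_image[OF v pq] by simp
  qed auto
  finally show ?thesis by (simp add: max_def min_def split: if_splits)
qed

end

context interval_system_dim
begin

text \<open>The letter \<open>i\<close> is absorbed into the word: the image under \<open>v\<close>
  of the new interval is the image under \<open>v @ [i]\<close> of the old one. So \<open>B\<close>
  is unchanged, which permits unlimited iteration.\<close>

lemma bound_on_g_image:
  assumes i: "i \<in> {1..n}" and st: "0 \<le> s" "s \<le> t" "t \<le> 1" and B: "bound_on B n s t"
  shows "bound_on B n (g i t) (g i s)"
  unfolding bound_on_def
proof (intro allI impI)
  fix v assume v: "set v \<subseteq> {1..n}"
  have "{g i t..g i s} = g i ` {s..t}" using g_image[of i s t] i st by simp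
  then have "J n \<inter> {g i t..g i s} = g i ` (J n \<inter> {s..t})"
    using J_Int_g_image[OF i, of "{s..t}"] st by simp
  then have "\<phi> v ` (J n \<inter> {g i t..g i s}) = \<phi> (v @ [i]) ` (J n \<inter> {s..t})"
    by (simp add: image_image)
  moreover have "set (v @ [i]) \<subseteq> {1..n}" using v i by simp
  ultimately have "rcontent (hdim n) (\<phi> v ` (J n \<inter> {g i t..g i s})) \<le>
      B * \<bar>\<phi> (v @ [i]) s - \<phi> (v @ [i]) t\<bar> powr hdim n * rcontent (hdim n) (J n)"
    using B unfolding bound_on_def by metis
  then show "rcontent (hdim n) (\<phi> v ` (J n \<inter> {g i t..g i s})) \<le>
      B * \<bar>\<phi> v (g i t) - \<phi> v (g i s)\<bar> powr hdim n * rcontent (hdim n) (J n)"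
    by (simp add: abs_minus_commute)
qed

text \<open>Short intervals at \<open>0\<close> are covered by the first-level cylinders with large index; the ratio condition on
  \<open>b\<close> makes the incomplete last one negligible.\<close>
lemma eventually_bound_at_0:
  assumes \<theta>: "1 < \<theta>"
  shows "\<forall>\<^sub>F n in sequentially. \<forall>t. 0 < t \<longrightarrow> t \<le> 1 \<longrightarrow> bound_on (\<theta> ^ 4) n 0 t"
proof -
  have "\<forall>\<^sub>F k in sequentially. good \<theta> k \<and> exp (C * b k) \<le> \<theta> \<and> b k \<le> \<theta> * b (Suc k)"
    using eventually_good[OF \<theta>] eventually_exp_b_le[OF \<theta>] b_ratio[OF \<theta>] by eventually_elim auto
  then obtain k0 where k0: "\<And>k. k0 \<le> k \<Longrightarrow> good \<theta> k \<and> exp (C * b k) \<le> \<theta> \<and> b k \<le> \<theta> * b (Suc k)"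
    unfolding eventually_sequentially by blast
  \<comment> \<open>\<open>k0\<close> depends only on \<theta>, so \<open>b k0\<close> is an
    admissible fixed length for the estimate on long intervals; below it all cylinders that occur
    are nearly affine.\<close>
  show ?thesis
    using eventually_bound_long[OF \<theta> b_pos[of k0]] eventually_card_powr_le[OF \<theta>, of 1] eventually_hdim_ge
  proof eventually_elim
    case (elim n)
    let ?h = "hdim n"
    have h: "0 < ?h" "?h \<le> 1" using elim(3) hdim_le_1 by auto
    show ?case
    proof (intro allI impI)
      fix t :: real assume t: "0 < t" "t \<le> 1"
      show "bound_on (\<theta> ^ 4) n 0 t"
      proof (cases "b k0 \<le> t")
        case True
        then show ?thesis using elim(1) t by auto
      next
        case False
        show ?thesis unfolding bound_on_def
        proof (intro allI impI)
          fix v assume v: "set v \<subseteq> {1..n}"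
          then have v0: "0 \<notin> set v" using nonzero_of_subset by blast
          let ?goal = "rcontent ?h (\<phi> v ` (J n \<inter> {0..t})) \<le> \<theta> ^ 4 * \<bar>\<phi> v 0 - \<phi> v t\<bar> powr ?h * rcontent ?h (J n)"
          show ?goal
          proof (cases "t < b n")
            case True
            then have "J n \<inter> {0..t} = {}" using J_ge[of _ n] by fastforce
            then have "rcontent ?h (\<phi> v ` (J n \<inter> {0..t})) = 0" using rcontent_degenerate[OF h(1), of "{}"] by simp
            then show ?thesis using \<theta> by (simp add: rcontent_nonneg)
          next
            case tn: False
            \<comment> \<open>This gives \<open>b j \<le> t < b (j - 1)\<close>: the cylinders from
              \<open>j\<close> on fill at most \<open>{0..b (j - 1)}\<close>, which exceeds
              \<open>{0..t}\<close> by a factor of at most \<theta>.\<close>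
            define j where "j = (LEAST j. b j \<le> t)"
            have jt: "b j \<le> t" unfolding j_def by (rule LeastI[of _ n]) (use tn in simp)
            have jn: "j \<le> n" unfolding j_def by (rule Least_le) (use tn in simp)
            have jk: "k0 < j" using jt False b_le[of j k0] by (cases "j \<le> k0") auto
            have jt': "t < b (j - 1)" using not_less_Least[of "j - 1" "\<lambda>j. b j \<le> t"] jk unfolding j_def[symmetric] by auto
            let ?W = "(\<lambda>i. [i]) ` {j..n}"
            have W0: "0 \<notin> set w" if "w \<in> ?W" for w using that jk by auto
            have "\<phi> v ` (J n \<inter> {0..t}) \<subseteq> (\<Union>w\<in>?W. \<phi> (v @ w) ` J n)"
            proof
              fix p assume "p \<in> \<phi> v ` (J n \<inter> {0..t})"
              then obtain z where z: "z \<in> J n" "z \<le> t" "p = \<phi> v z" by auto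
              then obtain i y where iy: "i \<in> {1..n}" "y \<in> J n" "z = g i y" using J_subset_UN by blast
              then have "b i \<le> z" using g_mem[of i y] J_unit by fastforce
              then have "b i < b (j - 1)" using z jt' by simp
              then have "j \<le> i" using b_le[of i "j - 1"] by (cases "i \<le> j - 1") auto
              then show "p \<in> (\<Union>w\<in>?W. \<phi> (v @ w) ` J n)" using iy z by auto
            qed
            moreover have bd: "bounded (\<phi> (v @ w) ` J n)" if "w \<in> ?W" for w
              using W0[OF that] v0 by (intro \<phi>_J_bounded) auto
            ultimately have "rcontent ?h (\<phi> v ` (J n \<inter> {0..t})) \<le> rcontent ?h (\<Union>w\<in>?W. \<phi> (v @ w) ` J n)"
              using h by (intro rcontent_mono bounded_UN) auto
            also have "\<dots> \<le> (\<Sum>w\<in>?W. rcontent ?h (\<phi> (v @ w) ` J n))"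
              using h bd by (intro rcontent_UN_le) auto
            \<comment> \<open>The outer \<theta> pays for the number of cylinders and the next for
              their distortion. The last two pay for enlarging \<open>t\<close> to
              \<open>b (j - 1)\<close>: one for the length ratio, one for the distortion of
              \<open>v\<close> on \<open>{0..b (j - 1)}\<close>.\<close>
            also have "\<dots> \<le> \<theta> * (\<theta> * (\<theta> * \<theta> * \<bar>\<phi> v 0 - \<phi> v t\<bar>)) powr ?h * rcontent ?h (J n)"
            proof (rule sum_rcontent_le[OF h _ W0 v0])
              have "card ?W \<le> n" using card_image_le[of "{j..n}" "\<lambda>i. [i]"] jk by simp
              then show "real (card ?W) powr (1 - ?h) \<le> \<theta>" using elim(2) by simp
              have "(\<Sum>w\<in>?W. \<Delta> (v @ w)) \<le> \<bar>\<phi> v 0 - \<phi> v (b (j - 1))\<bar>"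
              proof (rule sum_\<Delta>_le[OF _ _ W0 v0])
                show "antichain ?W" by (auto simp: antichain_def)
                fix w assume "w \<in> ?W"
                then obtain i where i: "w = [i]" "j \<le> i" by auto
                have "b (i - 1) \<le> b (j - 1)" using i(2) by (intro b_le) simp
                then have "g i x \<in> {0..b (j - 1)}" if "x \<in> {0<..<1}" for x
                  using g_mem[of i x] that i jk b_pos[of i] by auto
                then show "\<phi> w ` {0<..<1} \<subseteq> {0..b (j - 1)}" unfolding i(1) by auto
              qed (use b_le_1 b_pos in \<open>auto simp: less_imp_le\<close>)
              also have "\<dots> \<le> \<theta> * \<theta> * \<bar>\<phi> v 0 - \<phi> v t\<bar>"
              proof -
                have k1: "exp (C * b (j - 1)) \<le> \<theta>" "b (j - 1) \<le> \<theta> * b j" using k0[of "j - 1"] jk by auto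
                have "\<bar>\<phi> v 0 - \<phi> v (b (j - 1))\<bar> * \<bar>0 - t\<bar> \<le> exp (C * (b (j - 1) - 0)) * (\<bar>\<phi> v 0 - \<phi> v t\<bar> * \<bar>0 - b (j - 1)\<bar>)"
                  using jt' t b_le_1 b_pos[of "j - 1"] by (intro \<phi>_ratio[OF v0]) auto
                also have "\<dots> \<le> \<theta> * (\<bar>\<phi> v 0 - \<phi> v t\<bar> * (\<theta> * t))"
                  using k1 b_pos[of "j - 1"] \<theta> jt by (intro mult_mono) (auto intro: order_trans[OF _ mult_left_mono])
                finally show ?thesis using t by (simp add: mult_ac)
              qed
              finally show "(\<Sum>w\<in>?W. \<Delta> (v @ w)) \<le> \<theta> * \<theta> * \<bar>\<phi> v 0 - \<phi> v t\<bar>" .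
              fix w x y assume "w \<in> ?W" and xy: "x \<in> {0..1::real}" "y \<in> {0..1::real}"
              then obtain i where i: "w = [i]" "j \<le> i" by auto
              then have "good \<theta> i" using k0 jk by simp
              then show "\<bar>\<phi> (v @ w) x - \<phi> (v @ w) y\<bar> \<le> \<theta> * \<Delta> (v @ w) * \<bar>x - y\<bar>"
                using v0 xy unfolding good_def i(1) by blast
            qed (use \<theta> in auto)
            also have "\<dots> \<le> \<theta> ^ 4 * \<bar>\<phi> v 0 - \<phi> v t\<bar> powr ?h * rcontent ?h (J n)"
            proof (rule mult_right_mono[OF _ rcontent_nonneg])
              have "(\<theta> * (\<theta> * \<theta> * \<bar>\<phi> v 0 - \<phi> v t\<bar>)) powr ?h = (\<theta> ^ 3) powr ?h * \<bar>\<phi> v 0 - \<phi> v t\<bar> powr ?h"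
                using \<theta> powr_mult[of "\<theta> ^ 3" "\<bar>\<phi> v 0 - \<phi> v t\<bar>" ?h] by (simp add: power3_eq_cube mult.assoc)
              also have "\<dots> \<le> (\<theta> ^ 3) powr 1 * \<bar>\<phi> v 0 - \<phi> v t\<bar> powr ?h"
                using \<theta> h by (intro mult_right_mono powr_mono) auto
              finally have "\<theta> * (\<theta> * (\<theta> * \<theta> * \<bar>\<phi> v 0 - \<phi> v t\<bar>)) powr ?h \<le> \<theta> * ((\<theta> ^ 3) powr 1 * \<bar>\<phi> v 0 - \<phi> v t\<bar> powr ?h)"
                using \<theta> by (intro mult_left_mono) auto
              then show "\<theta> * (\<theta> * (\<theta> * \<theta> * \<bar>\<phi> v 0 - \<phi> v t\<bar>)) powr ?h \<le> \<theta> ^ 4 * \<bar>\<phi> v 0 - \<phi> v t\<bar> powr ?h"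
                using \<theta> by (simp add: numeral_eq_Suc mult.assoc)
            qed
            finally show ?thesis .
          qed
        qed
      qed
    qed
  qed
qed

lemma eventually_bound_at_1:
  assumes \<theta>: "1 < \<theta>"
  shows "\<forall>\<^sub>F n in sequentially. \<forall>t. 0 \<le> t \<longrightarrow> t < 1 \<longrightarrow> bound_on (\<theta> ^ 4) n t 1"
proof -
  \<comment> \<open>An interval starting at or below \<open>b 1\<close> is long with
    \<open>r = 1 - b 1\<close>; a shorter one lies in the image of \<open>g 1\<close>, which sends 0
    to 1.\<close>
  have "0 < 1 - b 1" using b_less[of 0 1] b_0 by simp
  from eventually_bound_long[OF \<theta> this] eventually_bound_at_0[OF \<theta>] eventually_ge_at_top[of 1]
  show ?thesis
  proof eventually_elim
    case (elim n)
    show ?case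
    proof (intro allI impI)
      fix t :: real assume t: "0 \<le> t" "t < 1"
      show "bound_on (\<theta> ^ 4) n t 1"
      proof (cases "t \<le> b 1")
        case True
        then show ?thesis using elim(1) t by auto
      next
        case False
        then have "t \<in> g 1 ` {0..1}" using image[of 1] b_0 t by auto
        then obtain s where s: "s \<in> {0..1}" "t = g 1 s" by blast
        then have "0 < s" using g_0[of 1] b_0 t by (cases "s = 0") auto
        then have "bound_on (\<theta> ^ 4) n 0 s" using elim(2) s by auto
        then have "bound_on (\<theta> ^ 4) n (g 1 s) (g 1 0)"
          using s elim(3) by (intro bound_on_g_image) auto
        then show ?thesis using g_0[of 1] b_0 s by simp
      qed
    qed
  qed
qed

text \<open>The preimage of an interval under the longest cylinder containing it is cut by the points \<open>b i\<close> into
  complete first-level cylinders and images of intervals with an endpoint \<open>0\<close> or \<open>1\<close>.\<close>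
lemma eventually_bound:
  assumes \<theta>: "1 < \<theta>"
  shows "\<forall>\<^sub>F n in sequentially. \<forall>p q. 0 \<le> p \<longrightarrow> p < q \<longrightarrow> q \<le> 1 \<longrightarrow> bound_on (\<theta> ^ 5) n p q"
  using eventually_bound_at_0[OF \<theta>] eventually_bound_at_1[OF \<theta>] eventually_card_powr_le[OF \<theta>, of 1] eventually_hdim_ge
proof eventually_elim
  case (elim n)
  let ?h = "hdim n"
  have h: "0 < ?h" "?h \<le> 1" using elim(4) hdim_le_1 by auto
  \<comment> \<open>First the intervals contained in no single first-level interval, where the
    pull-back stops.\<close>
  have direct: "bound_on (\<theta> ^ 5) n p q"
    if pq: "0 \<le> p" "p < q" "q \<le> 1" and no: "\<And>i. i \<in> {1..n} \<Longrightarrow> \<not> (b i \<le> p \<and> q \<le> b (i - 1))" for p q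
  proof -
    define x where "x i = max p (b i)" for i
    define y where "y i = min q (b (i - 1))" for i
    define I where "I = {i \<in> {1..n}. x i < y i}"
    have fin: "finite I" by (simp add: I_def)
    \<comment> \<open>Since \<open>p\<close> and \<open>q\<close> do not lie in one first-level
      interval, each piece has at least one endpoint in common with its own: the right one
      \<open>g i 0\<close>, or else the left one \<open>g i 1\<close>.\<close>
    have piece: "bound_on (\<theta> ^ 4) n (x i) (y i)" if iI: "i \<in> I" for i
    proof -
      have i: "i \<in> {1..n}" "1 \<le> i" and xy: "x i < y i" using iI by (auto simp: I_def)
      have mem: "x i \<in> g i ` {0..1}" "y i \<in> g i ` {0..1}"
        using xy unfolding image[OF i(2)] by (auto simp: x_def y_def)
      show ?thesis
      proof (cases "b (i - 1) \<le> q")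
        case True
        then have y: "y i = g i 0" using g_0[OF i(2)] by (simp add: y_def)
        obtain s where s: "s \<in> {0..1}" "x i = g i s" using mem by blast
        then have "0 < s" using xy y by (cases "s = 0") auto
        then have "bound_on (\<theta> ^ 4) n 0 s" using elim(1) s by auto
        then show ?thesis unfolding y s(2) using s by (intro bound_on_g_image i) auto
      next
        case False
        then have "p < b i" using no[OF i(1)] by auto
        then have x: "x i = g i 1" using g_1[OF i(2)] by (simp add: x_def)
        obtain s where s: "s \<in> {0..1}" "y i = g i s" using mem by blast
        then have "s < 1" using xy x by (cases "s = 1") auto
        then have "bound_on (\<theta> ^ 4) n s 1" using elim(2) s by auto
        then show ?thesis unfolding x s(2) using s by (intro bound_on_g_image i) auto
      qed
    qed
    show ?thesis unfolding bound_on_def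
    proof (intro allI impI)
      fix v assume v: "set v \<subseteq> {1..n}"
      then have v0: "0 \<notin> set v" using nonzero_of_subset by blast
      let ?d = "\<lambda>i. \<bar>\<phi> v (x i) - \<phi> v (y i)\<bar>"
      have cov: "J n \<inter> {p..q} \<subseteq> (\<Union>i\<in>I. J n \<inter> {x i..y i})"
      proof
        fix z assume z: "z \<in> J n \<inter> {p..q}"
        then obtain i u where iu: "i \<in> {1..n}" "u \<in> J n" "z = g i u" using J_subset_UN by blast
        have "u \<in> {0<..<1}" using iu J_open by blast
        then have "z \<in> {b i<..<b (i - 1)}" using g_open[of i u] iu by auto
        then have "z \<in> {x i..y i}" "x i < y i" using z pq by (auto simp: x_def y_def)
        then show "z \<in> (\<Union>i\<in>I. J n \<inter> {x i..y i})" using z iu(1) by (auto simp: I_def)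
      qed
      have bd: "bounded (\<phi> v ` (J n \<inter> {x i..y i}))" for i
        by (rule bounded_subset[OF \<phi>_J_bounded[OF v0, of n]]) auto
      have "rcontent ?h (\<phi> v ` (J n \<inter> {p..q})) \<le> rcontent ?h (\<Union>i\<in>I. \<phi> v ` (J n \<inter> {x i..y i}))"
      proof (rule rcontent_mono[OF h(1)])
        show "\<phi> v ` (J n \<inter> {p..q}) \<subseteq> (\<Union>i\<in>I. \<phi> v ` (J n \<inter> {x i..y i}))"
          unfolding image_UN[symmetric] by (rule image_mono[OF cov])
      qed (use fin bd in \<open>intro bounded_UN, auto\<close>)
      also have "\<dots> \<le> (\<Sum>i\<in>I. rcontent ?h (\<phi> v ` (J n \<inter> {x i..y i})))"
        using fin h bd by (intro rcontent_UN_le) auto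
      also have "\<dots> \<le> (\<Sum>i\<in>I. \<theta> ^ 4 * ?d i powr ?h * rcontent ?h (J n))"
        using piece v unfolding bound_on_def by (intro sum_mono) blast
      also have "\<dots> = \<theta> ^ 4 * (\<Sum>i\<in>I. ?d i powr ?h) * rcontent ?h (J n)"
        by (simp add: sum_distrib_left sum_distrib_right)
      also have "\<dots> \<le> \<theta> ^ 4 * (\<theta> * \<bar>\<phi> v p - \<phi> v q\<bar> powr ?h) * rcontent ?h (J n)"
      proof (intro mult_right_mono mult_left_mono rcontent_nonneg)
        \<comment> \<open>At exponent 1 the pieces add up to at most the whole image. Returning to
          exponent \<open>h\<close> costs \<open>card I powr (1 - h)\<close> with
          \<open>card I \<le> n\<close>, the fifth factor \<theta>.\<close>
        have "(\<Sum>i\<in>I. ?d i powr ?h) \<le> real (card I) powr (1 - ?h) * (\<Sum>i\<in>I. ?d i) powr ?h"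
          by (rule sum_powr_le_card_powr[OF fin h]) simp
        also have "\<dots> \<le> \<theta> * \<bar>\<phi> v p - \<phi> v q\<bar> powr ?h"
        proof (intro mult_mono powr_mono2)
          have "I \<subseteq> {1..n}" by (auto simp: I_def)
          then have "card I \<le> n" using card_mono[of "{1..n}" I] by simp
          then show "real (card I) powr (1 - ?h) \<le> \<theta>" using elim(3) by simp
          show "(\<Sum>i\<in>I. ?d i) \<le> \<bar>\<phi> v p - \<phi> v q\<bar>"
          proof (rule sum_\<phi>_intervals_le[OF fin _ _ _ _ pq(1) _ pq(3) v0])
            show "disjoint_family_on (\<lambda>i. {x i<..<y i}) I"
              unfolding disjoint_family_on_def
            proof (intro ballI impI)
              fix i j assume ij: "i \<in> I" "j \<in> I" "i \<noteq> j"
              then consider "i \<le> j - 1" | "j \<le> i - 1" by linarith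
              then have "y j \<le> x i \<or> y i \<le> x j"
                by cases (auto simp: x_def y_def min_le_iff_disj le_max_iff_disj dest: b_le)
              then show "{x i<..<y i} \<inter> {x j<..<y j} = {}" by auto
            qed
          qed (use pq in \<open>auto simp: x_def y_def I_def\<close>)
        qed (use h \<theta> in \<open>auto intro: sum_nonneg\<close>)
        finally show "(\<Sum>i\<in>I. ?d i powr ?h) \<le> \<theta> * \<bar>\<phi> v p - \<phi> v q\<bar> powr ?h" .
      qed (use \<theta> in auto)
      finally show "rcontent ?h (\<phi> v ` (J n \<inter> {p..q})) \<le> \<theta> ^ 5 * \<bar>\<phi> v p - \<phi> v q\<bar> powr ?h * rcontent ?h (J n)"
        by (simp add: numeral_eq_Suc mult_ac)
    qed
  qed
  \<comment> \<open>Induction along the pull-back: leaving a first-level interval lengthens the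
    interval by at least \<open>1 / \<alpha>\<close>, so it ends within \<open>l\<close> steps. At
    \<open>l = 0\<close> the interval is all of \<open>{0..1}\<close>, which fits in no first-level
    interval. The constant does not grow, by \<open>bound_on_g_image\<close>.\<close>
  have all: "bound_on (\<theta> ^ 5) n p q" if "0 \<le> p" "p < q" "q \<le> 1" "\<alpha> ^ l \<le> q - p" for l p q
    using that
  proof (induction l arbitrary: p q)
    case 0
    show ?case
    proof (rule direct)
      fix i assume "i \<in> {1..n}"
      then show "\<not> (b i \<le> p \<and> q \<le> b (i - 1))" using 0 b_pos[of i] by auto
    qed (use 0 in auto)
  next
    case (Suc l)
    show ?case
    proof (cases "\<exists>i\<in>{1..n}. b i \<le> p \<and> q \<le> b (i - 1)")
      case True
      then obtain i where i: "i \<in> {1..n}" "1 \<le> i" "b i \<le> p" "q \<le> b (i - 1)" by auto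
      then have "p \<in> g i ` {0..1}" "q \<in> g i ` {0..1}" using Suc.prems unfolding image[OF i(2)] by auto
      then obtain s t where st: "s \<in> {0..1}" "t \<in> {0..1}" "q = g i s" "p = g i t" by blast
      have lt: "s < t" using g_less_iff[OF i(2), of s t] st Suc.prems by simp
      have "\<alpha> * \<alpha> ^ l \<le> \<alpha> * (t - s)" using contraction[OF i(2) st(1,2)] st lt Suc.prems by simp
      then have "\<alpha> ^ l \<le> t - s" using \<alpha> by simp
      then have "bound_on (\<theta> ^ 5) n s t" using st lt by (intro Suc.IH) auto
      then show ?thesis unfolding st using st lt by (intro bound_on_g_image i) auto
    next
      case False
      then show ?thesis using Suc.prems by (intro direct) auto
    qed
  qed
  show ?case
  proof (intro allI impI)
    fix p q :: real assume pq: "0 \<le> p" "p < q" "q \<le> 1"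
    obtain l where "\<alpha> ^ l < q - p" using real_arch_pow_inv[of "q - p" \<alpha>] \<alpha> pq by auto
    then show "bound_on (\<theta> ^ 5) n p q" using pq by (intro all[of p q l]) auto
  qed
qed

text \<open>A mass distribution principle with the content of \<open>J n \<inter> A\<close> in place
  of a measure of \<open>A\<close>. Countable subadditivity bounds \<open>R\<close> by
  \<open>B * R\<close> times the sum of any cover, and \<open>R\<close> cancels because it is
  positive and finite.\<close>

lemma measure_J_ge:
  assumes n: "1 \<le> n" and h: "0 < hdim n" and B: "0 < B"
    and bound: "\<And>p q. 0 \<le> p \<Longrightarrow> p < q \<Longrightarrow> q \<le> 1 \<Longrightarrow> bound_on B n p q"
  shows "ennreal (1 / B) \<le> hausdorff_measure (hdim n) (J n)"
proof -
  let ?h = "hdim n"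
  define R where "R = rcontent ?h (J n)"
  have R: "0 < R" unfolding R_def by (rule content_J_pos[OF n h])
  have "ennreal (1 / B) \<le> hausdorff_content ?h (J n)"
    unfolding hausdorff_content_def
  proof (rule INF_greatest, clarify)
    fix U :: "nat \<Rightarrow> real set" assume U: "J n \<subseteq> \<Union> (range U)" "\<forall>i. bounded (U i)"
    have piece: "hausdorff_content ?h (J n \<inter> U i) \<le> ennreal (B * R) * diam_pow ?h (U i)" for i
    proof (cases "J n \<inter> U i = {}")
      case True
      then show ?thesis by (simp add: content_empty)
    next
      case False
      have bd: "bounded (J n \<inter> U i)" using J_bounded bounded_Int by blast
      obtain p q where pq: "p \<le> q" "J n \<inter> U i \<subseteq> {p..q}" "q - p \<le> diameter (J n \<inter> U i)"
        using bounded_real_subset_interval[OF bd False] .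
      \<comment> \<open>Clipping to the unit interval keeps all points of the limit set and does not
        increase the length.\<close>
      define p' where "p' = max 0 p"
      define q' where "q' = min 1 q"
      have "J n \<inter> U i \<subseteq> {p..q} \<inter> {0..1}" using pq(2) J_unit[of n] by blast
      also have "{p..q} \<inter> {0..1} = {p'..q'}" by (auto simp: p'_def q'_def)
      finally have sub: "J n \<inter> U i \<subseteq> J n \<inter> {p'..q'}" by blast
      have le: "p' \<le> q'" using sub False by fastforce
      have "diameter (J n \<inter> U i) \<le> diameter (U i)" using U by (intro diameter_subset) auto
      then have d: "q' - p' \<le> diameter (U i)" using pq le by (auto simp: p'_def q'_def)
      have "rcontent ?h (J n \<inter> U i) \<le> rcontent ?h (J n \<inter> {p'..q'})"
        using sub h J_bounded bounded_Int by (intro rcontent_mono) blast+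
      also have "\<dots> \<le> B * (q' - p') powr ?h * R"
      proof (cases "p' = q'")
        case True
        then have "rcontent ?h (J n \<inter> {p'..q'}) = 0" by (intro rcontent_degenerate[OF h, of _ p']) auto
        then show ?thesis using True by simp
      next
        case False
        then have "bound_on B n p' q'" using le by (intro bound) (auto simp: p'_def q'_def)
        then have "rcontent ?h (\<phi> [] ` (J n \<inter> {p'..q'})) \<le> B * \<bar>\<phi> [] p' - \<phi> [] q'\<bar> powr ?h * R"
          unfolding bound_on_def R_def by (metis empty_subsetI list.set(1))
        then show ?thesis using le by simp
      qed
      also have "\<dots> \<le> B * R * diameter (U i) powr ?h"
        using d le h B R by (simp add: mult_ac powr_mono2)
      finally have "ennreal (rcontent ?h (J n \<inter> U i)) \<le> ennreal (B * R * diameter (U i) powr ?h)"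
        by (rule ennreal_leI)
      moreover have "U i \<noteq> {}" using False by auto
      ultimately show ?thesis
        using h B R by (simp add: ennreal_rcontent[OF h bd] diam_pow_def ennreal_mult')
    qed
    have "ennreal R = hausdorff_content ?h (J n)" unfolding R_def by (rule ennreal_rcontent[OF h J_bounded])
    also have "\<dots> \<le> hausdorff_content ?h (\<Union>i. J n \<inter> U i)" using U by (intro content_mono) auto
    also have "\<dots> \<le> (\<Sum>i. hausdorff_content ?h (J n \<inter> U i))" by (rule content_countable_subadditive)
    also have "\<dots> \<le> (\<Sum>i. ennreal (B * R) * diam_pow ?h (U i))" by (intro suminf_le piece) auto
    also have "\<dots> = ennreal (B * R) * (\<Sum>i. diam_pow ?h (U i))" by (rule ennreal_suminf_cmult)
    finally have "ennreal R \<le> ennreal (B * R) * (\<Sum>i. diam_pow ?h (U i))" .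
    then have "ennreal (1 / (B * R)) * ennreal R \<le> ennreal (1 / (B * R)) * (ennreal (B * R) * (\<Sum>i. diam_pow ?h (U i)))"
      by (rule mult_left_mono) simp
    also have "\<dots> = (ennreal (1 / (B * R)) * ennreal (B * R)) * (\<Sum>i. diam_pow ?h (U i))" by (simp only: mult.assoc)
    also have "ennreal (1 / (B * R)) * ennreal (B * R) = 1" using B R by (simp flip: ennreal_mult')
    also have "ennreal (1 / (B * R)) * ennreal R = ennreal (1 / B)" using B R by (simp flip: ennreal_mult')
    finally show "ennreal (1 / B) \<le> (\<Sum>i. diam_pow ?h (U i))" by simp
  qed
  also have "\<dots> \<le> hausdorff_measure ?h (J n)" by (rule content_le_measure)
  finally show ?thesis .
qed

text \<open>For fixed \<theta> both bounds hold for all large \<open>n\<close>; only afterwards does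
  \<theta> tend to 1.\<close>

theorem measure_tendsto_1: "(\<lambda>n. hausdorff_measure (hdim n) (J n)) \<longlonglongrightarrow> 1"
proof -
  have bounds: "\<forall>\<^sub>F n in sequentially. ennreal (1 / \<theta> ^ 5) \<le> hausdorff_measure (hdim n) (J n) \<and>
      hausdorff_measure (hdim n) (J n) \<le> ennreal \<theta>" if \<theta>: "1 < \<theta>" for \<theta>
  proof -
    obtain k where k: "good \<theta> k" using eventually_happens'[OF _ eventually_good[OF \<theta>]] by auto
    show ?thesis
      using eventually_bound[OF \<theta>] eventually_hdim_ge eventually_ge_at_top[of "max 1 k"]
    proof eventually_elim
      case (elim n)
      then show ?case using \<theta> k by (intro conjI measure_J_ge measure_J_le[of n \<theta> k]) auto
    qed
  qed
  have lim: "((\<lambda>\<theta>. ennreal (1 / \<theta> ^ 5)) \<longlongrightarrow> ennreal (1 / 1 ^ 5)) (at_right 1)"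
    "((\<lambda>\<theta>. ennreal \<theta>) \<longlongrightarrow> ennreal 1) (at_right 1)"
    by (intro tendsto_intros tendsto_ennrealI; simp)+
  have gt: "\<forall>\<^sub>F \<theta> in at_right (1::real). 1 < \<theta>" by (rule eventually_at_right_less)
  show ?thesis
  proof (rule order_tendstoI)
    fix a :: ennreal assume "a < 1"
    then have "\<forall>\<^sub>F \<theta> in at_right 1. a < ennreal (1 / \<theta> ^ 5)" using order_tendstoD(1)[OF lim(1)] by simp
    then have "\<forall>\<^sub>F \<theta> in at_right 1. 1 < \<theta> \<and> a < ennreal (1 / \<theta> ^ 5)" using gt by eventually_elim auto
    then obtain \<theta> where "1 < \<theta>" "a < ennreal (1 / \<theta> ^ 5)"
      using eventually_happens'[OF trivial_limit_at_right_real] by blast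
    with bounds[of \<theta>] show "\<forall>\<^sub>F n in sequentially. a < hausdorff_measure (hdim n) (J n)"
      by (auto elim!: eventually_mono)
  next
    fix a :: ennreal assume "1 < a"
    then have "\<forall>\<^sub>F \<theta> in at_right 1. ennreal \<theta> < a" using order_tendstoD(2)[OF lim(2)] by simp
    then have "\<forall>\<^sub>F \<theta> in at_right 1. 1 < \<theta> \<and> ennreal \<theta> < a" using gt by eventually_elim auto
    then obtain \<theta> where "1 < \<theta>" "ennreal \<theta> < a"
      using eventually_happens'[OF trivial_limit_at_right_real] by blast
    with bounds[of \<theta>] show "\<forall>\<^sub>F n in sequentially. hausdorff_measure (hdim n) (J n) < a"
      by (auto elim!: eventually_mono)
  qed
qed

end

section \<open>Diffeomorphisms of the unit interval\<close>

text \<open>The derivative cannot vanish: the inverse is differentiable within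
  \<open>{a..b}\<close>, so the chain rule would give the identity derivative 0, against uniqueness
  of derivatives within a nondegenerate closed interval.\<close>

lemma C2_diffeo_derivatives:
  assumes diffeo: "C2_diffeo {0..1} {a..b} f" and ab: "a < b"
  defines "G \<equiv> deriv_within {0..1} f"
  shows "\<And>x. x \<in> {0..1} \<Longrightarrow> (f has_field_derivative G x) (at x within {0..1})"
    and "\<And>x. x \<in> {0..1} \<Longrightarrow> (G has_field_derivative deriv_within {0..1} G x) (at x within {0..1})"
    and "\<And>x. x \<in> {0..1} \<Longrightarrow> G x \<noteq> 0"
proof -
  have works: "(F has_field_derivative deriv_within S F x) (at x within S)"
    if "F differentiable_on S" "x \<in> S" for F S x
    using that vector_derivative_works[of F "at x within S"]
    by (simp add: differentiable_on_def deriv_within_def has_real_derivative_iff_has_vector_derivative)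
  have C2: "C2_on {0..1} f" "C2_on {a..b} (inv_into {0..1} f)" and bij: "bij_betw f {0..1} {a..b}"
    using diffeo by (auto simp: C2_diffeo_def)
  show D: "(f has_field_derivative G x) (at x within {0..1})" if "x \<in> {0..1}" for x
    using works[of f "{0..1}" x] C2(1) that by (simp add: C2_on_def G_def)
  show "(G has_field_derivative deriv_within {0..1} G x) (at x within {0..1})" if "x \<in> {0..1}" for x
    using works[of G "{0..1}" x] C2(1) that by (simp add: C2_on_def G_def)
  show "G x \<noteq> 0" if x: "x \<in> {0..1}" for x
  proof
    assume G0: "G x = 0"
    let ?i = "inv_into {0..1} f"
    have im: "f ` {0..1} = {a..b}" using bij by (simp add: bij_betw_def)
    have "f x \<in> {a..b}" using im x by blast
    then have "(?i has_field_derivative deriv_within {a..b} ?i (f x)) (at (f x) within f ` {0..1})"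
      unfolding im using C2(2) by (intro works) (auto simp: C2_on_def)
    from DERIV_image_chain[OF this D[OF x]] G0
    have "(?i \<circ> f has_field_derivative 0) (at x within {0..1})" by simp
    then have "((\<lambda>y. y) has_field_derivative 0) (at x within {0..1})"
      by (rule has_field_derivative_transform_within[where d = 1]) (use x bij in \<open>auto simp: bij_betw_def\<close>)
    then have "((\<lambda>y::real. y) has_vector_derivative 0) (at x within {0..1})"
      by (simp only: has_real_derivative_iff_has_vector_derivative)
    moreover have "((\<lambda>y::real. y) has_vector_derivative 1) (at x within {0..1})"
      by (rule has_vector_derivative_id)
    ultimately have "(0::real) = 1"
      using x by (intro vector_derivative_unique_within_closed_interval[of 0 1 x "\<lambda>y. y" 0 1]) auto
    then show False by simp
  qed
qed

lemma exists_mean_value: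
  fixes f :: "real \<Rightarrow> real"
  assumes D: "\<And>x. x \<in> {0..1} \<Longrightarrow> (f has_field_derivative G x) (at x within {0..1})"
    and sub: "{x, y} \<subseteq> {p..q}" "0 \<le> p" "q \<le> 1"
  shows "\<exists>z\<in>{p..q}. \<bar>f x - f y\<bar> = \<bar>G z\<bar> * \<bar>x - y\<bar>"
proof -
  have less: "\<exists>z\<in>{p..q}. \<bar>f x - f y\<bar> = \<bar>G z\<bar> * \<bar>x - y\<bar>" if "x < y" "{x, y} \<subseteq> {p..q}" for x y
  proof -
    have "\<exists>z\<in>{x<..<y}. f y - f x = (\<lambda>h. G z * h) (y - x)"
    proof (rule mvt_simple[OF that(1)])
      fix z assume "x \<le> z" "z \<le> y"
      then have "(f has_field_derivative G z) (at z within {x..y})"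
        using that sub by (intro has_field_derivative_subset[OF D]) auto
      then show "(f has_derivative (\<lambda>h. G z * h)) (at z within {x..y})"
        by (simp add: has_field_derivative_def)
    qed
    then obtain z where z: "z \<in> {x<..<y}" "f y - f x = G z * (y - x)" by blast
    then have "\<bar>f x - f y\<bar> = \<bar>G z\<bar> * \<bar>x - y\<bar>" by (simp add: abs_minus_commute[of "f x"] abs_minus_commute[of x] abs_mult)
    then show ?thesis using z that by (intro bexI[of _ z]) auto
  qed
  consider "x < y" | "y < x" | "x = y" by linarith
  then show ?thesis
  proof cases
    case 1
    then show ?thesis using less[of x y] sub by blast
  next
    case 2
    then show ?thesis using less[of y x] sub by (auto simp: abs_minus_commute)
  next
    case 3
    then show ?thesis using sub by auto
  qed
qed

lemma mean_value_ratio: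
  fixes f :: "real \<Rightarrow> real"
  assumes D: "\<And>x. x \<in> {0..1} \<Longrightarrow> (f has_field_derivative G x) (at x within {0..1})"
    and sub: "{x, y, u, v} \<subseteq> {p..q}" "0 \<le> p" "q \<le> 1"
    and M: "\<And>s t. s \<in> {p..q} \<Longrightarrow> t \<in> {p..q} \<Longrightarrow> \<bar>G s\<bar> \<le> M * \<bar>G t\<bar>"
  shows "\<bar>f x - f y\<bar> * \<bar>u - v\<bar> \<le> M * (\<bar>f u - f v\<bar> * \<bar>x - y\<bar>)"
proof -
  obtain s t where s: "s \<in> {p..q}" "\<bar>f x - f y\<bar> = \<bar>G s\<bar> * \<bar>x - y\<bar>"
    and t: "t \<in> {p..q}" "\<bar>f u - f v\<bar> = \<bar>G t\<bar> * \<bar>u - v\<bar>"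
    using exists_mean_value[OF D, of x y p q] exists_mean_value[OF D, of u v p q] sub by auto
  have "\<bar>G s\<bar> * (\<bar>x - y\<bar> * \<bar>u - v\<bar>) \<le> M * \<bar>G t\<bar> * (\<bar>x - y\<bar> * \<bar>u - v\<bar>)"
    by (intro mult_right_mono M s t) auto
  then show ?thesis unfolding s(2) t(2) by (simp add: mult_ac)
qed

text \<open>Squaring avoids a case distinction on the sign of \<open>G\<close>: \<open>ln (G\<^sup>2)\<close> has derivative \<open>2 * G' / G\<close>.\<close>
lemma abs_le_exp_of_log_derivative:
  fixes G :: "real \<Rightarrow> real"
  assumes D: "\<And>x. x \<in> {0..1} \<Longrightarrow> (G has_field_derivative G' x) (at x within {0..1})"
    and nz: "\<And>x. x \<in> {0..1} \<Longrightarrow> G x \<noteq> 0"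
    and c: "\<And>x. x \<in> {0..1} \<Longrightarrow> \<bar>G' x / G x\<bar> \<le> c" "0 \<le> c"
    and st: "s \<in> {p..q}" "t \<in> {p..q}" "0 \<le> p" "q \<le> 1"
  shows "\<bar>G s\<bar> \<le> exp (c * (q - p)) * \<bar>G t\<bar>"
proof -
  have st1: "s \<in> {0..1}" "t \<in> {0..1}" using st by auto
  have "norm (ln ((G s)\<^sup>2) - ln ((G t)\<^sup>2)) \<le> 2 * c * norm (s - t)"
  proof (rule field_differentiable_bound[of "{0..1}" _ "\<lambda>x. 2 * (G' x / G x)"])
    fix x :: real assume x: "x \<in> {0..1}"
    have "0 < G x * G x" using nz[OF x] by (auto simp: zero_less_mult_iff linorder_neq_iff)
    then show "((\<lambda>x. ln ((G x)\<^sup>2)) has_field_derivative 2 * (G' x / G x)) (at x within {0..1})"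
      using nz[OF x] by (auto intro!: derivative_eq_intros D x simp: power2_eq_square field_simps)
    show "norm (2 * (G' x / G x)) \<le> 2 * c" using c(1)[OF x] by (simp add: abs_mult)
  qed (use st1 in auto)
  also have "\<dots> \<le> 2 * c * (q - p)" using st c by (intro mult_left_mono) auto
  finally have le: "ln ((G s)\<^sup>2) - ln ((G t)\<^sup>2) \<le> 2 * c * (q - p)" by simp
  have "ln ((G z)\<^sup>2) = 2 * ln \<bar>G z\<bar>" if "z \<in> {0..1}" for z
    using nz[OF that] ln_realpow[of "\<bar>G z\<bar>" 2] by simp
  then have "ln \<bar>G s\<bar> \<le> c * (q - p) + ln \<bar>G t\<bar>" using le st1 by simp
  then have "exp (ln \<bar>G s\<bar>) \<le> exp (c * (q - p) + ln \<bar>G t\<bar>)" by (simp only: exp_le_cancel_iff)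
  then show ?thesis using nz[OF st1(1)] nz[OF st1(2)] by (simp add: exp_add)
qed

theorem theorem6p20:
  fixes b :: "nat \<Rightarrow> real" and g :: "nat \<Rightarrow> real \<Rightarrow> real"
  assumes b_decreasing: "strict_antimono_on UNIV b"
    and b_0: "b 0 = 1"
    and b_lim: "b \<longlonglongrightarrow> 0"
    and g_diffeo: "\<And>k. k \<ge> 1 \<Longrightarrow> C2_diffeo {0..1} {b k..b (k - 1)} (g k)"
    and g_decreasing: "\<And>k. k \<ge> 1 \<Longrightarrow> strict_antimono_on {0..1} (g k)"
    and g_extends: "\<And>k. k \<ge> 1 \<Longrightarrow> extends_C2_diffeo {0..1} (g k)"
    and i: "(\<lambda>n. (1 - hausdorff_dim (limit_set g n)) * ln (real n)) \<longlonglongrightarrow> 0"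
    and ii: "(\<lambda>n. SUP k\<in>{n..}. ereal (b k / b (k + 1))) \<longlonglongrightarrow> 1"
    and iii: "\<exists>c>0. \<forall>n\<ge>1. \<forall>x\<in>{0..1}.
                \<bar>deriv_within {0..1} (deriv_within {0..1} (g n)) x / deriv_within {0..1} (g n) x\<bar> < c"
    and iv: "(\<lambda>n. distortion {0..1} (g n)) \<longlonglongrightarrow> 1"
    and v: "\<exists>\<alpha><1. \<forall>n\<ge>1. \<forall>x\<in>{0..1}. \<bar>deriv_within {0..1} (g n) x\<bar> < \<alpha>"
  shows "(\<lambda>n. hausdorff_measure (hausdorff_dim (limit_set g n)) (limit_set g n)) \<longlonglongrightarrow> 1"
proof -
  define G where "G k = deriv_within {0..1} (g k)" for k
  obtain c where c: "0 < c" "\<And>n x. 1 \<le> n \<Longrightarrow> x \<in> {0..1} \<Longrightarrow> \<bar>deriv_within {0..1} (G n) x / G n x\<bar> < c"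
    using iii unfolding G_def by blast
  obtain \<alpha> where \<alpha>: "\<alpha> < 1" "\<And>n x. 1 \<le> n \<Longrightarrow> x \<in> {0..1} \<Longrightarrow> \<bar>G n x\<bar> < \<alpha>"
    using v unfolding G_def by blast
  have "0 < \<alpha>" using \<alpha>(2)[of 1 0] by simp
  have b_less: "b j < b i" if "i < j" for i j
    using monotone_onD[OF b_decreasing, of i j] that by simp
  have b_pos: "0 < b k" for k
  proof -
    have "0 \<le> b (Suc k)"
      by (rule LIMSEQ_le_const2[OF b_lim], intro exI[of _ "Suc k"] allI impI)
        (use b_less in \<open>auto simp: le_less\<close>)
    then show ?thesis using b_less[of k "Suc k"] by simp
  qed
  have D: "(g k has_field_derivative G k x) (at x within {0..1})"
    and D2: "(G k has_field_derivative deriv_within {0..1} (G k) x) (at x within {0..1})"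
    and nz: "G k x \<noteq> 0" if "1 \<le> k" "x \<in> {0..1}" for k x
    using C2_diffeo_derivatives[OF g_diffeo[OF that(1)] b_less, of x] that unfolding G_def by auto
  \<comment> \<open>The mean value theorem turns bounds on quotients of derivatives into the
    inequalities between difference quotients required by the locale.\<close>
  interpret interval_system_dim b g \<alpha> c
  proof
    fix k x y assume k: "1 \<le> (k::nat)" and xy: "x \<in> {0..1::real}" "y \<in> {0..1::real}"
    show "\<bar>g k x - g k y\<bar> \<le> \<alpha> * \<bar>x - y\<bar>"
      using field_differentiable_bound[of "{0..1}" "g k" "G k" \<alpha> x y] D[OF k] \<alpha>(2)[OF k] xy
      by (auto simp: less_imp_le)
    show "g k y < g k x" if "x < y" using monotone_onD[OF g_decreasing[OF k] xy that] by simp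
  next
    show "g k ` {0..1} = {b k..b (k - 1)}" if "1 \<le> k" for k
      using g_diffeo[OF that] by (simp add: C2_diffeo_def bij_betw_def)
  next
    fix k p q x y u v assume *: "1 \<le> (k::nat)" "0 \<le> (p::real)" "q \<le> 1" "{x, y, u, v} \<subseteq> {p..q}"
    show "\<bar>g k x - g k y\<bar> * \<bar>u - v\<bar> \<le> exp (c * (q - p)) * (\<bar>g k u - g k v\<bar> * \<bar>x - y\<bar>)"
    proof (rule mean_value_ratio[OF D[OF *(1)] *(4,2,3)])
      show "\<bar>G k s\<bar> \<le> exp (c * (q - p)) * \<bar>G k t\<bar>" if "s \<in> {p..q}" "t \<in> {p..q}" for s t
        using abs_le_exp_of_log_derivative[OF D2[OF *(1)] nz[OF *(1)] less_imp_le[OF c(2)[OF *(1)]] less_imp_le[OF c(1)] that *(2,3)]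
        by simp
    qed
  next
    fix \<theta> :: real assume \<theta>: "1 < \<theta>"
    have "\<forall>\<^sub>F k in sequentially. distortion {0..1} (g k) < ereal \<theta>"
      using iv \<theta> by (intro order_tendstoD(2)) auto
    then show "\<forall>\<^sub>F k in sequentially. \<forall>x y u v. {x, y, u, v} \<subseteq> {0..1} \<longrightarrow>
       \<bar>g k x - g k y\<bar> * \<bar>u - v\<bar> \<le> \<theta> * (\<bar>g k u - g k v\<bar> * \<bar>x - y\<bar>)"
      using eventually_ge_at_top[of 1]
    proof eventually_elim
      case (elim k)
      have "\<bar>G k s\<bar> \<le> \<theta> * \<bar>G k t\<bar>" if st: "s \<in> {0..1}" "t \<in> {0..1}" for s t
      proof -
        \<comment> \<open>The pair is \<open>(t, s)\<close> because \<open>distortion\<close>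
          divides by the derivative at the first component.\<close>
        have "ereal (\<bar>G k s\<bar> / \<bar>G k t\<bar>) \<le> distortion {0..1} (g k)"
          unfolding distortion_def G_def by (rule SUP_upper2[of "(t, s)"]) (use st in auto)
        then have "\<bar>G k s\<bar> / \<bar>G k t\<bar> \<le> \<theta>" using elim(1) by (metis ereal_less_eq(3) less_imp_le order_trans)
        then show ?thesis using nz[OF elim(2) st(2)] by (simp add: field_simps)
      qed
      then show ?case by (intro allI impI mean_value_ratio[OF D[OF elim(2)]]) auto
    qed
    have "\<forall>\<^sub>F n in sequentially. (SUP k\<in>{n..}. ereal (b k / b (k + 1))) < ereal \<theta>"
      using ii \<theta> by (intro order_tendstoD(2)) auto
    then show "\<forall>\<^sub>F k in sequentially. b k \<le> \<theta> * b (Suc k)"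
    proof eventually_elim
      case (elim n)
      have "ereal (b n / b (n + 1)) \<le> (SUP k\<in>{n..}. ereal (b k / b (k + 1)))" by (rule SUP_upper) simp
      then have "ereal (b n / b (n + 1)) < ereal \<theta>" using elim by (rule le_less_trans)
      then show ?case using b_pos[of "Suc n"] by (simp add: field_simps)
    qed
  qed (use b_less b_0 b_lim \<alpha>(1) \<open>0 < \<alpha>\<close> c(1) i in auto)
  show ?thesis by (rule measure_tendsto_1)
qed

end
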